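(* Let $w(n)$, $n=1,2,\ldots$, be an increasing sequence of positive numbers with $$\sum_{n=1}^\infty\frac{1}{n\,w(n)}=\infty .$$ Then $w(n)$ is not a UC-multiplier for the trigonometric system $\{e^{2\pi inx}:n=1,2,\ldots\}$. Namely, there are complex coefficients $a_n$ satisfying $\sum_{n=1}^\infty|a_n|^2w(n)<\infty$ such that the series $$\sum_{n=1}^\infty a_ne^{2\pi inx}$$ can be rearranged into an almost everywhere divergent series.
   Context: Let $\Phi=\{\phi_n:n=1,2,\ldots\}$ be an orthonormal system in $L^2(0,1)$. A sequence of positive numbers $w(n)\nearrow\infty$ is a UC-multiplier (a.e. unconditional convergence Weyl multiplier) for $\Phi$ if, whenever $\sum_{n=1}^\infty |a_n|^2w(n)<\infty$, the series $\sum_{n=1}^\infty a_n\phi_n(x)$ converges almost everywhere after any rearrangement of its terms (i.e. $\sum_n a_{\sigma(n)}\phi_{\sigma(n)}(x)$ converges a.e. for every permutation $\sigma$ of the positive integers). *)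

theory Defs
  imports "HOL-Analysis.Analysis"
begin

text \<open>
  Sequences and series are indexed by the positive integers; values at index \<open>0\<close> are never used.
\<close>

definition rearranged_partial_sum ::
    "(nat \<Rightarrow> real \<Rightarrow> complex) \<Rightarrow> (nat \<Rightarrow> complex) \<Rightarrow> (nat \<Rightarrow> nat) \<Rightarrow> real \<Rightarrow> nat \<Rightarrow> complex" where
  "rearranged_partial_sum \<phi> a \<sigma> x N = (\<Sum>n=1..N. a (\<sigma> n) * \<phi> (\<sigma> n) x)"

text \<open>
  The notion is meant for orthonormal systems \<open>\<phi>\<close> in \<open>L\<^sup>2(0,1)\<close> and weights \<open>w\<close> that are positive
  and increase to infinity. These restrictions on the arguments are deliberately not conjuncts of
  the predicate: otherwise its negation would hold trivially outside that range, for instance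
  for every bounded weight.
\<close>

definition UC_multiplier :: "(nat \<Rightarrow> real \<Rightarrow> complex) \<Rightarrow> (nat \<Rightarrow> real) \<Rightarrow> bool" where
  "UC_multiplier \<phi> w \<longleftrightarrow>
     (\<forall>a :: nat \<Rightarrow> complex. (\<lambda>n. (cmod (a n))\<^sup>2 * w n) summable_on {1..} \<longrightarrow>
       (\<forall>\<sigma>. bij_betw \<sigma> {1..} {1..} \<longrightarrow>
         (AE x in lebesgue_on {0<..<1}. convergent (rearranged_partial_sum \<phi> a \<sigma> x))))"

definition trig_system :: "nat \<Rightarrow> real \<Rightarrow> complex" where
  "trig_system n x = exp (2 * of_real pi * \<i> * of_nat n * of_real x)"

end

theory Submission
  imports Defs "HOL-Probability.Probability_Measure"
begin

text \<open>
  For the Haar system one lists the functions of the dyadic tree in symmetric (in-order) fashion.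
  The prefix ending at the position of \<open>x\<close> then contains, among the nodes whose cell contains \<open>x\<close>,
  precisely those where the path of \<open>x\<close> turns right, which are those that are positive at \<open>x\<close>. So the
  prefix and the remaining suffix have sums \<open>R\<close> and \<open>-(1 - R)\<close> if the coefficients \<open>c\<^sub>k\<close> of the levels
  in a block add up to \<open>1\<close>, and they cannot both be small. If \<open>c\<^sub>k\<close> belongs to frequencies up to
  \<open>2\<^bsup>G(k+1)\<^esup>\<close>, then \<open>c\<^sub>k\<close> may be chosen with \<open>\<Sum> c\<^sub>k\<^sup>2 w(2\<^bsup>G(k+1)\<^esup>) < \<infinity>\<close> because \<open>\<Sum> 1 / w(2\<^bsup>G(k+1)\<^esup>)\<close>
  diverges by condensation.

  To imitate this with exponentials, node \<open>q\<close> (with children \<open>2q\<close> and \<open>2q + 1\<close>) carries a square wave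
  of frequency \<open>m(q)\<close> and phase \<open>\<theta>(q)\<close>, which splits the cell of \<open>q\<close> according to its sign. The
  product of the indicator of a cell on level \<open>k\<close> with its wave is approximated in \<open>L\<^sup>2\<close> with error
  \<open>4\<^bsup>-(k+1)\<^esup>\<close> by a trigonometric polynomial with only \<open>2\<^bsup>O(k)\<^esup>\<close> frequencies: a Fourier block of size
  \<open>8\<^sup>l\<close> of the new wave is combined with an approximant of the old cell of precision index \<open>r - l\<close> only.
  Averaging over \<open>\<theta>(q)\<close> replaces the arithmetic independence of the frequencies in the error estimate,
  so the \<open>m(q)\<close> are free to be chosen greedily, of size \<open>2\<^bsup>O(k)\<^esup>\<close>, with the frequency sets of different
  nodes disjoint.
\<close>

section \<open>Frequency sets on the heap-indexed binary tree\<close>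

text \<open>Heap numbering: the root is 1 and level k consists of the numbers from 2^k to 2^(k+1) -
  1. Index 0 shares the base case and is never a node.\<close>

fun tree_level :: "nat \<Rightarrow> nat" where
  "tree_level q = (if q \<le> 1 then 0 else Suc (tree_level (q div 2)))"

declare tree_level.simps [simp del]

lemma tree_level_simps [simp]:
  "tree_level (Suc 0) = 0"
  "q \<ge> 1 \<Longrightarrow> b \<le> 1 \<Longrightarrow> tree_level (2 * q + b) = Suc (tree_level q)"
  by (simp_all add: tree_level.simps[of "Suc 0"] tree_level.simps[of "2 * q + b"])

text \<open>Every q > 1 is \<open>2 * (q div 2) + q mod 2\<close>, so writing a child as
  \<open>2 * q + b\<close> with a bit b treats left and right children in one case.\<close>

lemma heap_induct [consumes 1, case_names root child]:
  fixes q :: nat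
  assumes "q \<ge> 1" "Q 1" "\<And>q b. q \<ge> 1 \<Longrightarrow> b \<le> 1 \<Longrightarrow> Q q \<Longrightarrow> Q (2 * q + b)"
  shows "Q q"
  using assms(1)
proof (induction q rule: less_induct)
  case (less q)
  show ?case
  proof (cases "q = 1")
    case False
    then have "Q (2 * (q div 2) + q mod 2)"
      using less by (intro assms(3)) auto
    then show ?thesis
      by simp
  qed (use assms in simp)
qed

lemma tree_level_bounds:
  assumes "q \<ge> 1"
  shows "2 ^ tree_level q \<le> q" "q < 2 ^ Suc (tree_level q)"
proof -
  have "2 ^ tree_level q \<le> q \<and> q < 2 ^ Suc (tree_level q)"
    using assms by (induction q rule: heap_induct) auto
  then show "2 ^ tree_level q \<le> q" "q < 2 ^ Suc (tree_level q)"
    by auto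
qed

lemma tree_level_eq_iff: "q \<ge> 1 \<Longrightarrow> tree_level q = k \<longleftrightarrow> q \<in> {2 ^ k..<2 ^ Suc k}"
proof
  assume q: "q \<ge> 1" "q \<in> {2 ^ k..<2 ^ Suc k}"
  note b = tree_level_bounds[OF q(1)]
  from b q(2) have "(2::nat) ^ tree_level q < 2 ^ Suc k" "(2::nat) ^ k < 2 ^ Suc (tree_level q)"
    by auto
  then have "tree_level q < Suc k" "k < Suc (tree_level q)"
    by (simp_all only: power_strict_increasing_iff one_less_numeral_iff semiring_norm)
  then show "tree_level q = k"
    by simp
qed (use tree_level_bounds[of q] in auto)

lemma tree_level_mono:
  assumes "1 \<le> p" "p \<le> q"
  shows "tree_level p \<le> tree_level q"
proof -
  have "(2::nat) ^ tree_level p < 2 ^ Suc (tree_level q)"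
    using tree_level_bounds[of p] tree_level_bounds[of q] assms by linarith
  then have "tree_level p < Suc (tree_level q)"
    by (simp only: power_strict_increasing_iff one_less_numeral_iff semiring_norm)
  then show ?thesis
    by simp
qed

text \<open>The truncated differences add up to \<open>\<bar>n - (2 * j + 1) * \<mu>\<bar>\<close>; a frequency and its negative are
  identified because only real parts are considered.\<close>

definition freq_step :: "(nat \<Rightarrow> nat set) \<Rightarrow> nat \<Rightarrow> nat \<Rightarrow> nat set" where
  "freq_step S \<mu> r = (\<Union>l\<in>{..r}. \<Union>n\<in>S (r - l). \<Union>j\<in>{..<8 ^ l}.
     {n + (2 * j + 1) * \<mu>, (n - (2 * j + 1) * \<mu>) + ((2 * j + 1) * \<mu> - n)})"

text \<open>Frequencies of the approximant of a cell at precision r. The root cell is everything, so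
  only the constant occurs. A child's indicator is half the sum or difference of its parent's
  indicator and wave, hence the union.\<close>

fun cell_freqs :: "(nat \<Rightarrow> nat) \<Rightarrow> nat \<Rightarrow> nat \<Rightarrow> nat set" where
  "cell_freqs m q = (if q \<le> 1 then (\<lambda>r. {0})
     else (\<lambda>r. cell_freqs m (q div 2) r \<union> freq_step (cell_freqs m (q div 2)) (m (q div 2)) r))"

declare cell_freqs.simps [simp del]

lemma cell_freqs_simps [simp]:
  "cell_freqs m (Suc 0) r = {0}"
  "q \<ge> 1 \<Longrightarrow> b \<le> 1 \<Longrightarrow> cell_freqs m (2 * q + b) r = cell_freqs m q r \<union> freq_step (cell_freqs m q) (m q) r"
  by (simp_all add: cell_freqs.simps[of m "Suc 0"] cell_freqs.simps[of m "2 * q + b"])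

lemma finite_freq_step: "(\<And>r. finite (S r)) \<Longrightarrow> finite (freq_step S \<mu> r)"
  unfolding freq_step_def by blast

text \<open>Geometric sum of ratio 1/2, in additive form to avoid subtraction of natural
  numbers.\<close>

lemma sum_8_16: "(\<Sum>l\<le>r. 8 ^ l * 16 ^ (r - l)) + 8 ^ r = (2 * 16 ^ r :: nat)"
proof (induction r)
  case (Suc r)
  have "(\<Sum>l\<le>Suc r. 8 ^ l * 16 ^ (Suc r - l)) = (\<Sum>l\<le>r. 16 * (8 ^ l * 16 ^ (r - l))) + (8::nat) ^ Suc r"
    by (auto simp: Suc_diff_le intro!: sum.cong)
  also have "(\<Sum>l\<le>r. 16 * (8 ^ l * 16 ^ (r - l))) = (16::nat) * (\<Sum>l\<le>r. 8 ^ l * 16 ^ (r - l))"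
    by (simp add: sum_distrib_left)
  finally show ?case
    using Suc by simp
qed simp

text \<open>For each l there are at most K 16^(r-l) old frequencies, 8^l odd multipliers and two
  results. The faster growth 16 in the precision absorbs the 8^l of the wave, so the geometric sum
  costs a factor independent of r.\<close>

lemma card_freq_step_le:
  assumes fin: "\<And>r. finite (S r)" and card: "\<And>r. card (S r) \<le> K * 16 ^ r"
  shows "card (freq_step S \<mu> r) \<le> 4 * K * 16 ^ r"
proof -
  have two: "card {a, b :: nat} \<le> 2" for a b
    by (simp add: card_insert_if)
  have "card (freq_step S \<mu> r) \<le> (\<Sum>l\<le>r. card (\<Union>n\<in>S (r - l). \<Union>j\<in>{..<8 ^ l}.
     {n + (2 * j + 1) * \<mu>, (n - (2 * j + 1) * \<mu>) + ((2 * j + 1) * \<mu> - n)}))"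
    unfolding freq_step_def by (rule card_UN_le) simp
  also have "\<dots> \<le> (\<Sum>l\<le>r. \<Sum>n\<in>S (r - l). \<Sum>j<(8::nat) ^ l. 2)"
    by (intro sum_mono order.trans[OF card_UN_le] fin two) (auto simp: fin)
  also have "\<dots> = (\<Sum>l\<le>r. card (S (r - l)) * (2 * 8 ^ l))"
    by (simp add: mult.commute)
  also have "\<dots> \<le> (\<Sum>l\<le>r. (K * 16 ^ (r - l)) * (2 * 8 ^ l))"
    by (intro sum_mono mult_right_mono card) simp
  also have "\<dots> = 2 * K * (\<Sum>l\<le>r. 8 ^ l * 16 ^ (r - l))"
    by (simp add: sum_distrib_left mult_ac)
  also have "\<dots> \<le> 2 * K * (2 * 16 ^ r)"
    using sum_8_16[of r] by (intro mult_left_mono) auto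
  finally show ?thesis
    by simp
qed

lemma finite_spec: "q \<ge> 1 \<Longrightarrow> finite (cell_freqs m q r)"
  by (induction q arbitrary: r rule: heap_induct) (auto intro: finite_freq_step)

text \<open>A step multiplies the constant by at most 1 + 4 = 5, rounded up to 8 so that all counts
  stay powers of 2.\<close>

lemma card_spec_le: "q \<ge> 1 \<Longrightarrow> card (cell_freqs m q r) \<le> 8 ^ tree_level q * 16 ^ r"
proof (induction q arbitrary: r rule: heap_induct)
  case root
  then show ?case by simp
next
  case (child q b)
  have "card (cell_freqs m (2 * q + b) r) \<le> card (cell_freqs m q r) + card (freq_step (cell_freqs m q) (m q) r)"
    using child by (simp add: card_Un_le)
  also have "\<dots> \<le> 8 ^ tree_level q * 16 ^ r + 4 * 8 ^ tree_level q * 16 ^ r"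
    by (intro add_mono card_freq_step_le finite_spec child)
  finally show ?case
    using child by simp
qed

text \<open>Only proper ancestors enter, and these have smaller numbers; this permits a choice of
  \<open>m\<close> by recursion on q.\<close>

lemma cell_freqs_cong:
  assumes "q \<ge> 1" "\<And>p. p < q \<Longrightarrow> m p = m' p"
  shows "cell_freqs m q = cell_freqs m' q"
  using assms
proof (induction q rule: heap_induct)
  case root
  then show ?case by (auto simp: fun_eq_iff)
next
  case (child q b)
  then have *: "cell_freqs m q = cell_freqs m' q" "m q = m' q" by auto
  show ?case using child.hyps by (simp add: fun_eq_iff *)
qed

lemma freq_step_le:
  assumes "\<And>r n. n \<in> S r \<Longrightarrow> n \<le> X * 8 ^ r" and "n \<in> freq_step S \<mu> r"
  shows "n \<le> (X + 2 * \<mu>) * 8 ^ r"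
proof -
  obtain l n' j where h: "l \<le> r" "n' \<in> S (r - l)" "j < 8 ^ l" "n \<le> n' + (2 * j + 1) * \<mu>"
    using assms(2) unfolding freq_step_def by fastforce
  have "n' \<le> X * 8 ^ (r - l)"
    using assms(1) h(2) .
  also have "\<dots> \<le> X * 8 ^ r"
    by (intro mult_left_mono power_increasing) auto
  finally have 1: "n' \<le> X * 8 ^ r" .
  have "2 * j + 1 \<le> 2 * 8 ^ l"
    using h(3) by simp
  also have "\<dots> \<le> 2 * 8 ^ r"
    using h(1) by (intro mult_left_mono power_increasing) auto
  finally have "(2 * j + 1) * \<mu> \<le> 2 * 8 ^ r * \<mu>"
    by (rule mult_right_mono) simp
  with 1 h(4) show ?thesis
    by (simp add: algebra_simps)
qed

text \<open>Passing to a child adds 2 m(q) to the leading factor, so it grows at most threefold, far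
  less than the 2^95 granted by one more level.\<close>

lemma cell_freqs_le:
  assumes "q \<ge> 1" "\<And>p. 1 \<le> p \<Longrightarrow> p < q \<Longrightarrow> m p \<le> 2 ^ (95 * (tree_level p + 1))" "n \<in> cell_freqs m q r"
  shows "n \<le> 2 ^ (95 * (tree_level q + 1)) * 8 ^ r"
  using assms
proof (induction q arbitrary: n r rule: heap_induct)
  case root
  then show ?case by simp
next
  case (child q b)
  have IH: "n \<le> 2 ^ (95 * (tree_level q + 1)) * 8 ^ r" if "n \<in> cell_freqs m q r" for n r
    using child that by auto
  have "n \<le> (2 ^ (95 * (tree_level q + 1)) + 2 * m q) * 8 ^ r"
  proof (cases "n \<in> cell_freqs m q r")
    case True
    then show ?thesis
      using IH[OF True] by (simp add: algebra_simps)
  next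
    case False
    then show ?thesis
      using child.prems(2) child.hyps IH by (intro freq_step_le) auto
  qed
  also have "\<dots> \<le> (2 ^ (95 * (tree_level q + 1)) + 2 * 2 ^ (95 * (tree_level q + 1))) * 8 ^ r"
    using child.prems(1)[of q] child.hyps by (intro mult_right_mono add_left_mono mult_left_mono) auto
  also have "\<dots> \<le> (4 * 2 ^ (95 * (tree_level q + 1))) * 8 ^ r"
    by (intro mult_right_mono) auto
  also have "\<dots> = 2 ^ (95 * (tree_level q + 1) + 2) * 8 ^ r"
    by (simp add: power_add)
  also have "\<dots> \<le> 2 ^ (95 * (tree_level (2 * q + b) + 1)) * 8 ^ r"
    using child by (intro mult_right_mono power_increasing) auto
  finally show ?case .
qed

text \<open>The precision index \<open>8 * (k + 1)\<close> on level \<open>k\<close> beats the growth of the energy: the squared error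
  becomes \<open>16\<^bsup>k+1\<^esup> / 2\<^bsup>8(k+1)\<^esup> = 16\<^bsup>-(k+1)\<^esup>\<close>.\<close>

definition node_freqs :: "(nat \<Rightarrow> nat) \<Rightarrow> nat \<Rightarrow> nat set" where
  "node_freqs m q = freq_step (cell_freqs m q) (m q) (8 * (tree_level q + 1))"

lemma finite_node_freqs: "q \<ge> 1 \<Longrightarrow> finite (node_freqs m q)"
  unfolding node_freqs_def by (intro finite_freq_step finite_spec)

text \<open>Each triple of a frequency \<open>u\<close>, a frequency \<open>n\<close> and an odd multiplier excludes at most
  three values of \<open>\<mu>\<close>.\<close>

lemma freq_step_avoid:
  assumes fin: "\<And>r. finite (S r)" "finite T" and card: "\<And>r. card (S r) \<le> K * 16 ^ r" "card T \<le> N"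
    and T: "T \<noteq> {}" and M: "6 * K * 16 ^ r * 8 ^ r * N \<le> M"
  shows "\<exists>\<mu>\<le>M. freq_step S \<mu> r \<inter> T = {}"
proof -
  define B where "B = (\<Union>i\<in>{..r}. \<Union>n\<in>S i. \<Union>u\<in>T. \<Union>j\<in>{..<8 ^ r}.
    {(n + u) div (2 * j + 1), (n - u) div (2 * j + 1), (u - n) div (2 * j + 1)})"
  have bad: "\<mu> \<in> B" if mu: "freq_step S \<mu> r \<inter> T \<noteq> {}" for \<mu>
  proof -
    obtain l n j u where h: "l \<le> r" "n \<in> S (r - l)" "j < 8 ^ l" "u \<in> T"
      "u = n + (2 * j + 1) * \<mu> \<or> u = (n - (2 * j + 1) * \<mu>) + ((2 * j + 1) * \<mu> - n)"
      using mu unfolding freq_step_def by blast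
    have "(8::nat) ^ l \<le> 8 ^ r"
      using h(1) by (intro power_increasing) auto
    then have j: "j < 8 ^ r"
      using h(3) by linarith
    have "n + u = (2 * j + 1) * \<mu> \<or> n - u = (2 * j + 1) * \<mu> \<or> u - n = (2 * j + 1) * \<mu>"
      using h(5) by arith
    then have "\<mu> \<in> {(n + u) div (2 * j + 1), (n - u) div (2 * j + 1), (u - n) div (2 * j + 1)}"
      by (metis (no_types) insertI1 insertI2 nonzero_mult_div_cancel_left add_is_0 one_neq_zero)
    moreover have "r - l \<in> {..r}" "j \<in> {..<8 ^ r}"
      using j by auto
    ultimately show ?thesis
      unfolding B_def UN_iff using h(2,4) by (metis (no_types, lifting))
  qed
  have finB: "finite B"
    unfolding B_def using fin by blast
  have three: "card {a, b, c :: nat} \<le> 3" for a b c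
    by (simp add: card_insert_if)
  have "card B \<le> (\<Sum>i\<le>r. card (\<Union>n\<in>S i. \<Union>u\<in>T. \<Union>j\<in>{..<8 ^ r}.
    {(n + u) div (2 * j + 1), (n - u) div (2 * j + 1), (u - n) div (2 * j + 1)}))"
    unfolding B_def by (rule card_UN_le) simp
  also have "\<dots> \<le> (\<Sum>i\<le>r. \<Sum>n\<in>S i. \<Sum>u\<in>T. \<Sum>j<(8::nat) ^ r. 3)"
    by (intro sum_mono order.trans[OF card_UN_le] fin three) auto
  also have "\<dots> = (\<Sum>i\<le>r. card (S i)) * (3 * 8 ^ r * card T)"
    by (simp add: sum_distrib_right sum_distrib_left mult_ac)
  also have "\<dots> \<le> (\<Sum>i\<le>r. K * 16 ^ i) * (3 * 8 ^ r * N)"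
    by (intro mult_mono sum_mono card order_refl) auto
  also have "(\<Sum>i\<le>r. K * 16 ^ i) \<le> 2 * K * 16 ^ r"
  proof (induction r)
    case (Suc r)
    then show ?case by simp
  qed simp
  also have "2 * K * 16 ^ r * (3 * 8 ^ r * N) \<le> M"
    using M by (simp add: mult_ac)
  finally have "card B \<le> M"
    by simp
  \<comment> \<open>\<open>{..M}\<close> has M + 1 elements, one more than the bound on the number
    of excluded values.\<close>
  then have "\<not> {..M} \<subseteq> B"
    using card_mono[OF finB, of "{..M}"] by auto
  then show ?thesis
    using bad by blast
qed

text \<open>On level \<open>k\<close> fewer than \<open>2\<^bsup>36k+35\<^esup>\<close> frequencies have been used before, which together with the at
  most \<open>8\<^sup>k 16\<^sup>r\<close> old frequencies of each precision and \<open>8\<^sup>r\<close> odd multipliers, \<open>r = 8(k + 1)\<close>, rules out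
  fewer than \<open>2\<^bsup>95(k+1)\<^esup>\<close> values of \<open>m q\<close>.\<close>

lemma node_freqs_exist:
  "\<exists>m. \<forall>q\<ge>1. m q \<le> 2 ^ (95 * (tree_level q + 1)) \<and> 0 \<notin> node_freqs m q \<and>
     (\<forall>p. 1 \<le> p \<and> p < q \<longrightarrow> node_freqs m p \<inter> node_freqs m q = {})"
proof -
  \<comment> \<open>Counting 0 as used keeps the constant out of every node: only positive indices
    are available, and the energy formula is for nonzero frequencies.\<close>
  define Used where "Used m q = insert 0 (\<Union>p\<in>{1..<q}. node_freqs m p)" for m q
  define Q where "Q f q \<mu> \<longleftrightarrow> (q \<ge> 1 \<longrightarrow> \<mu> \<le> 2 ^ (95 * (tree_level q + 1)) \<and>
    freq_step (cell_freqs f q) \<mu> (8 * (tree_level q + 1)) \<inter> Used f q = {})" for f :: "nat \<Rightarrow> nat" and q \<mu> :: nat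
  \<comment> \<open>Recursive choice along the numbering of the nodes: admissibility of a value at q
    depends only on \<open>f\<close> below q, and an admissible value always exists.\<close>
  have "\<exists>m. \<forall>q. Q m q (m q)"
  proof (rule dependent_wellorder_choice)
    fix r :: nat and f g :: "nat \<Rightarrow> nat" and q :: nat
    assume fg: "\<And>y. y < q \<Longrightarrow> f y = g y"
    show "Q f q r = Q g q r"
    proof (cases "q \<ge> 1")
      case True
      have s: "cell_freqs f p = cell_freqs g p" if "1 \<le> p" "p \<le> q" for p
        using that fg by (intro cell_freqs_cong) auto
      then have "Used f q = Used g q"
        using fg unfolding Used_def node_freqs_def by (auto simp: fg)
      then show ?thesis
        unfolding Q_def using s[of q] True by simp
    qed (simp add: Q_def)
  next
    fix q f
    show "\<exists>\<mu>. Q f q \<mu>"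
    proof (cases "q \<ge> 1")
      case True
      define k where "k = tree_level q"
      have "card (Used f q) \<le> 1 + card (\<Union>p\<in>{1..<q}. node_freqs f p)"
        unfolding Used_def by (simp add: card_insert_if finite_node_freqs)
      also have "card (\<Union>p\<in>{1..<q}. node_freqs f p) \<le> (\<Sum>p\<in>{1..<q}. card (node_freqs f p))"
        by (rule card_UN_le) simp
      also have "\<dots> \<le> (\<Sum>p\<in>{1..<q}. 2 ^ (35 * k + 34))"
      proof (intro sum_mono)
        fix p assume p: "p \<in> {1..<q}"
        have "card (node_freqs f p) \<le> 4 * 8 ^ tree_level p * 16 ^ (8 * (tree_level p + 1))"
          unfolding node_freqs_def using p by (intro card_freq_step_le finite_spec card_spec_le) auto
        also have "\<dots> = 2 ^ (35 * tree_level p + 34)"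
        proof -
          have "(8::nat) ^ tree_level p = 2 ^ (3 * tree_level p)" "(16::nat) ^ (8 * (tree_level p + 1))
              = 2 ^ (32 * (tree_level p + 1))"
            by (simp_all add: power_mult power_add)
          moreover have "(4::nat) * 2 ^ a * 2 ^ b = 2 ^ (2 + a + b)" for a b
            by (simp add: power_add)
          ultimately show ?thesis
            by (simp only: ) (rule arg_cong[of _ _ "\<lambda>x. 2 ^ x"], simp)
        qed
        also have "\<dots> \<le> 2 ^ (35 * k + 34)"
          using tree_level_mono[of p q] p unfolding k_def by (intro power_increasing) auto
        finally show "card (node_freqs f p) \<le> 2 ^ (35 * k + 34)" .
      qed
      also have "\<dots> = (q - 1) * 2 ^ (35 * k + 34)"
        by simp
      also have "1 + (q - 1) * 2 ^ (35 * k + 34) \<le> q * 2 ^ (35 * k + 34)"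
        using True by (cases q) auto
      also have "\<dots> \<le> 2 ^ (k + 1) * 2 ^ (35 * k + 34)"
        using tree_level_bounds[OF True] unfolding k_def by (intro mult_right_mono) auto
      also have "\<dots> = 2 ^ (36 * k + 35)"
        unfolding power_add[symmetric] by (rule arg_cong[of _ _ "\<lambda>x. 2 ^ x"]) simp
      finally have cU: "card (Used f q) \<le> 2 ^ (36 * k + 35)"
        by simp
      have *: "\<exists>\<mu>\<le>2 ^ (95 * (k + 1)). freq_step (cell_freqs f q) \<mu> (8 * (k + 1)) \<inter> Used f q = {}"
      proof (rule freq_step_avoid[where K = "8 ^ k" and N = "2 ^ (36 * k + 35)"])
        show "finite (Used f q)"
          unfolding Used_def by (auto intro: finite_node_freqs)
        have "6 * 8 ^ k * 16 ^ (8 * (k + 1)) * 8 ^ (8 * (k + 1)) * 2 ^ (36 * k + 35)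
           \<le> (8 * 8 ^ k * 16 ^ (8 * (k + 1)) * 8 ^ (8 * (k + 1)) * 2 ^ (36 * k + 35) :: nat)"
          by (intro mult_right_mono) auto
        also have "\<dots> = 2 ^ (3 + 3 * k + 32 * (k + 1) + 24 * (k + 1) + (36 * k + 35))"
          unfolding power_add power_mult by simp
        also have "\<dots> \<le> 2 ^ (95 * (k + 1))"
          by (intro power_increasing) auto
        finally show "6 * 8 ^ k * 16 ^ (8 * (k + 1)) * 8 ^ (8 * (k + 1)) * 2 ^ (36 * k + 35)
            \<le> (2 ^ (95 * (k + 1)) :: nat)" .
      qed (use True cU in \<open>auto simp: finite_spec card_spec_le Used_def k_def\<close>)
      then show ?thesis
        unfolding Q_def k_def using True by auto
    qed (simp add: Q_def)
  qed
  then obtain m where m: "\<And>q. Q m q (m q)"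
    by blast
  have "m q \<le> 2 ^ (95 * (tree_level q + 1)) \<and> node_freqs m q \<inter> Used m q = {}" if "q \<ge> 1" for q
    using m[of q] that unfolding Q_def node_freqs_def by auto
  then show ?thesis
    unfolding Used_def by (intro exI[of _ m]) force
qed

text \<open>8^(8(k+1)) contributes 24(k+1) to the exponent and the factor 4 contributes 2; together
  with 95(k+1) this is at most 121(k+1). The same 121 is the spacing of the exponents in the
  condensation step.\<close>

lemma node_freqs_le:
  assumes "q \<ge> 1" "\<And>p. p \<ge> 1 \<Longrightarrow> m p \<le> 2 ^ (95 * (tree_level p + 1))" "n \<in> node_freqs m q"
  shows "n \<le> 2 ^ (121 * (tree_level q + 1))"
proof -
  have "n \<le> (2 ^ (95 * (tree_level q + 1)) + 2 * m q) * 8 ^ (8 * (tree_level q + 1))"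
    using assms by (intro freq_step_le[OF cell_freqs_le]) (auto simp: node_freqs_def)
  also have "\<dots> \<le> (4 * 2 ^ (95 * (tree_level q + 1))) * 8 ^ (8 * (tree_level q + 1))"
    using assms(2)[OF assms(1)] by (intro mult_right_mono) auto
  also have "\<dots> = 2 ^ (2 + 95 * (tree_level q + 1) + 24 * (tree_level q + 1))"
    unfolding power_add power_mult by simp
  also have "\<dots> \<le> 2 ^ (121 * (tree_level q + 1))"
    by (intro power_increasing) auto
  finally show ?thesis .
qed

section \<open>Trigonometric polynomials and the square wave\<close>

lemma trig_system_cis: "trig_system n x = cis (2 * pi * real n * x)"
  by (simp add: trig_system_def cis_conv_exp mult_ac)

text \<open>A complex coefficient encodes amplitude and phase, so sines and cosines are both
  covered. Taking real parts makes nonnegative frequencies sufficient for real functions.\<close>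

definition trig_poly :: "nat set \<Rightarrow> (real \<Rightarrow> real) \<Rightarrow> bool" where
  "trig_poly S f \<longleftrightarrow> (\<exists>a. \<forall>x. f x = (\<Sum>n\<in>S. Re (a n * trig_system n x)))"

lemma trig_poly_mono:
  assumes "trig_poly S f" "S \<subseteq> T" "finite T"
  shows "trig_poly T f"
proof -
  obtain a where "\<And>x. f x = (\<Sum>n\<in>S. Re (a n * trig_system n x))"
    using assms unfolding trig_poly_def by blast
  moreover have "(\<Sum>n\<in>S. Re (a n * trig_system n x))
      = (\<Sum>n\<in>T. Re ((if n \<in> S then a n else 0) * trig_system n x))" for x
    using assms by (intro sum.mono_neutral_cong_left) auto
  ultimately show ?thesis
    unfolding trig_poly_def by (intro exI[of _ "\<lambda>n. if n \<in> S then a n else 0"]) simp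
qed

lemma trig_poly_single: "trig_poly {n} (\<lambda>x. Re (z * trig_system n x))"
  unfolding trig_poly_def by (intro exI[of _ "\<lambda>_. z"]) simp

lemma trig_poly_add:
  assumes "trig_poly S f" "trig_poly S g"
  shows "trig_poly S (\<lambda>x. f x + g x)"
proof -
  obtain a b where "\<And>x. f x = (\<Sum>n\<in>S. Re (a n * trig_system n x))"
    "\<And>x. g x = (\<Sum>n\<in>S. Re (b n * trig_system n x))"
    using assms unfolding trig_poly_def by blast
  then show ?thesis
    unfolding trig_poly_def
    by (intro exI[of _ "\<lambda>n. a n + b n"]) (simp add: ring_distribs sum.distrib)
qed

lemma trig_poly_cmult:
  assumes "trig_poly S f"
  shows "trig_poly S (\<lambda>x. c * f x)"
proof -
  obtain a where "\<And>x. f x = (\<Sum>n\<in>S. Re (a n * trig_system n x))"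
    using assms unfolding trig_poly_def by blast
  then show ?thesis
    unfolding trig_poly_def
    by (intro exI[of _ "\<lambda>n. of_real c * a n"]) (simp add: sum_distrib_left algebra_simps)
qed

lemma trig_poly_zero: "trig_poly S (\<lambda>x. 0)"
  unfolding trig_poly_def by (intro exI[of _ "\<lambda>_. 0"]) simp

lemma trig_poly_sum:
  assumes "finite I" "\<And>i. i \<in> I \<Longrightarrow> trig_poly (S i) (f i)" "\<And>i. i \<in> I \<Longrightarrow> finite (S i)"
  shows "trig_poly (\<Union>i\<in>I. S i) (\<lambda>x. \<Sum>i\<in>I. f i x)"
proof -
  have "trig_poly T (\<lambda>x. \<Sum>i\<in>I. f i x)" if "\<And>i. i \<in> I \<Longrightarrow> trig_poly T (f i)" for T
    using assms(1) that by (induction I rule: finite_induct) (auto intro: trig_poly_zero trig_poly_add)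
  moreover have "trig_poly (\<Union>i\<in>I. S i) (f i)" if "i \<in> I" for i
    using assms that by (intro trig_poly_mono[OF assms(2)]) auto
  ultimately show ?thesis
    by blast
qed

lemma Re_mult_Re_eq: "Re (a * u) * Re (b * v) = Re (a * b / 2 * (u * v)) + Re (a * cnj b / 2 * (u * cnj v))"
  by (simp add: field_simps)

text \<open>The product-to-sum formula turns frequency n into n + t and |n - t|; the phase only
  rotates the coefficients.\<close>

lemma trig_poly_mult_sin:
  assumes "trig_poly S f" "finite S"
  shows "trig_poly (\<Union>n\<in>S. {n + t, (n - t) + (t - n)}) (\<lambda>x. f x * sin (2 * pi * real t * x + \<phi>))"
proof -
  obtain a where a: "\<And>x. f x = (\<Sum>n\<in>S. Re (a n * trig_system n x))"
    using assms unfolding trig_poly_def by blast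
  have "trig_poly {n + t, (n - t) + (t - n)} (\<lambda>x. Re (a n * trig_system n x) * sin (2 * pi * real t * x + \<phi>))" for n
  proof -
    define b where "b = - \<i> * cis \<phi>"
    define d where "d = (n - t) + (t - n)"
    \<comment> \<open>For n < t the difference term is conjugated, which leaves its real part
      unchanged and makes its frequency t - n.\<close>
    define z where "z = (if n \<ge> t then a n * cnj b else cnj (a n) * b)"
    have "Re (a n * trig_system n x) * sin (2 * pi * real t * x + \<phi>)
        = Re (a n * b / 2 * trig_system (n + t) x) + Re (z / 2 * trig_system d x)" for x
    proof -
      define u v where "u = 2 * pi * real n * x" and "v = 2 * pi * real t * x"
      have e: "trig_system n x = cis u" "trig_system (n + t) x = cis u * cis v"
        "trig_system d x = (if n \<ge> t then cis u * cnj (cis v) else cnj (cis u) * cis v)"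
        by (auto simp: trig_system_cis u_def v_def d_def cis_mult cis_cnj of_nat_diff algebra_simps)
      have s: "sin (2 * pi * real t * x + \<phi>) = Re (b * cis v)"
        by (simp add: b_def v_def sin_add algebra_simps)
      show ?thesis
        unfolding s e z_def
        by (cases "n \<ge> t") (simp_all only: Re_mult_Re_eq[of "a n" "cis u" b "cis v"] if_True if_False,
          simp_all add: field_simps)
    qed
    moreover have "trig_poly {n + t, d} (\<lambda>x. Re (a n * b / 2 * trig_system (n + t) x) + Re (z / 2 * trig_system d x))"
      by (intro trig_poly_add trig_poly_mono[OF trig_poly_single]) auto
    ultimately show ?thesis
      unfolding d_def by simp
  qed
  then have "trig_poly (\<Union>n\<in>S. {n + t, (n - t) + (t - n)})
      (\<lambda>x. \<Sum>n\<in>S. Re (a n * trig_system n x) * sin (2 * pi * real t * x + \<phi>))"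
    using assms by (intro trig_poly_sum) auto
  then show ?thesis
    by (simp add: a sum_distrib_right)
qed

text \<open>Numbers j of the odd frequencies 2j + 1, in blocks of ratio 8; blocks 0 to r exhaust j <
  8^r. The case l = 0 puts j = 0 into the first block.\<close>

definition dyadic_block :: "nat \<Rightarrow> nat set" where
  "dyadic_block l = {(if l = 0 then 0 else 8 ^ (l - 1))..<8 ^ l}"

text \<open>A block of the Fourier series of the wave that is 1 on the first half period and -1 on
  the second.\<close>

definition square_wave_block :: "nat \<Rightarrow> real \<Rightarrow> real" where
  "square_wave_block l y = (\<Sum>j\<in>dyadic_block l. 4 / (pi * real (2 * j + 1)) * sin (2 * pi * real (2 * j + 1) * y))"

lemma finite_dyadic_block [simp]: "finite (dyadic_block l)"
  by (simp add: dyadic_block_def)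

lemma sum_square_wave_block:
  "(\<Sum>l\<le>r. square_wave_block l y) = (\<Sum>j<8 ^ r. 4 / (pi * real (2 * j + 1)) * sin (2 * pi * real (2 * j + 1) * y))"
proof (induction r)
  case 0
  show ?case
    by (simp add: square_wave_block_def dyadic_block_def lessThan_atLeast0 del: of_nat_Suc)
next
  case (Suc r)
  have "{..<8 ^ Suc r} = {..<8 ^ r} \<union> dyadic_block (Suc r)" "{..<8 ^ r} \<inter> dyadic_block (Suc r) = {}"
    by (auto simp: dyadic_block_def)
  then show ?case
    using Suc by (simp add: square_wave_block_def sum.union_disjoint del: of_nat_Suc power_Suc)
qed

text \<open>Pairing precision r - l with block l as in a Cauchy product: a high block has small mean
  square and tolerates a coarse approximant, which keeps the number of frequencies of order
  16^r.\<close>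

definition wave_convolution :: "(nat \<Rightarrow> real \<Rightarrow> real) \<Rightarrow> (real \<Rightarrow> real) \<Rightarrow> nat \<Rightarrow> real \<Rightarrow> real" where
  "wave_convolution P g r x = (\<Sum>l\<le>r. P (r - l) x * square_wave_block l (g x))"

lemma trig_poly_mixed:
  assumes P: "\<And>r. trig_poly (S r) (P r)" and fin: "\<And>r. finite (S r)"
  shows "trig_poly (freq_step S \<mu> r) (wave_convolution P (\<lambda>x. real \<mu> * x + \<theta>) r)"
proof -
  have 1: "trig_poly (\<Union>n\<in>S (r - l). {n + (2 * j + 1) * \<mu>, (n - (2 * j + 1) * \<mu>) + ((2 * j + 1) * \<mu> - n)})
     (\<lambda>x. P (r - l) x * (4 / (pi * real (2 * j + 1)) * sin (2 * pi * real (2 * j + 1) * (real \<mu> * x + \<theta>))))"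
         for l j :: nat
    using trig_poly_cmult[where c = "4 / (pi * real (2 * j + 1))", OF trig_poly_mult_sin[where t = "(2 * j + 1) * \<mu>"
      and \<phi> = "2 * pi * real (2 * j + 1) * \<theta>", OF P[of "r - l"] fin]]
    by (simp add: algebra_simps)
  have "trig_poly (\<Union>l\<in>{..r}. \<Union>j\<in>dyadic_block l. \<Union>n\<in>S (r - l). {n + (2 * j + 1) * \<mu>, (n - (2 * j + 1) * \<mu>)
      + ((2 * j + 1) * \<mu> - n)})
    (\<lambda>x. \<Sum>l\<le>r. \<Sum>j\<in>dyadic_block l. P (r - l) x * (4 / (pi * real (2 * j + 1)) * sin (2 * pi * real (2 * j
        + 1) * (real \<mu> * x + \<theta>))))"
    by (intro trig_poly_sum 1) (auto simp: fin)
  then have "trig_poly (\<Union>l\<in>{..r}. \<Union>j\<in>dyadic_block l. \<Union>n\<in>S (r - l). {n + (2 * j + 1) * \<mu>, (n - (2 * j + 1) * \<mu>)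
      + ((2 * j + 1) * \<mu> - n)})
    (wave_convolution P (\<lambda>x. real \<mu> * x + \<theta>) r)"
    unfolding wave_convolution_def square_wave_block_def by (simp add: sum_distrib_left)
  then show ?thesis
  proof (rule trig_poly_mono)
    show "finite (freq_step S \<mu> r)"
      by (intro finite_freq_step fin)
    \<comment> \<open>The blocks are contained in the index ranges of \<open>freq_step\<close>, and
      the two inner unions are exchanged.\<close>
    have *: "(\<Union>l\<in>I. \<Union>j\<in>A l. \<Union>n\<in>B l. E n j) \<subseteq> (\<Union>l\<in>I. \<Union>n\<in>B l. \<Union>j\<in>C l. E n j)"
      if "\<And>l. A l \<subseteq> C l" for I :: "nat set" and A C B and E :: "nat \<Rightarrow> nat \<Rightarrow> nat set"
      using that by blast
    show "(\<Union>l\<in>{..r}. \<Union>j\<in>dyadic_block l. \<Union>n\<in>S (r - l). {n + (2 * j + 1) * \<mu>, (n - (2 * j + 1) * \<mu>) + ((2 * j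
        + 1) * \<mu> - n)})
        \<subseteq> freq_step S \<mu> r"
      unfolding freq_step_def by (rule *) (auto simp: dyadic_block_def)
  qed
qed

section \<open>Orthogonality and the mean-square Fourier expansion of the square wave\<close>

lemma has_integral_cis:
  assumes "k \<noteq> 0"
  shows "((\<lambda>x. Re (z * cis (2 * pi * of_int k * x))) has_integral 0) {0..1}"
proof -
  have "((\<lambda>x. Re (z * cis (2 * pi * of_int k * x))) has_integral
      Im (z * cis (2 * pi * of_int k * 1)) / (2 * pi * of_int k)
          - Im (z * cis (2 * pi * of_int k * 0)) / (2 * pi * of_int k)) {0..1}"
  proof (rule fundamental_theorem_of_calculus)
    fix x :: real
    have "((\<lambda>x. (Re z * sin (2 * pi * of_int k * x) + Im z * cos (2 * pi * of_int k * x)) / (2 * pi * of_int k))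
      has_real_derivative Re z * cos (2 * pi * of_int k * x)
          - Im z * sin (2 * pi * of_int k * x)) (at x within {0..1})"
      using assms by (auto intro!: derivative_eq_intros simp: field_simps)
    then show "((\<lambda>x. Im (z * cis (2 * pi * of_int k * x)) / (2 * pi * of_int k)) has_vector_derivative
        Re (z * cis (2 * pi * of_int k * x))) (at x within {0..1})"
      by (simp add: has_real_derivative_iff_has_vector_derivative)
  qed simp
  moreover have "cis (2 * pi * of_int k) = 1"
    by (simp add: cis_multiple_2pi)
  ultimately show ?thesis
    by simp
qed

text \<open>The product contains the frequencies n + m and n - m; n + m is positive, so a mean
  survives only for n = m.\<close>

lemma has_integral_trig_product:
  assumes "n \<noteq> 0" "m \<noteq> 0"
  shows "((\<lambda>x. Re (a * trig_system n x) * Re (b * trig_system m x)) has_integral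
     (if n = m then Re (a * cnj b) / 2 else 0)) {0..1}"
proof -
  have "Re (a * trig_system n x) * Re (b * trig_system m x) =
      Re (a * b / 2 * cis (2 * pi * of_int (int n + int m) * x))
      + Re (a * cnj b / 2 * cis (2 * pi * of_int (int n - int m) * x))" for x
  proof -
    define u v where "u = 2 * pi * real n * x" and "v = 2 * pi * real m * x"
    have "cis (2 * pi * of_int (int n + int m) * x) = cis u * cis v"
      "cis (2 * pi * of_int (int n - int m) * x) = cis u * cnj (cis v)"
      by (simp_all add: cis_mult cis_cnj u_def v_def algebra_simps)
    moreover have "Re (a * cis u) * Re (b * cis v)
        = Re (a * b / 2 * (cis u * cis v)) + Re (a * cnj b / 2 * (cis u * cnj (cis v)))"
      by (rule Re_mult_Re_eq)
    ultimately show ?thesis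
      by (simp only: trig_system_cis u_def[symmetric] v_def[symmetric])
  qed
  moreover have "((\<lambda>x. Re (a * b / 2 * cis (2 * pi * of_int (int n + int m) * x))
      + Re (a * cnj b / 2 * cis (2 * pi * of_int (int n - int m) * x))) has_integral
      0 + (if n = m then Re (a * cnj b) / 2 else 0)) {0..1}"
  proof (rule has_integral_add)
    show "((\<lambda>x. Re (a * b / 2 * cis (2 * pi * of_int (int n + int m) * x))) has_integral 0) {0..1}"
      using assms by (intro has_integral_cis) auto
    show "((\<lambda>x. Re (a * cnj b / 2 * cis (2 * pi * of_int (int n - int m) * x))) has_integral
        (if n = m then Re (a * cnj b) / 2 else 0)) {0..1}"
    proof (cases "n = m")
      case True
      have "((\<lambda>x. Re (a * cnj b / 2)) has_integral (1 - 0) *\<^sub>R Re (a * cnj b / 2)) {0..1::real}"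
        using has_integral_const_real[of "Re (a * cnj b / 2)" 0 1] by simp
      then show ?thesis
        using True by simp
    next
      case False
      then show ?thesis
        using has_integral_cis[of "int n - int m" "a * cnj b / 2"] by simp
    qed
  qed
  ultimately show ?thesis
    by simp
qed

lemma has_integral_trig_poly_square:
  assumes "finite S" "0 \<notin> S"
  shows "((\<lambda>x. (\<Sum>n\<in>S. Re (a n * trig_system n x))\<^sup>2) has_integral (\<Sum>n\<in>S. (cmod (a n))\<^sup>2) / 2) {0..1}"
proof -
  have "((\<lambda>x. \<Sum>n\<in>S. \<Sum>m\<in>S. Re (a n * trig_system n x) * Re (a m * trig_system m x)) has_integral
      (\<Sum>n\<in>S. \<Sum>m\<in>S. if n = m then Re (a n * cnj (a m)) / 2 else 0)) {0..1}"
    using assms by (intro has_integral_sum has_integral_trig_product) (auto intro: ccontr)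
  moreover have "(\<Sum>n\<in>S. \<Sum>m\<in>S. if n = m then Re (a n * cnj (a m)) / 2 else 0) = (\<Sum>n\<in>S. (cmod (a n))\<^sup>2) / 2"
    using assms by (simp add: sum.delta cmod_power2 sum_divide_distrib) (simp add: power2_eq_square)
  ultimately show ?thesis
    by (simp add: power2_eq_square sum_product)
qed

text \<open>As a function of the shift t the block has coefficients whose moduli do not depend on y,
  so its mean square over t is the same for all y.\<close>

lemma square_wave_block_shift:
  "square_wave_block l (y + t) = (\<Sum>n\<in>(\<lambda>j. 2 * j
      + 1) ` dyadic_block l. Re (- \<i> * of_real (4 / (pi * real n)) * cis (2 * pi * real n * y) * trig_system n t))"
proof -
  have "inj_on (\<lambda>j. 2 * j + 1) (dyadic_block l)" for l
    by (auto intro: inj_onI)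
  then have "(\<Sum>n\<in>(\<lambda>j. 2 * j + 1) ` dyadic_block l. Re (- \<i> * of_real (4 / (pi * real n)) * cis (2 * pi * real n
      * y) * trig_system n t))
    = (\<Sum>j\<in>dyadic_block l. Re (- \<i> * of_real (4 / (pi * real (2 * j + 1))) * cis (2 * pi * real (2 * j
        + 1) * y) * trig_system (2 * j + 1) t))"
    by (simp add: sum.reindex)
  also have "\<dots> = square_wave_block l (y + t)"
    unfolding square_wave_block_def
  proof (rule sum.cong)
    fix j
    show "Re (- \<i> * of_real (4 / (pi * real (2 * j + 1))) * cis (2 * pi * real (2 * j
        + 1) * y) * trig_system (2 * j + 1) t)
      = 4 / (pi * real (2 * j + 1)) * sin (2 * pi * real (2 * j + 1) * (y + t))"
    proof -
      define c where "c = 4 / (pi * real (2 * j + 1))"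
      have "Re (- \<i> * of_real c * cis u * cis v) = c * sin (u + v)" for u v
        by (simp add: sin_add algebra_simps)
      then show ?thesis
        unfolding c_def[symmetric] trig_system_cis by (simp add: algebra_simps)
    qed
  qed simp
  finally show ?thesis ..
qed

text \<open>Telescoping, since (2j + 1)^2 >= 4 j (j + 1).\<close>

lemma inverse_odd_square_sum_le:
  assumes "N \<ge> 1"
  shows "(\<Sum>j\<in>{N..<M}. 1 / (real (2 * j + 1))\<^sup>2) \<le> 1 / (4 * real N)"
proof -
  have "(\<Sum>j\<in>{N..<M}. 1 / (real (2 * j + 1))\<^sup>2) \<le> (\<Sum>j\<in>{N..<M}. 1 / (4 * real j) - 1 / (4 * real (Suc j)))"
  proof (rule sum_mono)
    fix j assume "j \<in> {N..<M}"
    then have "real j > 0" using assms by auto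
    then have "0 < 1 + (real j * 4 + real j * (real j * 4))"
      by (intro add_pos_pos mult_pos_pos) auto
    with \<open>real j > 0\<close> have "1 / (real (2 * j + 1))\<^sup>2 \<le> 1 / (4 * real j * (real j + 1))"
      by (intro divide_left_mono mult_pos_pos) (auto simp: power2_eq_square algebra_simps)
    also have "\<dots> = 1 / (4 * real j) - 1 / (4 * real (Suc j))"
      using \<open>real j > 0\<close> by (simp add: field_simps)
    finally show "1 / (real (2 * j + 1))\<^sup>2 \<le> 1 / (4 * real j) - 1 / (4 * real (Suc j))" .
  qed
  also have "\<dots> \<le> 1 / (4 * real N)"
  proof (cases "N \<le> M")
    case True
    then show ?thesis
      using sum_Suc_diff'[OF True, of "\<lambda>j. - (1 / (4 * real j))"] by simp
  qed auto
  finally show ?thesis .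
qed

text \<open>Parseval in the shift gives 8 / pi^2 < 1 times the sum of 1 / (2j + 1)^2 over the block.
  The tail bound yields 1 / (4 * 8^(l-1)) = 2 / 8^l, and block 0 consists of j = 0 only.\<close>

lemma has_integral_square_wave_block_square:
  "\<exists>I\<le>2 / 8 ^ l. ((\<lambda>t. (square_wave_block l (y + t))\<^sup>2) has_integral I) {0..1}"
proof -
  define a :: "nat \<Rightarrow> complex" where "a n = - \<i> * of_real (4 / (pi * real n)) * cis (2 * pi * real n * y)" for n
  have 1: "((\<lambda>t. (square_wave_block l (y + t))\<^sup>2) has_integral (\<Sum>n\<in>(\<lambda>j. 2 * j
      + 1) ` dyadic_block l. (cmod (a n))\<^sup>2) / 2) {0..1}"
    unfolding square_wave_block_shift a_def[symmetric] by (rule has_integral_trig_poly_square) auto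
  have "inj_on (\<lambda>j. 2 * j + 1) (dyadic_block l)"
    by (auto intro: inj_onI)
  then have "(\<Sum>n\<in>(\<lambda>j. 2 * j + 1) ` dyadic_block l. (cmod (a n))\<^sup>2) / 2
      = (\<Sum>j\<in>dyadic_block l. (cmod (a (2 * j + 1)))\<^sup>2) / 2"
    by (simp add: sum.reindex)
  also have "\<dots> = (\<Sum>j\<in>dyadic_block l. 8 / pi\<^sup>2 * (1 / (real (2 * j + 1))\<^sup>2))"
    by (simp add: a_def norm_mult norm_divide power_divide power_mult_distrib sum_divide_distrib field_simps
        del: of_nat_Suc of_nat_add of_nat_mult)
  also have "\<dots> = 8 / pi\<^sup>2 * (\<Sum>j\<in>dyadic_block l. 1 / (real (2 * j + 1))\<^sup>2)"
    by (simp add: sum_distrib_left)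
  also have "\<dots> \<le> 1 * (2 / 8 ^ l)"
  proof (rule mult_mono)
    have "3 * 3 \<le> pi * pi"
      using pi_gt3 by (intro mult_mono) auto
    then show "8 / pi\<^sup>2 \<le> 1"
      by (simp add: power2_eq_square field_simps)
    show "(\<Sum>j\<in>dyadic_block l. 1 / (real (2 * j + 1))\<^sup>2) \<le> 2 / 8 ^ l"
    proof (cases l)
      case 0
      have "dyadic_block 0 = {0}" by (auto simp: dyadic_block_def)
      then show ?thesis using 0 by simp
    next
      case (Suc l')
      have "(\<Sum>j\<in>dyadic_block l. 1 / (real (2 * j + 1))\<^sup>2) \<le> 1 / (4 * real (8 ^ l'))"
        unfolding Suc dyadic_block_def by (simp only: nat.simps if_False diff_Suc_1) (rule
            inverse_odd_square_sum_le, simp)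
      then show ?thesis using Suc by simp
    qed
  qed (auto intro: sum_nonneg)
  finally show ?thesis
    using 1 by (intro exI conjI) auto
qed

text \<open>The values are 1 and -1 without exception, also at the jumps, so the indicators built
  from the wave are exactly 0 or 1 at every point.\<close>

definition square_wave :: "real \<Rightarrow> real" where
  "square_wave y = (if frac y < 1 / 2 then 1 else - 1)"

lemma has_integral_square_wave_sin:
  "((\<lambda>t. square_wave t * sin (2 * pi * real (2 * j + 1) * t)) has_integral 2 / (pi * real (2 * j + 1))) {0..1}"
proof -
  define c where "c = 2 * pi * real (2 * j + 1)"
  have c: "c > 0" "c \<noteq> 0"
    unfolding c_def by (auto intro!: mult_pos_pos)
  have cos1: "cos c = 1"
    unfolding c_def using cos_npi[of "2 * (2 * j + 1)"] by (simp add: algebra_simps)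
  \<comment> \<open>The middle of the period is an odd multiple of pi, so both halves contribute 2 /
    c.\<close>
  have "c / 2 = real (2 * j + 1) * pi"
    unfolding c_def by simp
  then have cos2: "cos (c / 2) = - 1"
    by (simp only: cos_npi) simp
  have A: "((\<lambda>t. sin (c * t)) has_integral (- cos (c * v) / c - - cos (c * u) / c)) {u..v}" if "u \<le> v" for u v
  proof (rule fundamental_theorem_of_calculus[OF that])
    fix x :: real
    have "((\<lambda>t. - cos (c * t) / c) has_real_derivative sin (c * x)) (at x within {u..v})"
      using c by (auto intro!: derivative_eq_intros)
    then show "((\<lambda>t. - cos (c * t) / c) has_vector_derivative sin (c * x)) (at x within {u..v})"
      by (simp add: has_real_derivative_iff_has_vector_derivative)
  qed
  have "((\<lambda>t. square_wave t * sin (c * t)) has_integral 2 / c) {0..1/2}"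
  proof (rule has_integral_spike_finite[where S = "{1/2}" and f = "\<lambda>t. sin (c * t)"])
    show "((\<lambda>t. sin (c * t)) has_integral 2 / c) {0..1 / 2}"
      using A[of 0 "1/2"] cos2 by (simp add: field_simps)
    fix x :: real assume "x \<in> {0..1/2} - {1/2}"
    then have "frac x = x" by (simp add: frac_eq)
    with \<open>x \<in> _\<close> show "square_wave x * sin (c * x) = sin (c * x)" by (simp add: square_wave_def)
  qed simp
  moreover have "((\<lambda>t. square_wave t * sin (c * t)) has_integral 2 / c) {1/2..1}"
  proof (rule has_integral_spike_finite[where S = "{1}" and f = "\<lambda>t. - sin (c * t)"])
    show "((\<lambda>t. - sin (c * t)) has_integral 2 / c) {1 / 2..1}"
      using has_integral_neg[OF A[of "1/2" 1]] cos1 cos2 by (simp add: field_simps)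
    fix x :: real assume "x \<in> {1/2..1} - {1}"
    then have "frac x = x" by (simp add: frac_eq)
    with \<open>x \<in> _\<close> show "square_wave x * sin (c * x) = - sin (c * x)" by (simp add: square_wave_def)
  qed simp
  ultimately have "((\<lambda>t. square_wave t * sin (c * t)) has_integral 2 / c + 2 / c) {0..1}"
    by (intro has_integral_combine[of 0 "1/2" 1]) auto
  moreover have "2 / c + 2 / c = 2 / (pi * n)" if "c = 2 * pi * n" for n
    using that by (simp add: field_simps)
  from this[OF c_def] have "2 / c + 2 / c = 2 / (pi * real (2 * j + 1))" .
  ultimately show ?thesis
    unfolding c_def[symmetric] by simp
qed

text \<open>Pairing the terms of the series for pi^2 / 6 separates the odd squares from the even
  ones, which contribute a quarter of the whole.\<close>

lemma inverse_odd_squares_sums: "(\<lambda>j. 1 / (real (2 * j + 1))\<^sup>2) sums (pi\<^sup>2 / 8)"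
proof -
  let ?f = "\<lambda>n::nat. 1 / (real n + 1)\<^sup>2"
  have f: "?f sums (pi\<^sup>2 / 6)"
    using inverse_squares_sums by (simp add: add.commute)
  have e: "(\<lambda>n. 1 / 4 * ?f n) sums (1 / 4 * (pi\<^sup>2 / 6))"
    by (rule sums_mult[OF f])
  have "(\<lambda>n. \<Sum>k\<in>{n * 2..<n * 2 + 2}. ?f k) sums (pi\<^sup>2 / 6)"
    by (rule sums_group[OF f]) simp
  moreover have "(\<Sum>k\<in>{n * 2..<n * 2 + 2}. ?f k) = 1 / (real (2 * n + 1))\<^sup>2 + 1 / 4 * ?f n" for n
  proof -
    have "{n * 2..<n * 2 + 2} = {2 * n, 2 * n + 1}" by auto
    moreover have "1 / (real (2 * n + 1) + 1)\<^sup>2 = 1 / 4 * ?f n"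
    proof -
      have "real (2 * n + 1) + 1 = 2 * (real n + 1)" by simp
      then show ?thesis by (simp only: power_mult_distrib) simp
    qed
    ultimately show ?thesis by simp
  qed
  ultimately have "(\<lambda>n. 1 / (real (2 * n + 1))\<^sup>2 + 1 / 4 * ?f n) sums (pi\<^sup>2 / 6)"
    by simp
  from sums_diff[OF this e] show ?thesis
    by (simp add: field_simps)
qed

text \<open>The mean square error is 1 - (8 / pi^2) Z, where Z is the partial sum of the inverse odd
  squares. As these add up to pi^2 / 8, it is 8 / pi^2 times the tail, and the tail is at most 1 /
  (4 * 8^r).\<close>

lemma has_integral_square_wave_minus_partial:
  "\<exists>I\<le>1 / 8 ^ r. ((\<lambda>t. (square_wave t - (\<Sum>l\<le>r. square_wave_block l t))\<^sup>2) has_integral I) {0..1}"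
proof -
  define N :: nat where "N = 8 ^ r"
  have N: "N \<ge> 1" by (simp add: N_def)
  define Z where "Z = (\<Sum>j<N. 1 / (real (2 * j + 1))\<^sup>2)"
  define b where "b j = 4 / (pi * real (2 * j + 1))" for j
  define Q where "Q t = (\<Sum>j<N. b j * sin (2 * pi * real (2 * j + 1) * t))" for t
  have Q: "(\<Sum>l\<le>r. square_wave_block l t) = Q t" for t
    unfolding sum_square_wave_block Q_def b_def N_def ..
  have sq2: "((\<lambda>t. (square_wave t)\<^sup>2) has_integral 1) {0..1}"
  proof -
    have "(square_wave t)\<^sup>2 = 1" for t
      by (simp add: square_wave_def)
    then show ?thesis
      using has_integral_const_real[of "1::real" 0 1] by simp
  qed
  have "((\<lambda>t. \<Sum>j<N. b j * (square_wave t * sin (2 * pi * real (2 * j + 1) * t))) has_integral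
      (\<Sum>j<N. b j * (2 / (pi * real (2 * j + 1))))) {0..1}"
    by (intro has_integral_sum has_integral_mult_right has_integral_square_wave_sin) auto
  moreover have "(\<Sum>j<N. b j * (square_wave t * sin (2 * pi * real (2 * j + 1) * t))) = square_wave t * Q t" for t
    unfolding Q_def sum_distrib_left by (intro sum.cong) auto
  moreover have "(\<Sum>j<N. b j * (2 / (pi * real (2 * j + 1)))) = 8 / pi\<^sup>2 * Z"
    unfolding Z_def sum_distrib_left b_def by (intro sum.cong) (auto simp: field_simps power2_eq_square)
  ultimately have sqQ: "((\<lambda>t. square_wave t * Q t) has_integral 8 / pi\<^sup>2 * Z) {0..1}"
    by simp
  have QQ: "((\<lambda>t. (Q t)\<^sup>2) has_integral 8 / pi\<^sup>2 * Z) {0..1}"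
  proof -
    define a :: "nat \<Rightarrow> complex" where "a n = - \<i> * of_real (4 / (pi * real n))" for n
    have inj: "inj_on (\<lambda>j. 2 * j + 1) {..<N}"
      by (auto intro: inj_onI)
    have "Q t = (\<Sum>n\<in>(\<lambda>j. 2 * j + 1) ` {..<N}. Re (a n * trig_system n t))" for t
      unfolding sum.reindex[OF inj] Q_def o_def
      by (intro sum.cong) (auto simp: a_def b_def trig_system_cis)
    moreover have "(\<Sum>n\<in>(\<lambda>j. 2 * j + 1) ` {..<N}. (cmod (a n))\<^sup>2) / 2 = 8 / pi\<^sup>2 * Z"
      unfolding sum.reindex[OF inj] o_def Z_def sum_distrib_left sum_divide_distrib
      by (intro sum.cong) (auto simp: a_def norm_mult norm_divide power_divide power_mult_distrib simp del:
          of_nat_Suc of_nat_add of_nat_mult)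
    ultimately show ?thesis
      using has_integral_trig_poly_square[of "(\<lambda>j. 2 * j + 1) ` {..<N}" a] by auto
  qed
  have "((\<lambda>t. (square_wave t)\<^sup>2 - 2 * (square_wave t * Q t) + (Q t)\<^sup>2) has_integral 1 - 2 * (8 / pi\<^sup>2 * Z)
      + 8 / pi\<^sup>2 * Z) {0..1}"
    by (intro has_integral_add has_integral_diff has_integral_mult_right sq2 sqQ QQ)
  moreover have "(square_wave t)\<^sup>2 - 2 * (square_wave t * Q t) + (Q t)\<^sup>2 = (square_wave t - Q t)\<^sup>2" for t
    by (simp add: power2_diff)
  ultimately have 1: "((\<lambda>t. (square_wave t - Q t)\<^sup>2) has_integral 1 - 8 / pi\<^sup>2 * Z) {0..1}"
    by (simp add: algebra_simps)
  have "(\<lambda>M. \<Sum>j<M. 1 / (real (2 * j + 1))\<^sup>2) \<longlonglongrightarrow> pi\<^sup>2 / 8"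
    using inverse_odd_squares_sums unfolding sums_def .
  then have "pi\<^sup>2 / 8 \<le> Z + 1 / (4 * real N)"
  proof (rule LIMSEQ_le_const2)
    show "\<exists>K. \<forall>M\<ge>K. (\<Sum>j<M. 1 / (real (2 * j + 1))\<^sup>2) \<le> Z + 1 / (4 * real N)"
    proof (intro exI[of _ N] allI impI)
      fix M assume M: "N \<le> M"
      have "(\<Sum>j<M. 1 / (real (2 * j + 1))\<^sup>2) = Z + (\<Sum>j\<in>{N..<M}. 1 / (real (2 * j + 1))\<^sup>2)"
        unfolding Z_def using sum.atLeastLessThan_concat[of 0 N M "\<lambda>j. 1 / (real (2 * j + 1))\<^sup>2"] M
            by (simp only: lessThan_atLeast0)
      then show "(\<Sum>j<M. 1 / (real (2 * j + 1))\<^sup>2) \<le> Z + 1 / (4 * real N)"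
        using inverse_odd_square_sum_le[OF N, of M] by simp
    qed
  qed
  then have "8 / pi\<^sup>2 * (pi\<^sup>2 / 8) \<le> 8 / pi\<^sup>2 * (Z + 1 / (4 * real N))"
    by (rule mult_left_mono) simp
  moreover have "8 / pi\<^sup>2 * (pi\<^sup>2 / 8) = 1"
    by simp
  moreover have "8 / pi\<^sup>2 * (Z + 1 / (4 * real N)) = 8 / pi\<^sup>2 * Z + 2 / pi\<^sup>2 * (1 / real N)"
    by (simp add: distrib_left)
  ultimately have "1 - 8 / pi\<^sup>2 * Z \<le> 2 / pi\<^sup>2 * (1 / real N)"
    by linarith
  also have "\<dots> \<le> 1 * (1 / real N)"
  proof (rule mult_right_mono)
    have "3 * 3 \<le> pi * pi"
      using pi_gt3 by (intro mult_mono) auto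
    then show "2 / pi\<^sup>2 \<le> 1"
      by (simp add: power2_eq_square field_simps)
  qed simp
  finally have "1 - 8 / pi\<^sup>2 * Z \<le> 1 / 8 ^ r"
    by (simp add: N_def)
  then show ?thesis
    unfolding Q using 1 by blast
qed

section \<open>Choice of a phase\<close>

text \<open>Half-open, so that translation modulo 1 acts on it bijectively.\<close>

definition unit_measure :: "real measure" where
  "unit_measure = restrict_space lborel {0..<1}"

lemma space_unit_measure [simp]: "space unit_measure = {0..<1}"
  by (simp add: unit_measure_def space_restrict_space)

lemma measurable_unit_measure: "f \<in> borel_measurable borel \<Longrightarrow> f \<in> borel_measurable unit_measure"
  unfolding unit_measure_def by (intro measurable_restrict_space1) simp

lemma nn_integral_unit_measure:
  "(\<integral>\<^sup>+x. f x \<partial>unit_measure) = (\<integral>\<^sup>+x. f x * indicator {0..<1} x \<partial>lborel)"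
  unfolding unit_measure_def by (subst nn_integral_restrict_space) auto

lemma emeasure_unit_measure [simp]: "emeasure unit_measure {0..<1} = 1"
  unfolding unit_measure_def by (subst emeasure_restrict_space) auto

interpretation unit_measure: prob_space unit_measure
  by (rule prob_spaceI) simp

lemma nn_integral_unit_has_integral:
  assumes "f \<in> borel_measurable borel" "\<And>x. f x \<ge> 0" "(f has_integral I) {0..1}"
  shows "(\<integral>\<^sup>+x. ennreal (f x) \<partial>unit_measure) = ennreal I"
proof -
  have "(f has_integral I) {0..<1}"
  proof (rule iffD1[OF has_integral_spike_set_eq assms(3)])
    show "negligible {x \<in> {0..1} - {0..<1}. f x \<noteq> 0}"
      by (rule negligible_subset[of "{1}"]) auto
    have "{x \<in> {0..<1} - {0..1}. f x \<noteq> 0} = {}"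
      by auto
    then show "negligible {x \<in> {0..<1} - {0..1}. f x \<noteq> 0}"
      by (simp only: negligible_empty)
  qed
  then have "((\<lambda>x. if x \<in> {0..<1} then f x else 0) has_integral I) UNIV"
    by (simp only: has_integral_restrict_UNIV)
  then have "(\<integral>\<^sup>+x. ennreal (if x \<in> {0..<1} then f x else 0) \<partial>lborel) = ennreal I"
    using assms(1,2) by (intro nn_integral_has_integral_lborel) auto
  moreover have "ennreal (if x \<in> {0..<1} then f x else 0) = ennreal (f x) * indicator {0..<1} x" for x
    by (auto simp: indicator_def)
  ultimately show ?thesis
    by (simp add: nn_integral_unit_measure)
qed

text \<open>The shift is reduced to its fractional part z; the part of [z, z + 1) beyond 1 is moved
  back by one period to [0, z).\<close>

lemma nn_integral_unit_periodic:
  fixes g :: "real \<Rightarrow> ennreal"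
  assumes g [measurable]: "g \<in> borel_measurable borel" and per: "\<And>x (k :: int). g (x + of_int k) = g x"
  shows "(\<integral>\<^sup>+t. g (y + t) \<partial>unit_measure) = (\<integral>\<^sup>+t. g t \<partial>unit_measure)"
proof -
  define z where "z = frac y"
  have z: "0 \<le> z" "z < 1"
    by (auto simp: z_def frac_lt_1)
  have "g (y + t) = g (z + t)" for t
    using per[of "z + t" "floor y"] by (simp add: z_def frac_def)
  then have "(\<integral>\<^sup>+t. g (y + t) \<partial>unit_measure) = (\<integral>\<^sup>+t. g (z + t) * indicator {0..<1} t \<partial>lborel)"
    by (simp add: nn_integral_unit_measure)
  also have "\<dots> = (\<integral>\<^sup>+u. g u * indicator {z..<z + 1} u \<partial>lborel)"
    by (subst nn_integral_real_affine[where c = 1 and t = z]) (auto intro!: nn_integral_cong simp: indicator_def)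
  also have "\<dots> = (\<integral>\<^sup>+u. g u * indicator {z..<1} u + g u * indicator {1..<z + 1} u \<partial>lborel)"
    using z by (intro nn_integral_cong) (auto simp: indicator_def)
  also have "\<dots> = (\<integral>\<^sup>+u. g u * indicator {z..<1} u \<partial>lborel) + (\<integral>\<^sup>+u. g u * indicator {1..<z + 1} u \<partial>lborel)"
    by (rule nn_integral_add) auto
  also have "(\<integral>\<^sup>+u. g u * indicator {1..<z + 1} u \<partial>lborel) = (\<integral>\<^sup>+v. g v * indicator {0..<z} v \<partial>lborel)"
    using per[of _ 1]
    by (subst nn_integral_real_affine[where c = 1 and t
        = 1]) (auto intro!: nn_integral_cong simp: indicator_def add.commute)
  also have "(\<integral>\<^sup>+u. g u * indicator {z..<1} u \<partial>lborel) + \<dots>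
     = (\<integral>\<^sup>+u. g u * indicator {z..<1} u + g u * indicator {0..<z} u \<partial>lborel)"
    by (rule nn_integral_add[symmetric]) auto
  also have "\<dots> = (\<integral>\<^sup>+u. g u * indicator {0..<1} u \<partial>lborel)"
    using z by (intro nn_integral_cong) (auto simp: indicator_def)
  finally show ?thesis
    by (simp add: nn_integral_unit_measure)
qed

lemma square_wave_measurable [measurable]: "square_wave \<in> borel_measurable borel"
  unfolding square_wave_def[abs_def] frac_def by measurable

lemma square_wave_block_measurable [measurable]: "square_wave_block l \<in> borel_measurable borel"
  unfolding square_wave_block_def[abs_def] by measurable

lemma square_wave_cases: "square_wave y = 1 \<or> square_wave y = - 1"
  by (simp add: square_wave_def)

lemma square_wave_periodic: "square_wave (x + of_int k) = square_wave x"
  by (simp add: square_wave_def frac_def)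

lemma square_wave_block_periodic: "square_wave_block l (x + of_int k) = square_wave_block l x"
proof -
  have "sin (2 * pi * real (2 * j + 1) * (x + of_int k)) = sin (2 * pi * real (2 * j + 1) * x)" for j
  proof -
    have "2 * pi * real (2 * j + 1) * (x + of_int k)
        = 2 * pi * real (2 * j + 1) * x + 2 * pi * of_int (int (2 * j + 1) * k)"
      by (simp add: algebra_simps)
    then show ?thesis
      by (simp only: sin_add sin_int_2pin cos_int_2pin mult_1_right mult_zero_right add_0_right)
  qed
  then show ?thesis
    unfolding square_wave_block_def by (simp only:)
qed

lemma nn_integral_square_wave_block:
  "(\<integral>\<^sup>+t. ennreal ((square_wave_block l (y + t))\<^sup>2) \<partial>unit_measure) \<le> ennreal (2 / 8 ^ l)"
proof -
  obtain I where I: "I \<le> 2 / 8 ^ l" "((\<lambda>t. (square_wave_block l (y + t))\<^sup>2) has_integral I) {0..1}"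
    using has_integral_square_wave_block_square by blast
  then have "(\<integral>\<^sup>+t. ennreal ((square_wave_block l (y + t))\<^sup>2) \<partial>unit_measure) = ennreal I"
    by (intro nn_integral_unit_has_integral) auto
  then show ?thesis
    using I(1) by (simp add: ennreal_leI)
qed

lemma nn_integral_square_wave_minus_partial:
  "(\<integral>\<^sup>+t. ennreal ((square_wave (y + t) - (\<Sum>l\<le>r. square_wave_block l (y + t)))\<^sup>2) \<partial>unit_measure)
      \<le> ennreal (1 / 8 ^ r)"
proof -
  obtain I where I: "I \<le> 1 / 8 ^ r" "((\<lambda>t. (square_wave t - (\<Sum>l\<le>r. square_wave_block l t))\<^sup>2) has_integral I) {0..1}"
    using has_integral_square_wave_minus_partial by blast
  have "(\<integral>\<^sup>+t. ennreal ((square_wave (y + t) - (\<Sum>l\<le>r. square_wave_block l (y + t)))\<^sup>2) \<partial>unit_measure)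
     = (\<integral>\<^sup>+t. ennreal ((square_wave t - (\<Sum>l\<le>r. square_wave_block l t))\<^sup>2) \<partial>unit_measure)"
    by (rule nn_integral_unit_periodic) (auto simp: square_wave_periodic square_wave_block_periodic)
  also have "\<dots> = ennreal I"
    using I by (intro nn_integral_unit_has_integral) auto
  finally show ?thesis
    using I(1) by (simp add: ennreal_leI)
qed

text \<open>Cauchy-Schwarz with the weights 2^(-l), whose sum is below 2. In the induction each term
  split off costs a factor 2 on the rest.\<close>

lemma square_sum_le: "(\<Sum>l\<le>r. v l)\<^sup>2 \<le> 2 * (\<Sum>l\<le>r. 2 ^ l * (v l)\<^sup>2)" for v :: "nat \<Rightarrow> real"
proof (induction r arbitrary: v)
  case (Suc r)
  have "(\<Sum>l\<le>Suc r. v l)\<^sup>2 = (v 0 + (\<Sum>l\<le>r. v (Suc l)))\<^sup>2"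
    by (simp only: sum.atMost_Suc_shift)
  also have "\<dots> \<le> 2 * (v 0)\<^sup>2 + 2 * (\<Sum>l\<le>r. v (Suc l))\<^sup>2"
    using sum_squares_bound[of "v 0" "\<Sum>l\<le>r. v (Suc l)"] by (simp add: power2_sum)
  also have "\<dots> \<le> 2 * (v 0)\<^sup>2 + 2 * (2 * (\<Sum>l\<le>r. 2 ^ l * (v (Suc l))\<^sup>2))"
    using Suc[of "\<lambda>l. v (Suc l)"] by simp
  also have "\<dots> = 2 * (\<Sum>l\<le>Suc r. 2 ^ l * (v l)\<^sup>2)"
    by (simp add: sum.atMost_Suc_shift sum_distrib_left del: sum.atMost_Suc)
  finally show ?case .
qed simp

text \<open>(T - 2b)^2 >= 0 gives (T + b)^2 <= 3/2 T^2 + 3 b^2; the 3/2 meets the factor 2 of the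
  preceding bound.\<close>

lemma square_sum_add_le: "((\<Sum>l\<le>r. v l) + b)\<^sup>2 \<le> 3 * ((\<Sum>l\<le>r. 2 ^ l * (v l)\<^sup>2) + b\<^sup>2)" for v :: "nat \<Rightarrow> real"
proof -
  define T where "T = (\<Sum>l\<le>r. v l)"
  have "0 \<le> (T - 2 * b)\<^sup>2" by simp
  then have "(T + b)\<^sup>2 \<le> 3 / 2 * T\<^sup>2 + 3 * b\<^sup>2"
    by (simp add: power2_eq_square algebra_simps)
  then show ?thesis
    using square_sum_le[of v r] unfolding T_def by simp
qed

text \<open>The triangle l + i < n lies in a square, and all terms are nonnegative.\<close>

lemma suminf_convolution_le:
  fixes a b :: "nat \<Rightarrow> ennreal"
  shows "(\<Sum>r. \<Sum>l\<le>r. a l * b (r - l)) \<le> (\<Sum>l. a l) * (\<Sum>r. b r)"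
proof -
  have "(\<Sum>r<n. \<Sum>l\<le>r. a l * b (r - l)) \<le> (\<Sum>l. a l) * (\<Sum>r. b r)" for n
  proof -
    have "(\<Sum>r<n. \<Sum>l\<le>r. a l * b (r - l)) = (\<Sum>(l, i)\<in>{(l, i). l + i < n}. a l * b i)"
      by (rule sum.triangle_reindex[symmetric])
    also have "\<dots> \<le> (\<Sum>(l, i)\<in>{..<n} \<times> {..<n}. a l * b i)"
      by (rule sum_mono2) auto
    also have "\<dots> = (\<Sum>l<n. a l) * (\<Sum>i<n. b i)"
      by (simp add: sum_product sum.cartesian_product)
    also have "\<dots> \<le> (\<Sum>l. a l) * (\<Sum>r. b r)"
      by (intro mult_mono sum_le_suminf) auto
    finally show ?thesis .
  qed
  then show ?thesis
    by (simp add: suminf_eq_SUP SUP_least)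
qed

definition err2 :: "(real \<Rightarrow> real) \<Rightarrow> (nat \<Rightarrow> real \<Rightarrow> real) \<Rightarrow> nat \<Rightarrow> ennreal" where
  "err2 F P r = (\<integral>\<^sup>+x. ennreal ((F x - P r x)\<^sup>2) \<partial>unit_measure)"

text \<open>Controlling the weighted sum rather than each error separately preserves the decay rate in \<open>r\<close>
  when a single phase is chosen for all \<open>r\<close> at once.\<close>

definition energy :: "(real \<Rightarrow> real) \<Rightarrow> (nat \<Rightarrow> real \<Rightarrow> real) \<Rightarrow> ennreal" where
  "energy F P = (\<Sum>r. 2 ^ r * err2 F P r)"

lemma id_unit_measurable [measurable]: "(\<lambda>x. x) \<in> borel_measurable unit_measure"
  by (rule measurable_unit_measure) simp

text \<open>For fixed \<open>x\<close> the average over the phase \<open>\<theta>\<close> decouples the old error from the new wave, so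
  no arithmetic independence of the frequencies is needed.\<close>

lemma phase_exists:
  fixes \<mu> :: nat
  assumes F [measurable]: "F \<in> borel_measurable borel" and P: "\<And>r. P r \<in> borel_measurable borel"
    and F1: "\<And>x. \<bar>F x\<bar> \<le> 1" and fin: "energy F P < \<infinity>"
  shows "\<exists>\<theta>. energy (\<lambda>x. F x * square_wave (real \<mu> * x + \<theta>)) (wave_convolution P (\<lambda>x. real \<mu> * x + \<theta>))
      \<le> 16 * (energy F P + 1)"
proof -
  note P [measurable]
  note [measurable] = measurable_unit_measure[OF F] measurable_unit_measure[OF P]
  define D where "D \<theta> r x = F x * square_wave (real \<mu> * x + \<theta>) - wave_convolution P (\<lambda>x. real \<mu> * x + \<theta>) r x"
      for \<theta> r x
  have Dm [measurable]: "(\<lambda>(x, \<theta>). D \<theta> r x) \<in> borel_measurable (unit_measure \<Otimes>\<^sub>M unit_measure)" for r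
    unfolding D_def wave_convolution_def by measurable
  have Dm' [measurable]: "(\<lambda>(\<theta>, x). D \<theta> r x) \<in> borel_measurable (unit_measure \<Otimes>\<^sub>M unit_measure)" for r
    unfolding D_def wave_convolution_def by measurable
  interpret pair_sigma_finite unit_measure unit_measure ..
  define w where "w l y = (square_wave_block l y)\<^sup>2" for l y
  define q where "q r y = (square_wave y - (\<Sum>l\<le>r. square_wave_block l y))\<^sup>2" for r y
  have wq [measurable]: "w l \<in> borel_measurable borel" "q r \<in> borel_measurable borel" for l r
    unfolding w_def q_def by measurable
  have Dle: "ennreal ((D \<theta> r x)\<^sup>2) \<le> 3 * ((\<Sum>l\<le>r. ennreal (2 ^ l * (F x - P (r
      - l) x)\<^sup>2) * ennreal (w l (real \<mu> * x + \<theta>)))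
      + ennreal (q r (real \<mu> * x + \<theta>)))" for \<theta> r x
  proof -
    let ?y = "real \<mu> * x + \<theta>"
    \<comment> \<open>F times the partial Fourier sum is added and subtracted: one part carries the
      old errors, the other the truncation error of the wave.\<close>
    have "D \<theta> r x = (\<Sum>l\<le>r. (F x - P (r - l) x) * square_wave_block l ?y) + F x * (square_wave ?y
        - (\<Sum>l\<le>r. square_wave_block l ?y))"
      by (simp add: D_def wave_convolution_def algebra_simps sum_subtractf sum_distrib_left)
    then have "(D \<theta> r x)\<^sup>2 \<le> 3 * ((\<Sum>l\<le>r. 2 ^ l * ((F x - P (r - l) x) * square_wave_block l ?y)\<^sup>2)
        + (F x * (square_wave ?y - (\<Sum>l\<le>r. square_wave_block l ?y)))\<^sup>2)"
      using square_sum_add_le by simp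
    also have "(F x * (square_wave ?y - (\<Sum>l\<le>r. square_wave_block l ?y)))\<^sup>2 \<le> q r ?y"
    proof -
      have "(F x)\<^sup>2 \<le> 1"
        using F1[of x] by (simp add: abs_square_le_1)
      then show ?thesis
        unfolding q_def power_mult_distrib using mult_right_mono[of "(F x)\<^sup>2" 1 "(square_wave ?y
            - (\<Sum>l\<le>r. square_wave_block l ?y))\<^sup>2"]
        by simp
    qed
    also have "(\<Sum>l\<le>r. 2 ^ l * ((F x - P (r - l) x) * square_wave_block l ?y)\<^sup>2)
        = (\<Sum>l\<le>r. (2 ^ l * (F x - P (r - l) x)\<^sup>2) * w l ?y)"
      by (simp add: w_def power_mult_distrib mult_ac)
    finally have "(D \<theta> r x)\<^sup>2 \<le> 3 * ((\<Sum>l\<le>r. (2 ^ l * (F x - P (r - l) x)\<^sup>2) * w l ?y) + q r ?y)"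
      by simp
    then have "ennreal ((D \<theta> r x)\<^sup>2) \<le> ennreal (3 * ((\<Sum>l\<le>r. (2 ^ l * (F x - P (r - l) x)\<^sup>2) * w l ?y) + q r ?y))"
      by (rule ennreal_leI)
    also have "\<dots> = 3 * ((\<Sum>l\<le>r. ennreal (2 ^ l * (F x - P (r - l) x)\<^sup>2) * ennreal (w l ?y)) + ennreal (q r ?y))"
    proof -
      have "w l y \<ge> 0" "q l y \<ge> 0" for l y
        by (auto simp: w_def q_def)
      then show ?thesis
        by (simp add: ennreal_mult ennreal_plus sum_nonneg flip: sum_ennreal)
    qed
    finally show ?thesis .
  qed
  have inner: "(\<integral>\<^sup>+\<theta>. ennreal ((D \<theta> r x)\<^sup>2) \<partial>unit_measure)
      \<le> 3 * ((\<Sum>l\<le>r. ennreal (2 ^ l * (F x - P (r - l) x)\<^sup>2) * ennreal (2 / 8 ^ l)) + ennreal (1 / 8 ^ r))" for r x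
  proof -
    have "(\<integral>\<^sup>+\<theta>. ennreal ((D \<theta> r x)\<^sup>2) \<partial>unit_measure)
       \<le> (\<integral>\<^sup>+\<theta>. 3 * ((\<Sum>l\<le>r. ennreal (2 ^ l * (F x - P (r - l) x)\<^sup>2) * ennreal (w l (real \<mu> * x + \<theta>)))
      + ennreal (q r (real \<mu> * x + \<theta>))) \<partial>unit_measure)"
      by (intro nn_integral_mono Dle)
    also have "\<dots> = 3 * ((\<Sum>l\<le>r. ennreal (2 ^ l * (F x - P (r - l) x)\<^sup>2) * (\<integral>\<^sup>+\<theta>. ennreal (w l (real \<mu> * x
        + \<theta>)) \<partial>unit_measure))
      + (\<integral>\<^sup>+\<theta>. ennreal (q r (real \<mu> * x + \<theta>)) \<partial>unit_measure))"
      by (simp add: nn_integral_cmult nn_integral_add nn_integral_sum)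
    also have "\<dots> \<le> 3 * ((\<Sum>l\<le>r. ennreal (2 ^ l * (F x - P (r - l) x)\<^sup>2) * ennreal (2 / 8 ^ l)) + ennreal (1 / 8 ^ r))"
      unfolding w_def q_def
      by (intro mult_left_mono add_mono sum_mono nn_integral_square_wave_block
          nn_integral_square_wave_minus_partial) auto
    finally show ?thesis .
  qed
  \<comment> \<open>Writing 2^r = 2^l 2^(r-l), the extra 2^l, the Cauchy-Schwarz weight 2^l and the
    block bound 2 / 8^l combine to 2 * 2^(-l), a summable convolution kernel.\<close>
  define c :: "nat \<Rightarrow> ennreal" where "c l = ennreal (2 * (1 / 2) ^ l)" for l
  have J: "(\<integral>\<^sup>+\<theta>. 2 ^ r * (\<integral>\<^sup>+x. ennreal ((D \<theta> r x)\<^sup>2) \<partial>unit_measure) \<partial>unit_measure)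
      \<le> 3 * ((\<Sum>l\<le>r. c l * (2 ^ (r - l) * err2 F P (r - l))) + ennreal ((1 / 4) ^ r))" for r
  proof -
    have "(\<integral>\<^sup>+\<theta>. (\<integral>\<^sup>+x. ennreal ((D \<theta> r x)\<^sup>2) \<partial>unit_measure) \<partial>unit_measure)
        = (\<integral>\<^sup>+x. (\<integral>\<^sup>+\<theta>. ennreal ((D \<theta> r x)\<^sup>2) \<partial>unit_measure) \<partial>unit_measure)"
      by (rule Fubini') measurable
    also have "\<dots> \<le> (\<integral>\<^sup>+x. 3 * ((\<Sum>l\<le>r. ennreal (2 ^ l * (F x - P (r - l) x)\<^sup>2) * ennreal (2 / 8 ^ l))
        + ennreal (1 / 8 ^ r)) \<partial>unit_measure)"
      by (intro nn_integral_mono inner)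
    also have "\<dots> = 3 * ((\<Sum>l\<le>r. 2 ^ l * err2 F P (r - l) * ennreal (2 / 8 ^ l)) + ennreal (1 / 8 ^ r))"
      by (simp add: nn_integral_cmult nn_integral_add nn_integral_sum nn_integral_multc err2_def ennreal_mult
          unit_measure.emeasure_space_1[simplified]
          flip: ennreal_power)
    finally have K: "(\<integral>\<^sup>+\<theta>. (\<integral>\<^sup>+x. ennreal ((D \<theta> r x)\<^sup>2) \<partial>unit_measure) \<partial>unit_measure)
        \<le> 3 * ((\<Sum>l\<le>r. 2 ^ l * err2 F P (r - l) * ennreal (2 / 8 ^ l)) + ennreal (1 / 8 ^ r))" .
    have "(\<integral>\<^sup>+\<theta>. 2 ^ r * (\<integral>\<^sup>+x. ennreal ((D \<theta> r x)\<^sup>2) \<partial>unit_measure) \<partial>unit_measure)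
        = 2 ^ r * (\<integral>\<^sup>+\<theta>. (\<integral>\<^sup>+x. ennreal ((D \<theta> r x)\<^sup>2) \<partial>unit_measure) \<partial>unit_measure)"
      by (rule nn_integral_cmult) measurable
    also have "\<dots> \<le> 2 ^ r * (3 * ((\<Sum>l\<le>r. 2 ^ l * err2 F P (r - l) * ennreal (2 / 8 ^ l)) + ennreal (1 / 8 ^ r)))"
      by (intro mult_left_mono K) auto
    also have "\<dots> = 3 * ((\<Sum>l\<le>r. 2 ^ r * (2 ^ l * err2 F P (r - l) * ennreal (2 / 8 ^ l)))
        + 2 ^ r * ennreal (1 / 8 ^ r))"
      by (simp add: distrib_left sum_distrib_left mult_ac)
    also have "(\<Sum>l\<le>r. 2 ^ r * (2 ^ l * err2 F P (r - l) * ennreal (2 / 8 ^ l)))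
        = (\<Sum>l\<le>r. c l * (2 ^ (r - l) * err2 F P (r - l)))"
    proof (rule sum.cong)
      fix l assume "l \<in> {..r}"
      then have "(2::ennreal) ^ r = 2 ^ l * 2 ^ (r - l)"
        by (simp flip: power_add)
      moreover have "2 ^ l * (2 ^ l * ennreal (2 / 8 ^ l)) = c l"
      proof -
        have "(2::ennreal) ^ l = ennreal (2 ^ l)"
          by (simp flip: ennreal_power)
        then have "2 ^ l * (2 ^ l * ennreal (2 / 8 ^ l)) = ennreal (2 ^ l * (2 ^ l * (2 / 8 ^ l)))"
          by (simp only: ennreal_mult[symmetric] zero_le_power zero_le_numeral mult_nonneg_nonneg
              divide_nonneg_nonneg)
        also have "2 ^ l * (2 ^ l * (2 / 8 ^ l)) = 2 * (1 / 2 :: real) ^ l"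
          by (simp add: power_divide field_simps flip: power_mult_distrib)
        finally show ?thesis by (simp add: c_def)
      qed
      ultimately show "2 ^ r * (2 ^ l * err2 F P (r - l) * ennreal (2 / 8 ^ l))
          = c l * (2 ^ (r - l) * err2 F P (r - l))"
        by (metis (no_types, lifting) mult.assoc mult.commute)
    qed simp
    also have "2 ^ r * ennreal (1 / 8 ^ r) = ennreal ((1 / 4) ^ r)"
    proof -
      have "(2::ennreal) ^ r = ennreal (2 ^ r)"
        by (simp flip: ennreal_power)
      then have "2 ^ r * ennreal (1 / 8 ^ r) = ennreal (2 ^ r * (1 / 8 ^ r))"
        by (simp only: ennreal_mult[symmetric] zero_le_power zero_le_numeral zero_le_one divide_nonneg_nonneg)
      also have "2 ^ r * (1 / 8 ^ r) = (1 / 4 :: real) ^ r"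
        by (simp add: power_divide field_simps flip: power_mult_distrib)
      finally show ?thesis .
    qed
    finally show ?thesis .
  qed
  have "(\<integral>\<^sup>+\<theta>. (\<Sum>r. 2 ^ r * (\<integral>\<^sup>+x. ennreal ((D \<theta> r x)\<^sup>2) \<partial>unit_measure)) \<partial>unit_measure)
      = (\<Sum>r. (\<integral>\<^sup>+\<theta>. 2 ^ r * (\<integral>\<^sup>+x. ennreal ((D \<theta> r x)\<^sup>2) \<partial>unit_measure) \<partial>unit_measure))"
    by (rule nn_integral_suminf) measurable
  also have "\<dots> \<le> (\<Sum>r. 3 * ((\<Sum>l\<le>r. c l * (2 ^ (r - l) * err2 F P (r - l))) + ennreal ((1 / 4) ^ r)))"
    by (intro suminf_le J) auto
  also have "\<dots> = 3 * ((\<Sum>r. \<Sum>l\<le>r. c l * (2 ^ (r - l) * err2 F P (r - l))) + (\<Sum>r. ennreal ((1 / 4) ^ r)))"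
    by (subst ennreal_suminf_cmult, subst suminf_add[symmetric]) auto
  \<comment> \<open>The kernel has sum 4, and the geometric series of ratio 1/4 has sum 4/3 <=
    2.\<close>
  also have "\<dots> \<le> 3 * (4 * energy F P + 2)"
  proof (intro mult_left_mono add_mono)
    have "(\<Sum>l. c l) = ennreal (2 * 2)"
      unfolding c_def by (rule suminf_ennreal_eq) (use sums_mult[OF geometric_sums[of "1/2::real"], of 2] in auto)
    then have "(\<Sum>l. c l) = 4"
      by simp
    then show "(\<Sum>r. \<Sum>l\<le>r. c l * (2 ^ (r - l) * err2 F P (r - l))) \<le> 4 * energy F P"
      using suminf_convolution_le[of c "\<lambda>r. 2 ^ r * err2 F P r"] by (simp add: energy_def)
    have "(\<Sum>r. ennreal ((1 / 4) ^ r)) = ennreal (1 / (1 - 1 / 4))"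
      by (rule suminf_ennreal_eq) (use geometric_sums[of "1/4::real"] in auto)
    also have "\<dots> \<le> ennreal 2"
      by (rule ennreal_leI) simp
    finally show "(\<Sum>r. ennreal ((1 / 4) ^ r)) \<le> 2"
      by simp
  qed auto
  finally have total: "(\<integral>\<^sup>+\<theta>. (\<Sum>r. 2 ^ r * (\<integral>\<^sup>+x. ennreal ((D \<theta> r x)\<^sup>2) \<partial>unit_measure)) \<partial>unit_measure)
      \<le> 3 * (4 * energy F P + 2)" .
  show ?thesis
  \<comment> \<open>If every phase failed, averaging would give 16 (E + 1) <= 12 E + 6 for E =
    \<open>energy F P\<close>, impossible because E is finite.\<close>
  proof (rule ccontr)
    assume "\<nexists>\<theta>. energy (\<lambda>x. F x * square_wave (real \<mu> * x + \<theta>)) (wave_convolution P (\<lambda>x. real \<mu> * x + \<theta>))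
        \<le> 16 * (energy F P + 1)"
    then have "16 * (energy F P + 1) \<le> (\<Sum>r. 2 ^ r * (\<integral>\<^sup>+x. ennreal ((D \<theta> r x)\<^sup>2) \<partial>unit_measure))" for \<theta>
      unfolding energy_def err2_def D_def by (auto simp: not_le intro: less_imp_le)
    then have "(\<integral>\<^sup>+\<theta>. 16 * (energy F P + 1) \<partial>unit_measure) \<le> 3 * (4 * energy F P + 2)"
      by (intro order.trans[OF nn_integral_mono total])
    then have "16 * (energy F P + 1) \<le> 3 * (4 * energy F P + 2)"
      by simp
    moreover obtain e where "energy F P = ennreal e" "e \<ge> 0"
      using fin by (cases "energy F P") auto
    ultimately have "ennreal (16 * (e + 1)) \<le> ennreal (3 * (4 * e + 2))"
      by (simp add: ennreal_mult ennreal_plus)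
    then show False
      using \<open>e \<ge> 0\<close> by (subst (asm) ennreal_le_iff) auto
  qed
qed

section \<open>Cell indicators and their approximants\<close>

text \<open>Multiplying by (1 + wave) / 2 or (1 - wave) / 2 keeps the part of the cell where the
  wave is 1 or -1; the odd child is the positive side.\<close>

fun cell_indicator :: "(nat \<Rightarrow> nat) \<Rightarrow> (nat \<Rightarrow> real) \<Rightarrow> nat \<Rightarrow> real \<Rightarrow> real" where
  "cell_indicator m \<theta> q = (if q \<le> 1 then (\<lambda>x. 1) else (\<lambda>x. (cell_indicator m \<theta> (q div 2) x
     + (if even q then - 1 else 1) * (cell_indicator m \<theta> (q div 2) x * square_wave (real (m (q div 2)) * x
         + \<theta> (q div 2)))) / 2))"

text \<open>The recursion of the indicators with the product replaced by its approximant. All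
  precisions are carried along because precision r of a child uses precisions 0 to r of its
  parent.\<close>

fun cell_approx :: "(nat \<Rightarrow> nat) \<Rightarrow> (nat \<Rightarrow> real) \<Rightarrow> nat \<Rightarrow> nat \<Rightarrow> real \<Rightarrow> real" where
  "cell_approx m \<theta> q = (if q \<le> 1 then (\<lambda>r x. 1) else (\<lambda>r x. (cell_approx m \<theta> (q div 2) r x
     + (if even q then - 1 else 1)
       * wave_convolution (cell_approx m \<theta> (q div 2)) (\<lambda>x. real (m (q div 2)) * x + \<theta> (q div 2)) r x) / 2))"

declare cell_indicator.simps [simp del] cell_approx.simps [simp del]

definition node_wave :: "(nat \<Rightarrow> nat) \<Rightarrow> (nat \<Rightarrow> real) \<Rightarrow> nat \<Rightarrow> real \<Rightarrow> real" where
  "node_wave m \<theta> q x = cell_indicator m \<theta> q x * square_wave (real (m q) * x + \<theta> q)"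

definition node_approx :: "(nat \<Rightarrow> nat) \<Rightarrow> (nat \<Rightarrow> real) \<Rightarrow> nat \<Rightarrow> nat \<Rightarrow> real \<Rightarrow> real" where
  "node_approx m \<theta> q = wave_convolution (cell_approx m \<theta> q) (\<lambda>x. real (m q) * x + \<theta> q)"

lemma cell_indicator_simps [simp]:
  "cell_indicator m \<theta> (Suc 0) x = 1"
  "q \<ge> 1 \<Longrightarrow> b \<le> 1 \<Longrightarrow> cell_indicator m \<theta> (2 * q + b) x
      = (cell_indicator m \<theta> q x + (2 * real b - 1) * node_wave m \<theta> q x) / 2"
  using cell_indicator.simps[of m \<theta> "2 * q + b"]
      by (auto simp: cell_indicator.simps[of m \<theta> "Suc 0"] node_wave_def le_Suc_eq)

lemma cell_approx_simps [simp]: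
  "cell_approx m \<theta> (Suc 0) r x = 1"
  "q \<ge> 1 \<Longrightarrow> b \<le> 1 \<Longrightarrow> cell_approx m \<theta> (2 * q + b) r x
      = (cell_approx m \<theta> q r x + (2 * real b - 1) * node_approx m \<theta> q r x) / 2"
  using cell_approx.simps[of m \<theta> "2 * q + b"]
      by (auto simp: cell_approx.simps[of m \<theta> "Suc 0"] node_approx_def le_Suc_eq)

lemma cell_indicator_01:
  assumes "q \<ge> 1"
  shows "cell_indicator m \<theta> q x \<in> {0, 1}"
  using assms
proof (induction q rule: heap_induct)
  case (child q b)
  then show ?case
    using square_wave_cases[of "real (m q) * x + \<theta> q"] by (auto simp: node_wave_def le_Suc_eq)
qed simp

lemma cell_indicator_measurable: "q \<ge> 1 \<Longrightarrow> cell_indicator m \<theta> q \<in> borel_measurable borel"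
proof (induction q rule: heap_induct)
  case root
  have "cell_indicator m \<theta> 1 = (\<lambda>x. 1)" by auto
  then show ?case by simp
next
  case (child q b)
  note child(3)[measurable]
  have "cell_indicator m \<theta> (2 * q + b) = (\<lambda>x. (cell_indicator m \<theta> q x + (2 * real b
      - 1) * (cell_indicator m \<theta> q x * square_wave (real (m q) * x + \<theta> q))) / 2)"
    using child by (auto simp: node_wave_def)
  then show ?case by simp
qed

lemma wave_convolution_measurable:
  assumes [measurable]: "\<And>r. P r \<in> borel_measurable borel" "g \<in> borel_measurable borel"
  shows "wave_convolution P g r \<in> borel_measurable borel"
  unfolding wave_convolution_def[abs_def] by measurable

lemma cell_approx_measurable: "q \<ge> 1 \<Longrightarrow> cell_approx m \<theta> q r \<in> borel_measurable borel"
proof (induction q arbitrary: r rule: heap_induct)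
  case root
  have "cell_approx m \<theta> 1 r = (\<lambda>x. 1)" by auto
  then show ?case by simp
next
  case (child q b)
  note child(3)[measurable]
  have [measurable]: "node_approx m \<theta> q r \<in> borel_measurable borel"
    unfolding node_approx_def by (intro wave_convolution_measurable child) measurable
  have "cell_approx m \<theta> (2 * q + b) r = (\<lambda>x. (cell_approx m \<theta> q r x + (2 * real b - 1) * node_approx m \<theta> q r x) / 2)"
    using child by auto
  then show ?case by simp
qed

lemma node_approx_measurable: "q \<ge> 1 \<Longrightarrow> node_approx m \<theta> q r \<in> borel_measurable borel"
  unfolding node_approx_def by (intro wave_convolution_measurable cell_approx_measurable) auto

lemma node_wave_measurable: "q \<ge> 1 \<Longrightarrow> node_wave m \<theta> q \<in> borel_measurable borel"
  using cell_indicator_measurable[measurable] unfolding node_wave_def[abs_def] by measurable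

lemma trig_poly_approx: "q \<ge> 1 \<Longrightarrow> trig_poly (cell_freqs m q r) (cell_approx m \<theta> q r)"
proof (induction q arbitrary: r rule: heap_induct)
  case root
  have "trig_poly {0} (\<lambda>x. Re (1 * trig_system 0 x))"
    by (rule trig_poly_single)
  moreover have "cell_approx m \<theta> 1 r = (\<lambda>x. Re (1 * trig_system 0 x))"
    by (auto simp: trig_system_cis)
  ultimately show ?case by simp
next
  case (child q b)
  have fin: "finite (cell_freqs m (2 * q + b) r)"
    using child by (intro finite_spec) auto
  have "trig_poly (cell_freqs m (2 * q + b) r) (cell_approx m \<theta> q r)"
    using child fin by (intro trig_poly_mono[OF child(3)]) auto
  moreover have "trig_poly (freq_step (cell_freqs m q) (m q) r) (node_approx m \<theta> q r)"
    unfolding node_approx_def using child by (intro trig_poly_mixed finite_spec) auto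
  then have "trig_poly (cell_freqs m (2 * q + b) r) (node_approx m \<theta> q r)"
    by (rule trig_poly_mono) (use child fin in auto)
  ultimately have "trig_poly (cell_freqs m (2 * q + b) r) (\<lambda>x. 1 / 2 * (cell_approx m \<theta> q r x + (2 * real b
      - 1) * node_approx m \<theta> q r x))"
    by (intro trig_poly_cmult trig_poly_add)
  moreover have "cell_approx m \<theta> (2 * q + b) r
      = (\<lambda>x. 1 / 2 * (cell_approx m \<theta> q r x + (2 * real b - 1) * node_approx m \<theta> q r x))"
    using child by auto
  ultimately show ?case
    by simp
qed

lemma trig_poly_node_approx:
  "q \<ge> 1 \<Longrightarrow> trig_poly (node_freqs m q) (node_approx m \<theta> q (8 * (tree_level q + 1)))"
  unfolding node_approx_def node_freqs_def by (intro trig_poly_mixed finite_spec trig_poly_approx)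

text \<open>Phases of smaller nodes determine both functions, so the phases can be chosen by
  recursion.\<close>

lemma cell_indicator_approx_cong:
  assumes "q \<ge> 1" "\<And>p. p < q \<Longrightarrow> \<theta> p = \<theta>' p"
  shows "cell_indicator m \<theta> q = cell_indicator m \<theta>' q \<and> cell_approx m \<theta> q = cell_approx m \<theta>' q"
  using assms
proof (induction q rule: heap_induct)
  case (child q b)
  then have *: "cell_indicator m \<theta> q = cell_indicator m \<theta>' q" "cell_approx m \<theta> q = cell_approx m \<theta>' q" "\<theta> q = \<theta>' q"
    by auto
  show ?case
    using child.hyps by (simp add: fun_eq_iff node_wave_def node_approx_def *)
qed (simp add: fun_eq_iff)

text \<open>The child's error is (u + v) / 2 or (u - v) / 2, where u and v are the errors of the
  parent's indicator and wave; convexity of the square gives the average of the two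
  energies.\<close>

lemma energy_child_le:
  assumes q: "q \<ge> 1" "b \<le> 1"
  shows "energy (cell_indicator m \<theta> (2 * q + b)) (cell_approx m \<theta> (2 * q + b)) \<le>
    ennreal (1 / 2) * energy (cell_indicator m \<theta> q) (cell_approx m \<theta> q)
        + ennreal (1 / 2) * energy (node_wave m \<theta> q) (node_approx m \<theta> q)"
proof -
  note meas = cell_indicator_measurable[OF q(1)] cell_approx_measurable[OF q(1)] node_wave_measurable[OF q(1)]
      node_approx_measurable[OF q(1)]
  note [measurable] = meas[THEN measurable_unit_measure]
  have "err2 (cell_indicator m \<theta> (2 * q + b)) (cell_approx m \<theta> (2 * q + b)) r
      \<le> ennreal (1 / 2) * err2 (cell_indicator m \<theta> q) (cell_approx m \<theta> q) r
          + ennreal (1 / 2) * err2 (node_wave m \<theta> q) (node_approx m \<theta> q) r" for r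
  proof -
    have "ennreal ((cell_indicator m \<theta> (2 * q + b) x - cell_approx m \<theta> (2 * q + b) r x)\<^sup>2)
      \<le> ennreal (1 / 2) * ennreal ((cell_indicator m \<theta> q x - cell_approx m \<theta> q r x)\<^sup>2)
        + ennreal (1 / 2) * ennreal ((node_wave m \<theta> q x - node_approx m \<theta> q r x)\<^sup>2)" for x
    proof -
      define u v where "u = cell_indicator m \<theta> q x - cell_approx m \<theta> q r x" and "v
          = node_wave m \<theta> q x - node_approx m \<theta> q r x"
      have "cell_indicator m \<theta> (2 * q + b) x - cell_approx m \<theta> (2 * q + b) r x = (u + (2 * real b - 1) * v) / 2"
        unfolding u_def v_def cell_indicator_simps(2)[OF q] cell_approx_simps(2)[OF q] by (simp add: field_simps)
      moreover have "b = 0 \<or> b = 1"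
        using q by auto
      then have "((u + (2 * real b - 1) * v) / 2)\<^sup>2 \<le> 1 / 2 * u\<^sup>2 + 1 / 2 * v\<^sup>2"
        using sum_squares_bound[of u v] sum_squares_bound[of u "- v"]
        by (auto simp: power2_eq_square algebra_simps)
      ultimately have "ennreal ((cell_indicator m \<theta> (2 * q + b) x - cell_approx m \<theta> (2 * q + b) r x)\<^sup>2)
          \<le> ennreal (1 / 2 * u\<^sup>2 + 1 / 2 * v\<^sup>2)"
        by (simp only: ennreal_leI)
      also have "\<dots> = ennreal (1 / 2) * ennreal (u\<^sup>2) + ennreal (1 / 2) * ennreal (v\<^sup>2)"
        by (simp only: ennreal_plus ennreal_mult zero_le_power2 zero_le_divide_1_iff zero_le_numeral
            mult_nonneg_nonneg)
      finally show ?thesis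
        unfolding u_def v_def .
    qed
    then have "err2 (cell_indicator m \<theta> (2 * q + b)) (cell_approx m \<theta> (2 * q + b)) r
        \<le> (\<integral>\<^sup>+x. ennreal (1 / 2) * ennreal ((cell_indicator m \<theta> q x - cell_approx m \<theta> q r x)\<^sup>2)
        + ennreal (1 / 2) * ennreal ((node_wave m \<theta> q x - node_approx m \<theta> q r x)\<^sup>2) \<partial>unit_measure)"
      unfolding err2_def by (rule nn_integral_mono)
    also have "\<dots> = ennreal (1 / 2) * err2 (cell_indicator m \<theta> q) (cell_approx m \<theta> q) r
        + ennreal (1 / 2) * err2 (node_wave m \<theta> q) (node_approx m \<theta> q) r"
      unfolding err2_def by (subst nn_integral_add) (simp_all add: nn_integral_cmult)
    finally show ?thesis .
  qed
  then have "energy (cell_indicator m \<theta> (2 * q + b)) (cell_approx m \<theta> (2 * q + b)) \<le> (\<Sum>r. 2 ^ r *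
      (ennreal (1 / 2) * err2 (cell_indicator m \<theta> q) (cell_approx m \<theta> q) r
          + ennreal (1 / 2) * err2 (node_wave m \<theta> q) (node_approx m \<theta> q) r))"
    unfolding energy_def by (intro suminf_le mult_left_mono) auto
  also have "\<dots> = (\<Sum>r. ennreal (1 / 2) * (2 ^ r * err2 (cell_indicator m \<theta> q) (cell_approx m \<theta> q) r)
      + ennreal (1 / 2) * (2 ^ r * err2 (node_wave m \<theta> q) (node_approx m \<theta> q) r))"
    by (intro suminf_cong) (simp only: distrib_left mult_ac)
  also have "\<dots> = (\<Sum>r. ennreal (1 / 2) * (2 ^ r * err2 (cell_indicator m \<theta> q) (cell_approx m \<theta> q) r))
      + (\<Sum>r. ennreal (1 / 2) * (2 ^ r * err2 (node_wave m \<theta> q) (node_approx m \<theta> q) r))"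
    by (rule suminf_add[symmetric]) auto
  finally show ?thesis
    by (simp only: ennreal_suminf_cmult energy_def)
qed

text \<open>Cells on level k satisfy E <= 16^k - 1 by induction: the root has no error, a wave costs
  at most 16 (E + 1) <= 16^(k+1), and a child is bounded by the average of the two.\<close>

lemma phases_exist:
  "\<exists>\<theta>. \<forall>q\<ge>1. energy (node_wave m \<theta> q) (node_approx m \<theta> q) \<le> ennreal (16 ^ (tree_level q + 1))"
proof -
  \<comment> \<open>Finiteness of the energy is a premise inside \<open>Q\<close>, since it is
    established only after all phases have been chosen, by the induction on the tree.\<close>
  define Q where "Q f q t \<longleftrightarrow> (q \<ge> 1 \<longrightarrow> energy (cell_indicator m f q) (cell_approx m f q) < \<infinity> \<longrightarrow>
      energy (\<lambda>x. cell_indicator m f q x * square_wave (real (m q) * x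
          + t)) (wave_convolution (cell_approx m f q) (\<lambda>x. real (m q) * x + t))
      \<le> 16 * (energy (cell_indicator m f q) (cell_approx m f q) + 1))" for f :: "nat \<Rightarrow> real" and q :: nat and t
  have "\<exists>\<theta>. \<forall>q. Q \<theta> q (\<theta> q)"
  proof (rule dependent_wellorder_choice)
    fix t and f g :: "nat \<Rightarrow> real" and q :: nat
    assume fg: "\<And>p. p < q \<Longrightarrow> f p = g p"
    show "Q f q t = Q g q t"
      using cell_indicator_approx_cong[of q f g m] fg by (cases "q \<ge> 1") (auto simp: Q_def)
  next
    fix q f
    show "\<exists>t. Q f q t"
    proof (cases "q \<ge> 1 \<and> energy (cell_indicator m f q) (cell_approx m f q) < \<infinity>")
      case True
      then have "\<bar>cell_indicator m f q x\<bar> \<le> 1" for x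
        using cell_indicator_01[of q m f x] by auto
      then show ?thesis
        unfolding Q_def using phase_exists[of "cell_indicator m f q" "cell_approx m f q" "m q"] True
          cell_indicator_measurable[of q m f] cell_approx_measurable[of q m f] by blast
    qed (auto simp: Q_def)
  qed
  then obtain \<theta> where "\<And>q. Q \<theta> q (\<theta> q)"
    by blast
  then have \<theta>: "energy (node_wave m \<theta> q) (node_approx m \<theta> q)
      \<le> 16 * (energy (cell_indicator m \<theta> q) (cell_approx m \<theta> q) + 1)"
    if "q \<ge> 1" "energy (cell_indicator m \<theta> q) (cell_approx m \<theta> q) < \<infinity>" for q
    using that unfolding Q_def node_wave_def[abs_def] node_approx_def by blast
  have step: "energy (node_wave m \<theta> q) (node_approx m \<theta> q) \<le> ennreal (16 ^ (k + 1))"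
    if "q \<ge> 1" "energy (cell_indicator m \<theta> q) (cell_approx m \<theta> q) \<le> ennreal (16 ^ k - 1)" for q k
  proof -
    have "energy (cell_indicator m \<theta> q) (cell_approx m \<theta> q) < \<infinity>"
      using that(2) by (simp add: le_less_trans)
    then have "energy (node_wave m \<theta> q) (node_approx m \<theta> q)
        \<le> 16 * (energy (cell_indicator m \<theta> q) (cell_approx m \<theta> q) + 1)"
      using \<theta> that by blast
    also have "\<dots> \<le> 16 * (ennreal (16 ^ k - 1) + 1)"
      using that by (intro mult_left_mono add_mono) auto
    also have "16 * (ennreal e + 1) = ennreal (16 * (e + 1))" if "e \<ge> 0" for e
      using that by (simp add: ennreal_mult ennreal_plus)
    from this[of "16 ^ k - 1"] have "16 * (ennreal (16 ^ k - 1) + 1) = ennreal (16 * ((16 ^ k - 1) + 1))"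
      by simp
    finally show ?thesis
      by simp
  qed
  have "energy (cell_indicator m \<theta> q) (cell_approx m \<theta> q) \<le> ennreal (16 ^ tree_level q - 1)" if "q \<ge> 1" for q
    using that
  proof (induction q rule: heap_induct)
    case root
    have "energy (cell_indicator m \<theta> 1) (cell_approx m \<theta> 1) = 0"
      by (simp add: energy_def err2_def)
    then show ?case
      by (simp only: zero_le)
  next
    case (child q b)
    have "energy (cell_indicator m \<theta> (2 * q + b)) (cell_approx m \<theta> (2 * q + b)) \<le>
      ennreal (1 / 2) * energy (cell_indicator m \<theta> q) (cell_approx m \<theta> q)
          + ennreal (1 / 2) * energy (node_wave m \<theta> q) (node_approx m \<theta> q)"
      using child by (intro energy_child_le)
    also have "\<dots> \<le> ennreal (1 / 2) * ennreal (16 ^ tree_level q - 1)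
        + ennreal (1 / 2) * ennreal (16 ^ (tree_level q + 1))"
      using child by (intro add_mono mult_left_mono step) auto
    also have "\<dots> = ennreal (1 / 2 * (16 ^ tree_level q - 1) + 1 / 2 * 16 ^ (tree_level q + 1))"
    proof -
      have "ennreal (1 / 2) * ennreal a + ennreal (1 / 2) * ennreal b = ennreal (1 / 2 * a + 1 / 2 * b)"
        if "a \<ge> 0" "b \<ge> 0" for a b
        using that by (simp only: ennreal_plus ennreal_mult zero_le_divide_1_iff zero_le_numeral mult_nonneg_nonneg)
      then show ?thesis
        by simp
    qed
    also have "\<dots> \<le> ennreal (16 ^ tree_level (2 * q + b) - 1)"
    proof (rule ennreal_leI)
      have *: "1 / 2 * (a - 1) + 1 / 2 * (16 * a) \<le> 16 * a - 1" if "1 \<le> a" for a :: real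
        using that by simp
      have "(1::real) \<le> 16 ^ tree_level q" by simp
      then show "1 / 2 * (16 ^ tree_level q - 1) + 1 / 2 * 16 ^ (tree_level q + 1)
          \<le> (16 ^ tree_level (2 * q + b) - 1 :: real)"
        unfolding tree_level_simps(2)[OF child(1,2)] Suc_eq_plus1[symmetric] power_Suc by (rule *)
    qed
    finally show ?case .
  qed
  then show ?thesis
    using step by blast
qed

text \<open>The weighted sum dominates its term of index 8(k+1), whose weight is
  16^(2(k+1)).\<close>

lemma node_error_exists:
  "\<exists>\<theta>. \<forall>q\<ge>1. err2 (node_wave m \<theta> q) (node_approx m \<theta> q) (8 * (tree_level q + 1))
      \<le> ennreal (1 / 16 ^ (tree_level q + 1))"
proof -
  obtain \<theta> where \<theta>: "\<And>q. q \<ge> 1 \<Longrightarrow> energy (node_wave m \<theta> q) (node_approx m \<theta> q) \<le> ennreal (16 ^ (tree_level q + 1))"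
    using phases_exist by blast
  have "err2 (node_wave m \<theta> q) (node_approx m \<theta> q) (8 * (tree_level q + 1))
      \<le> ennreal (1 / 16 ^ (tree_level q + 1))" if q: "q \<ge> 1" for q
  proof -
    define r where "r = 8 * (tree_level q + 1)"
    define e where "e = err2 (node_wave m \<theta> q) (node_approx m \<theta> q) r"
    have "2 ^ r * e \<le> (\<Sum>r. 2 ^ r * err2 (node_wave m \<theta> q) (node_approx m \<theta> q) r)"
      unfolding e_def using sum_le_suminf[of "\<lambda>r. 2 ^ r * err2 (node_wave m \<theta> q) (node_approx m \<theta> q) r" "{r}"] by simp
    also have "\<dots> \<le> ennreal (16 ^ (tree_level q + 1))"
      using \<theta>[OF q] unfolding energy_def .
    finally have 1: "2 ^ r * e \<le> ennreal (16 ^ (tree_level q + 1))" .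
    have r: "(2::real) ^ r = 16 ^ (tree_level q + 1) * 16 ^ (tree_level q + 1)"
      unfolding r_def power_mult power_mult_distrib[symmetric] by simp
    have 2: "(2::ennreal) ^ r = ennreal (2 ^ r)"
      by (simp flip: ennreal_power)
    have "e = ennreal (1 / 2 ^ r) * (2 ^ r * e)"
      unfolding 2 mult.assoc[symmetric] by (simp flip: ennreal_mult)
    also have "\<dots> \<le> ennreal (1 / 2 ^ r) * ennreal (16 ^ (tree_level q + 1))"
      by (intro mult_left_mono 1) auto
    also have "\<dots> = ennreal (1 / 16 ^ (tree_level q + 1))"
      unfolding r by (simp flip: ennreal_mult)
    finally show ?thesis
      unfolding e_def r_def .
  qed
  then show ?thesis
    by blast
qed

section \<open>Sums over tree levels and the resulting node system\<close>

lemma sum_children: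
  fixes f :: "nat \<Rightarrow> 'a :: comm_monoid_add"
  assumes "a \<le> b"
  shows "sum f {2 * a..<2 * b} = (\<Sum>q\<in>{a..<b}. f (2 * q) + f (Suc (2 * q)))"
  using assms by (induction b rule: dec_induct) (simp_all add: add.assoc)

lemma sum_levels:
  fixes f :: "nat \<Rightarrow> 'a :: comm_monoid_add"
  assumes "a \<le> b"
  shows "sum f {2 ^ a..<2 ^ b} = (\<Sum>k\<in>{a..<b}. sum f {2 ^ k..<2 ^ Suc k})"
  using assms
proof (induction b rule: dec_induct)
  case (step b)
  have "sum f {2 ^ a..<2 ^ Suc b} = sum f {2 ^ a..<2 ^ b} + sum f {2 ^ b..<2 ^ Suc b}"
    using step by (intro sum.atLeastLessThan_concat[symmetric] power_increasing) auto
  then show ?case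
    using step by simp
qed simp

text \<open>Children split the value of their parent, so every level inherits the total of the root:
  the cells of one level form a partition.\<close>

lemma sum_tree_level:
  fixes F :: "nat \<Rightarrow> real"
  assumes "F 1 = 1" "\<And>q. q \<ge> 1 \<Longrightarrow> F (2 * q) + F (Suc (2 * q)) = F q"
  shows "sum F {2 ^ k..<2 ^ Suc k} = 1"
proof (induction k)
  case (Suc k)
  have "sum F {2 ^ Suc k..<2 ^ Suc (Suc k)} = sum F {2 * 2 ^ k..<2 * 2 ^ Suc k}"
    by simp
  also have "\<dots> = (\<Sum>q\<in>{2 ^ k..<2 ^ Suc k}. F (2 * q) + F (Suc (2 * q)))"
    by (rule sum_children) simp
  also have "\<dots> = sum F {2 ^ k..<2 ^ Suc k}"
    by (intro sum.cong assms) (auto intro: order.trans[of 1 "2 ^ k"])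
  finally show ?case
    using Suc by simp
qed (use assms in \<open>simp add: numeral_2_eq_2\<close>)

lemma cell_indicator_children:
  assumes "q \<ge> 1"
  shows "cell_indicator m \<theta> (2 * q) x + cell_indicator m \<theta> (Suc (2 * q)) x = cell_indicator m \<theta> q x"
    and "cell_indicator m \<theta> (Suc (2 * q)) x - cell_indicator m \<theta> (2 * q) x = node_wave m \<theta> q x"
  using cell_indicator_simps(2)[OF assms, of 0 m \<theta> x] cell_indicator_simps(2)[OF assms, of 1 m \<theta> x]
  by (simp_all add: field_simps)

lemma node_wave_square: "q \<ge> 1 \<Longrightarrow> (node_wave m \<theta> q x)\<^sup>2 = cell_indicator m \<theta> q x"
  using cell_indicator_01[of q m \<theta> x] square_wave_cases[of "real (m q) * x + \<theta> q"] by (auto simp: node_wave_def)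

text \<open>Interface to the final construction: the waves appear as differences of the indicators
  of the two children, while multipliers, phases and precisions are hidden.\<close>

lemma node_system_exists:
  obtains U :: "nat \<Rightarrow> nat set" and A :: "nat \<Rightarrow> nat \<Rightarrow> complex" and F :: "nat \<Rightarrow> real \<Rightarrow> real"
  where "\<And>q. q \<ge> 1 \<Longrightarrow> finite (U q)" "\<And>q. q \<ge> 1 \<Longrightarrow> U q \<subseteq> {1..2 ^ (121 * (tree_level q + 1))}"
    and "\<And>p q. p \<ge> 1 \<Longrightarrow> q \<ge> 1 \<Longrightarrow> p \<noteq> q \<Longrightarrow> U p \<inter> U q = {}"
    and "\<And>x. F 1 x = 1" "\<And>q x. q \<ge> 1 \<Longrightarrow> F q x \<in> {0, 1}"
    and "\<And>q x. q \<ge> 1 \<Longrightarrow> F (2 * q) x + F (Suc (2 * q)) x = F q x"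
    and "\<And>k. (\<Sum>q\<in>{2 ^ k..<2 ^ Suc k}. \<Sum>n\<in>U q. (cmod (A q n))\<^sup>2) \<le> 8"
    and "AE x in unit_measure. summable (\<lambda>i. \<bar>(\<Sum>n\<in>U (Suc i). Re (A (Suc i) n * trig_system n x))
        - (F (Suc (2 * Suc i)) x - F (2 * Suc i) x)\<bar>)"
proof -
  obtain m where m: "\<And>q. q \<ge> 1 \<Longrightarrow> m q \<le> 2 ^ (95 * (tree_level q + 1))" "\<And>q. q \<ge> 1 \<Longrightarrow> 0 \<notin> node_freqs m q"
    "\<And>p q. 1 \<le> p \<Longrightarrow> p < q \<Longrightarrow> node_freqs m p \<inter> node_freqs m q = {}"
    using node_freqs_exist by (metis order.strict_trans1 less_imp_le)
  obtain \<theta> where \<theta>: "\<And>q. q \<ge> 1 \<Longrightarrow> err2 (node_wave m \<theta> q) (node_approx m \<theta> q) (8 * (tree_level q + 1))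
      \<le> ennreal (1 / 16 ^ (tree_level q + 1))"
    using node_error_exists by blast
  define U where "U = node_freqs m"
  define H where "H q = node_approx m \<theta> q (8 * (tree_level q + 1))" for q
  define S where "S = node_wave m \<theta>"
  define F where "F = cell_indicator m \<theta>"
  define Z where "Z q x = S q x - H q x" for q x
  have "\<exists>a. \<forall>x. H q x = (\<Sum>n\<in>U q. Re (a n * trig_system n x))" if "q \<ge> 1" for q
    using trig_poly_node_approx[OF that, of m \<theta>] unfolding trig_poly_def H_def U_def .
  then obtain A where A: "\<And>q x. q \<ge> 1 \<Longrightarrow> H q x = (\<Sum>n\<in>U q. Re (A q n * trig_system n x))"
    by metis
  have fin: "finite (U q)" if "q \<ge> 1" for q
    using that unfolding U_def by (rule finite_node_freqs)
  have Fdef: "F 1 x = 1" "q \<ge> 1 \<Longrightarrow> F q x \<in> {0, 1}" "q \<ge> 1 \<Longrightarrow> F (2 * q) x + F (Suc (2 * q)) x = F q x" for x q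
    unfolding F_def using cell_indicator_01 cell_indicator_children(1) by auto
  have SF: "q \<ge> 1 \<Longrightarrow> S q x = F (Suc (2 * q)) x - F (2 * q) x" for q x
    unfolding F_def S_def by (simp only: cell_indicator_children(2))
  have mS: "S q \<in> borel_measurable borel" and mH: "H q \<in> borel_measurable borel" and mF: "F q \<in>
      borel_measurable borel"
    if "q \<ge> 1" for q
    using that unfolding S_def H_def F_def
    by (auto intro: node_wave_measurable node_approx_measurable cell_indicator_measurable)
  have mZ: "Z q \<in> borel_measurable borel" if "q \<ge> 1" for q
    unfolding Z_def[abs_def] using mS[OF that] mH[OF that] by measurable
  have Z2: "(\<integral>\<^sup>+x. ennreal ((Z q x)\<^sup>2) \<partial>unit_measure) \<le> ennreal (1 / 16 ^ (tree_level q + 1))" if "q \<ge> 1" for q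
    using \<theta>[OF that] unfolding err2_def Z_def S_def H_def .
  \<comment> \<open>With H = S - Z one has H^2 <= 2 S^2 + 2 Z^2, and S^2 is the indicator of the
    cell.\<close>
  have energy: "ennreal ((\<Sum>n\<in>U q. (cmod (A q n))\<^sup>2) / 2)
      \<le> 2 * (\<integral>\<^sup>+x. ennreal (F q x) \<partial>unit_measure) + 2 * ennreal (1 / 16 ^ (tree_level q + 1))"
    if q: "q \<ge> 1" for q
  proof -
    have "((\<lambda>x. (\<Sum>n\<in>U q. Re (A q n * trig_system n x))\<^sup>2) has_integral (\<Sum>n\<in>U q. (cmod (A q n))\<^sup>2) / 2) {0..1}"
      using fin[OF q] m(2)[OF q] unfolding U_def by (rule has_integral_trig_poly_square)
    then have "((\<lambda>x. (H q x)\<^sup>2) has_integral (\<Sum>n\<in>U q. (cmod (A q n))\<^sup>2) / 2) {0..1}"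
      using A[OF q] by simp
    then have "ennreal ((\<Sum>n\<in>U q. (cmod (A q n))\<^sup>2) / 2) = (\<integral>\<^sup>+x. ennreal ((H q x)\<^sup>2) \<partial>unit_measure)"
      using mH[OF q] by (intro nn_integral_unit_has_integral[symmetric]) auto
    also have "\<dots> \<le> (\<integral>\<^sup>+x. 2 * ennreal (F q x) + 2 * ennreal ((Z q x)\<^sup>2) \<partial>unit_measure)"
    proof (rule nn_integral_mono)
      fix x
      have "(H q x)\<^sup>2 \<le> 2 * (S q x)\<^sup>2 + 2 * (Z q x)\<^sup>2"
        using sum_squares_bound[of "S q x" "- Z q x"] unfolding Z_def by (simp add: power2_eq_square algebra_simps)
      also have "(S q x)\<^sup>2 = F q x"
        unfolding S_def F_def by (rule node_wave_square[OF q])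
      finally have "ennreal ((H q x)\<^sup>2) \<le> ennreal (2 * F q x + 2 * (Z q x)\<^sup>2)"
        by (rule ennreal_leI)
      also have "\<dots> = 2 * ennreal (F q x) + 2 * ennreal ((Z q x)\<^sup>2)"
        using Fdef(2)[OF q, of x] by (subst ennreal_plus) (auto simp: ennreal_mult)
      finally show "ennreal ((H q x)\<^sup>2) \<le> 2 * ennreal (F q x) + 2 * ennreal ((Z q x)\<^sup>2)" .
    qed
    also have "\<dots> = 2 * (\<integral>\<^sup>+x. ennreal (F q x) \<partial>unit_measure) + 2 * (\<integral>\<^sup>+x. ennreal ((Z q x)\<^sup>2) \<partial>unit_measure)"
      using measurable_unit_measure[OF mF[OF q]] measurable_unit_measure[OF mZ[OF q]]
      by (subst nn_integral_add) (auto simp: nn_integral_cmult)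
    also have "\<dots> \<le> 2 * (\<integral>\<^sup>+x. ennreal (F q x) \<partial>unit_measure) + 2 * ennreal (1 / 16 ^ (tree_level q + 1))"
      by (intro add_mono mult_left_mono Z2 q) auto
    finally show ?thesis .
  qed
  \<comment> \<open>The measures of the cells of a level add up to 1, so half the energy is at most
    2 + 2 * 2^k / 16^(k+1) <= 4.\<close>
  have level_energy: "(\<Sum>q\<in>{2 ^ k..<2 ^ Suc k}. \<Sum>n\<in>U q. (cmod (A q n))\<^sup>2) \<le> 8" for k
  proof -
    have q1: "q \<ge> 1" "tree_level q = k" if "q \<in> {2 ^ k..<2 ^ Suc k}" for q
    proof -
      show "q \<ge> 1" using that by (auto intro: order.trans[of 1 "2 ^ k"])
      then show "tree_level q = k" using that tree_level_eq_iff by blast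
    qed
    have "ennreal (\<Sum>q\<in>{2 ^ k..<2 ^ Suc k}. (\<Sum>n\<in>U q. (cmod (A q n))\<^sup>2) / 2)
      = (\<Sum>q\<in>{2 ^ k..<2 ^ Suc k}. ennreal ((\<Sum>n\<in>U q. (cmod (A q n))\<^sup>2) / 2))"
      by (rule sum_ennreal[symmetric]) (auto intro!: sum_nonneg)
    also have "\<dots> \<le> (\<Sum>q\<in>{2 ^ k..<2 ^ Suc k}. 2 * (\<integral>\<^sup>+x. ennreal (F q x) \<partial>unit_measure)
        + 2 * ennreal (1 / 16 ^ (k + 1)))"
      using energy q1 by (intro sum_mono) metis
    also have "\<dots> = 2 * (\<integral>\<^sup>+x. (\<Sum>q\<in>{2 ^ k..<2 ^ Suc k}. ennreal (F q x)) \<partial>unit_measure)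
        + of_nat (2 ^ k) * (2 * ennreal (1 / 16 ^ (k + 1)))"
      using q1 mF[THEN measurable_unit_measure] by (subst nn_integral_sum) (auto simp: sum.distrib sum_distrib_left)
    also have "(\<integral>\<^sup>+x. (\<Sum>q\<in>{2 ^ k..<2 ^ Suc k}. ennreal (F q x)) \<partial>unit_measure) = (\<integral>\<^sup>+x. 1 \<partial>unit_measure)"
    proof (rule nn_integral_cong)
      fix x
      have "0 \<le> F q x" if "q \<in> {2 ^ k..<2 ^ Suc k}" for q
        using Fdef(2)[OF q1(1)[OF that], of x] by auto
      then have "(\<Sum>q\<in>{2 ^ k..<2 ^ Suc k}. ennreal (F q x)) = ennreal (\<Sum>q\<in>{2 ^ k..<2 ^ Suc k}. F q x)"
        by (rule sum_ennreal)
      also have "(\<Sum>q\<in>{2 ^ k..<2 ^ Suc k}. F q x) = 1"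
        by (rule sum_tree_level) (rule Fdef; simp)+
      finally show "(\<Sum>q\<in>{2 ^ k..<2 ^ Suc k}. ennreal (F q x)) = 1"
        by simp
    qed
    also have "\<dots> = 1"
      by simp
    also have "of_nat (2 ^ k) * (2 * ennreal (1 / 16 ^ (k + 1))) = ennreal (2 ^ k * (2 * (1 / 16 ^ (k + 1))))"
    proof -
      have "of_nat (2 ^ k) = ennreal (2 ^ k)" "(2::ennreal) = ennreal 2"
        by (simp_all flip: ennreal_power)
      then show ?thesis
        by (simp only: ennreal_mult[symmetric] zero_le_power zero_le_numeral zero_le_one divide_nonneg_nonneg
            mult_nonneg_nonneg)
    qed
    also have "\<dots> \<le> ennreal 2"
    proof (rule ennreal_leI)
      have "(2::real) ^ k \<le> 16 ^ k" by (rule power_mono) auto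
      then have "(2::real) ^ k \<le> 16 * 16 ^ k"
        by (rule order.trans) simp
      then show "2 ^ k * (2 * (1 / 16 ^ (k + 1))) \<le> (2::real)"
        by (simp add: field_simps)
    qed
    also have "2 * 1 + ennreal 2 = ennreal 4"
      by simp
    finally have "ennreal (\<Sum>q\<in>{2 ^ k..<2 ^ Suc k}. (\<Sum>n\<in>U q. (cmod (A q n))\<^sup>2) / 2) \<le> ennreal 4"
      by (simp add: add_left_mono)
    then have "(\<Sum>q\<in>{2 ^ k..<2 ^ Suc k}. (\<Sum>n\<in>U q. (cmod (A q n))\<^sup>2) / 2) \<le> 4"
      by (subst (asm) ennreal_le_iff) auto
    then show ?thesis
      by (simp add: sum_divide_distrib[symmetric])
  qed
  \<comment> \<open>The L1 norms of the errors have a finite sum, so the errors themselves are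
    summable almost everywhere.\<close>
  have "(\<integral>\<^sup>+x. (\<Sum>i. ennreal \<bar>Z (Suc i) x\<bar>) \<partial>unit_measure) = (\<Sum>i. \<integral>\<^sup>+x. ennreal \<bar>Z (Suc i) x\<bar> \<partial>unit_measure)"
    using mZ[THEN measurable_unit_measure] by (intro nn_integral_suminf) auto
  also have "\<dots> \<le> (\<Sum>i. ennreal (1 / (real (Suc i))\<^sup>2))"
  proof (intro suminf_le)
    fix i
    define q where "q = Suc i"
    \<comment> \<open>\<delta> bounds the L2 norm of the error. The inequality |Z| <= \<delta> / 2 +
      Z^2 / (2 \<delta>) integrates to the bound \<delta>, and q < 2^(k+1) makes this at most 1 /
      q^2.\<close>
    define \<delta> :: real where "\<delta> = 1 / 4 ^ (tree_level q + 1)"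
    have q: "q \<ge> 1" and \<delta>: "\<delta> > 0"
      by (auto simp: q_def \<delta>_def)
    have \<delta>2: "\<delta> * \<delta> = 1 / 16 ^ (tree_level q + 1)"
      by (simp add: \<delta>_def flip: power_mult_distrib)
    have "(\<integral>\<^sup>+x. ennreal \<bar>Z q x\<bar> \<partial>unit_measure)
        \<le> (\<integral>\<^sup>+x. ennreal (\<delta> / 2) + ennreal (1 / (2 * \<delta>)) * ennreal ((Z q x)\<^sup>2) \<partial>unit_measure)"
    proof (rule nn_integral_mono)
      fix x
      have "0 \<le> (\<bar>Z q x\<bar> - \<delta>)\<^sup>2" by simp
      then have "2 * \<delta> * \<bar>Z q x\<bar> \<le> \<delta> * \<delta> + (Z q x)\<^sup>2"
        by (simp add: power2_diff mult_ac) (simp add: power2_eq_square algebra_simps)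
      then have "\<bar>Z q x\<bar> \<le> \<delta> / 2 + 1 / (2 * \<delta>) * (Z q x)\<^sup>2"
        using \<delta> by (simp add: field_simps)
      then have "ennreal \<bar>Z q x\<bar> \<le> ennreal (\<delta> / 2 + 1 / (2 * \<delta>) * (Z q x)\<^sup>2)"
        by (rule ennreal_leI)
      also have "\<dots> = ennreal (\<delta> / 2) + ennreal (1 / (2 * \<delta>) * (Z q x)\<^sup>2)"
        using \<delta> by (intro ennreal_plus) auto
      also have "ennreal (1 / (2 * \<delta>) * (Z q x)\<^sup>2) = ennreal (1 / (2 * \<delta>)) * ennreal ((Z q x)\<^sup>2)"
        using \<delta> by (intro ennreal_mult) auto
      finally show "ennreal \<bar>Z q x\<bar> \<le> ennreal (\<delta> / 2) + ennreal (1 / (2 * \<delta>)) * ennreal ((Z q x)\<^sup>2)" .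
    qed
    also have "\<dots> = ennreal (\<delta> / 2) + ennreal (1 / (2 * \<delta>)) * (\<integral>\<^sup>+x. ennreal ((Z q x)\<^sup>2) \<partial>unit_measure)"
      using measurable_unit_measure[OF mZ[OF q]] by (subst nn_integral_add) (auto simp: nn_integral_cmult)
    also have "\<dots> \<le> ennreal (\<delta> / 2) + ennreal (1 / (2 * \<delta>)) * ennreal (\<delta> * \<delta>)"
      unfolding \<delta>2 by (intro add_left_mono mult_left_mono Z2 q) auto
    also have "ennreal (1 / (2 * \<delta>)) * ennreal (\<delta> * \<delta>) = ennreal (1 / (2 * \<delta>) * (\<delta> * \<delta>))"
      using \<delta> by (intro ennreal_mult[symmetric]) auto
    also have "ennreal (\<delta> / 2) + \<dots> = ennreal (\<delta> / 2 + 1 / (2 * \<delta>) * (\<delta> * \<delta>))"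
      using \<delta> by (intro ennreal_plus[symmetric]) auto
    also have "\<delta> / 2 + 1 / (2 * \<delta>) * (\<delta> * \<delta>) = \<delta>"
      using \<delta> by (simp add: field_simps)
    also have "ennreal \<delta> \<le> ennreal (1 / (real q)\<^sup>2)"
    proof (rule ennreal_leI)
      have "real q \<le> 2 ^ (tree_level q + 1)"
        using tree_level_bounds(2)[OF q] by (simp flip: of_nat_less_iff[where ?'a = real])
      then have "(real q)\<^sup>2 \<le> (2 ^ (tree_level q + 1))\<^sup>2"
        by (intro power_mono) auto
      also have "(2 ^ (tree_level q + 1))\<^sup>2 = (4::real) ^ (tree_level q + 1)"
        by (simp add: power2_eq_square flip: power_mult_distrib)
      finally show "\<delta> \<le> 1 / (real q)\<^sup>2"
        unfolding \<delta>_def using q by (intro divide_left_mono) auto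
    qed
    finally show "(\<integral>\<^sup>+x. ennreal \<bar>Z (Suc i) x\<bar> \<partial>unit_measure) \<le> ennreal (1 / (real (Suc i))\<^sup>2)"
      unfolding q_def .
  qed auto
  also have "\<dots> = ennreal (pi\<^sup>2 / 6)"
    using inverse_squares_sums by (intro suminf_ennreal_eq) (auto simp: add.commute)
  finally have "(\<integral>\<^sup>+x. (\<Sum>i. ennreal \<bar>Z (Suc i) x\<bar>) \<partial>unit_measure) \<noteq> \<infinity>"
    by (auto simp: top_unique)
  then have "AE x in unit_measure. (\<Sum>i. ennreal \<bar>Z (Suc i) x\<bar>) \<noteq> \<infinity>"
    using mZ[THEN measurable_unit_measure] by (intro nn_integral_noteq_infinite) auto
  then have ae: "AE x in unit_measure. summable (\<lambda>i. \<bar>(\<Sum>n\<in>U (Suc i). Re (A (Suc i) n * trig_system n x))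
        - (F (Suc (2 * Suc i)) x - F (2 * Suc i) x)\<bar>)"
  proof (rule AE_mp, intro AE_I2 impI)
    fix x assume "(\<Sum>i. ennreal \<bar>Z (Suc i) x\<bar>) \<noteq> \<infinity>"
    then have "summable (\<lambda>i. \<bar>Z (Suc i) x\<bar>)"
      by (intro summable_suminf_not_top) auto
    moreover have "\<bar>Z (Suc i) x\<bar> = \<bar>(\<Sum>n\<in>U (Suc i). Re (A (Suc i) n * trig_system n x))
        - (F (Suc (2 * Suc i)) x - F (2 * Suc i) x)\<bar>" for i
    proof -
      have i: "1 \<le> Suc i" by simp
      show ?thesis
        unfolding Z_def A[OF i] SF[OF i] by (rule abs_minus_commute)
    qed
    ultimately show "summable (\<lambda>i. \<bar>(\<Sum>n\<in>U (Suc i). Re (A (Suc i) n * trig_system n x))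
        - (F (Suc (2 * Suc i)) x - F (2 * Suc i) x)\<bar>)"
      by simp
  qed
  have U1: "U q \<subseteq> {1..2 ^ (121 * (tree_level q + 1))}" if "q \<ge> 1" for q
  proof
    fix n assume n: "n \<in> U q"
    then have "n \<le> 2 ^ (121 * (tree_level q + 1))"
      using that m(1) unfolding U_def by (intro node_freqs_le[of q m]) auto
    moreover have "n \<noteq> 0"
      using m(2)[OF that] n unfolding U_def by metis
    ultimately show "n \<in> {1..2 ^ (121 * (tree_level q + 1))}"
      by simp
  qed
  have dis: "U p \<inter> U q = {}" if "p \<ge> 1" "q \<ge> 1" "p \<noteq> q" for p q
    using that m(3)[of p q] m(3)[of q p] unfolding U_def by (cases p q rule: linorder_cases) auto
  show thesis
    by (rule that[of U F A]) (fact fin U1 dis Fdef level_energy ae)+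
qed

section \<open>Permutations and coefficients\<close>

text \<open>The position of \<open>n\<close> is the number of its predecessors when the elements are sorted by the
  size of the smallest member of the chain containing them, ties being broken by value.\<close>

lemma chain_enumeration:
  fixes \<C> :: "nat set set"
  assumes fin: "\<And>A. A \<in> \<C> \<Longrightarrow> finite A \<and> A \<subseteq> {1..}"
    and chain: "\<And>A B. A \<in> \<C> \<Longrightarrow> B \<in> \<C> \<Longrightarrow> A \<subseteq> B \<or> B \<subseteq> A"
    and cover: "\<And>n. n \<ge> 1 \<Longrightarrow> \<exists>A\<in>\<C>. n \<in> A"
  shows "\<exists>\<sigma>. bij_betw \<sigma> {1..} {1..} \<and> (\<forall>A\<in>\<C>. \<sigma> ` {1..card A} = A)"
proof -
  define rank where "rank n = (LEAST k. \<exists>A\<in>\<C>. n \<in> A \<and> card A = k)" for n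
  define pre where "pre n = {p. p \<ge> 1 \<and> (rank p < rank n \<or> rank p = rank n \<and> p \<le> n)}" for n
  define pos where "pos n = card (pre n)" for n
  have rank_ex: "\<exists>A\<in>\<C>. n \<in> A \<and> card A = rank n" if "n \<ge> 1" for n
    unfolding rank_def by (rule LeastI_ex) (use cover[OF that] in blast)
  \<comment> \<open>Of two members of a chain the smaller is contained in the larger, so membership
    reduces to comparing sizes.\<close>
  have mem_iff: "n \<in> A \<longleftrightarrow> rank n \<le> card A" if A: "A \<in> \<C>" and n: "n \<ge> 1" for A n
  proof
    assume "n \<in> A"
    then show "rank n \<le> card A"
      unfolding rank_def using A by (intro Least_le) blast
  next
    assume le: "rank n \<le> card A"
    obtain B where B: "B \<in> \<C>" "n \<in> B" "card B = rank n"
      using rank_ex[OF n] by blast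
    show "n \<in> A"
    proof (rule ccontr)
      assume "n \<notin> A"
      then have "A \<subset> B"
        using chain[OF A B(1)] B(2) by blast
      then have "card A < card B"
        using fin[OF B(1)] psubset_card_mono by blast
      with le B(3) show False by simp
    qed
  qed
  have pre_sub: "pre n \<subseteq> A" if "A \<in> \<C>" "n \<in> A" for A n
  proof
    fix p assume p: "p \<in> pre n"
    have "n \<ge> 1" using fin[OF that(1)] that(2) by auto
    then have "rank n \<le> card A"
      using that mem_iff by blast
    with p show "p \<in> A"
      using mem_iff[OF that(1), of p] unfolding pre_def by auto
  qed
  have fin_pre: "finite (pre n)" if n1: "n \<ge> 1" for n
  proof -
    obtain A where A: "A \<in> \<C>" "n \<in> A"
      using cover[OF n1] by blast
    show ?thesis
      by (rule finite_subset[OF pre_sub[OF A]]) (use fin[OF A(1)] in simp)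
  qed
  have self: "n \<in> pre n" if "n \<ge> 1" for n
    using that by (simp add: pre_def)
  have strict: "pos p < pos n" if "p \<ge> 1" "n \<ge> 1" "p \<noteq> n" "p \<in> pre n" for p n
  proof -
    have "n \<notin> pre p" "pre p \<subseteq> pre n"
      using that unfolding pre_def by auto
    then have "pre p \<subset> pre n"
      using self[OF that(2)] by blast
    then show ?thesis
      unfolding pos_def by (rule psubset_card_mono[OF fin_pre[OF that(2)]])
  qed
  have inj: "inj_on pos {1..}"
  proof (rule inj_onI, rule ccontr)
    fix p n assume h: "p \<in> {1..}" "n \<in> {1..}" "pos p = pos n" "p \<noteq> n"
    have "p \<in> pre n \<or> n \<in> pre p"
      using h unfolding pre_def by auto
    with h strict[of p n] strict[of n p] show False
      by auto
  qed
  have pos1: "pos n \<ge> 1" if "n \<ge> 1" for n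
    using self[OF that] fin_pre[OF that] unfolding pos_def by (auto simp: Suc_le_eq card_gt_0_iff)
  have img: "pos ` A = {1..card A}" if A: "A \<in> \<C>" for A
  proof (rule card_subset_eq)
    show "pos ` A \<subseteq> {1..card A}"
    proof
      fix k assume "k \<in> pos ` A"
      then obtain n where n: "n \<in> A" "k = pos n" by blast
      then have "n \<ge> 1" using fin[OF A] by auto
      then show "k \<in> {1..card A}"
        using n pos1 pre_sub[OF A n(1)] fin[OF A] unfolding pos_def by (auto intro: card_mono)
    qed
    show "card (pos ` A) = card {1..card A}"
      using inj fin[OF A] by (simp add: card_image inj_on_subset)
  qed simp
  \<comment> \<open>A chain is directed: every initial segment of the positive integers lies in a
    single member, which makes \<open>pos\<close> onto.\<close>
  have big: "\<exists>A\<in>\<C>. {1..K} \<subseteq> A" for K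
  proof (induction K)
    case 0
    then show ?case using cover[of 1] by auto
  next
    case (Suc K)
    then obtain A where A: "A \<in> \<C>" "{1..K} \<subseteq> A"
      by blast
    obtain B where B: "B \<in> \<C>" "Suc K \<in> B"
      using cover[of "Suc K"] by auto
    have *: "{1..Suc K} = insert (Suc K) {1..K}"
      by auto
    from chain[OF A(1) B(1)] show ?case
    proof
      assume "A \<subseteq> B"
      then show ?thesis
        unfolding * using A B by (intro bexI[of _ B]) auto
    next
      assume "B \<subseteq> A"
      then show ?thesis
        unfolding * using A B by (intro bexI[of _ A]) auto
    qed
  qed
  have "bij_betw pos {1..} {1..}"
    unfolding bij_betw_def
  proof (intro conjI inj equalityI subsetI)
    fix k assume "k \<in> pos ` {1..}"
    then show "k \<in> {1..}" using pos1 by auto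
  next
    fix k :: nat assume k: "k \<in> {1..}"
    obtain A where A: "A \<in> \<C>" "{1..k} \<subseteq> A"
      using big by blast
    then have "k \<le> card A"
      using card_mono[of A "{1..k}"] fin by auto
    then have "k \<in> pos ` A"
      using img[OF A(1)] k by simp
    moreover have "pos ` A \<subseteq> pos ` {1..}"
      by (rule image_mono) (use fin[OF A(1)] in simp)
    ultimately show "k \<in> pos ` {1..}"
      by (rule rev_subsetD)
  qed
  \<comment> \<open>\<open>pos\<close> sends an element to its place in the list, whereas the
    rearrangement goes from places to elements.\<close>
  then have "bij_betw (inv_into {1..} pos) {1..} {1..}"
    by (rule bij_betw_inv_into)
  moreover have "inv_into {1..} pos ` {1..card A} = A" if A: "A \<in> \<C>" for A
    unfolding img[OF A, symmetric] by (rule inv_into_image_cancel[OF inj]) (use fin[OF A] in simp)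
  ultimately show ?thesis
    by blast
qed

text \<open>Blocks are chosen with total mass V >= 2^j, and c = u / V. The sum of c^2 / u over a
  block is then 1 / V <= 2^(-j); by Cauchy-Schwarz no other coefficients with sum 1 do
  better.\<close>

lemma block_weights:
  fixes u :: "nat \<Rightarrow> real"
  assumes pos: "\<And>k. u k > 0" and unb: "\<And>B. \<exists>N. B \<le> (\<Sum>k<N. u k)"
  obtains L :: "nat \<Rightarrow> nat" and c where "strict_mono L" "\<And>k. 0 \<le> c k" "\<And>k. c k \<le> 1"
    "\<And>j. (\<Sum>k\<in>{L j..<L (Suc j)}. c k) = 1" "\<And>N. (\<Sum>k<N. (c k)\<^sup>2 / u k) \<le> 2"
proof -
  have ex: "\<exists>b>a. (\<Sum>k\<in>{a..<b}. u k) \<ge> 2 ^ j" for a j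
  proof -
    obtain N where N: "(\<Sum>k<a. u k) + 2 ^ j \<le> (\<Sum>k<N. u k)"
      using unb by blast
    have "a < N"
    proof (rule ccontr)
      assume "\<not> a < N"
      then have "(\<Sum>k<N. u k) \<le> (\<Sum>k<a. u k)"
        using pos by (intro sum_mono2) (auto intro: less_imp_le)
      moreover have "(2::real) ^ j > 0" by simp
      ultimately show False using N by linarith
    qed
    moreover have "(\<Sum>k<a. u k) + (\<Sum>k\<in>{a..<N}. u k) = (\<Sum>k<N. u k)"
      using sum.atLeastLessThan_concat[of 0 a N u] \<open>a < N\<close> by (simp add: lessThan_atLeast0)
    ultimately show ?thesis
      using N by (intro exI[of _ N]) auto
  qed
  then obtain nxt where nxt: "\<And>a j. nxt a j > a" "\<And>a j. (\<Sum>k\<in>{a..<nxt a j}. u k) \<ge> 2 ^ j"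
    by metis
  define L where "L = rec_nat 0 (\<lambda>j a. nxt a j)"
  have L0: "L 0 = 0" and LS: "L (Suc j) = nxt (L j) j" for j
    by (simp_all add: L_def)
  have mono: "strict_mono L"
    unfolding strict_mono_Suc_iff LS using nxt by simp
  define V where "V j = (\<Sum>k\<in>{L j..<L (Suc j)}. u k)" for j
  have V: "V j \<ge> 2 ^ j" for j
    unfolding V_def LS by (rule nxt)
  have V0: "V j > 0" for j
    using V[of j] by (rule less_le_trans[rotated]) simp
  define J where "J k = (LEAST j. k < L (Suc j))" for k
  have J: "J k = j" if "k \<in> {L j..<L (Suc j)}" for j k
    unfolding J_def
  proof (rule Least_equality)
    fix i assume "k < L (Suc i)"
    with that have "L j < L (Suc i)" by auto
    then show "j \<le> i" using mono by (simp add: strict_mono_less)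
  qed (use that in auto)
  have Jex: "\<exists>j. k \<in> {L j..<L (Suc j)}" for k
  proof -
    have ex: "\<exists>j. k < L (Suc j)"
      using strict_mono_imp_increasing[OF mono, of "Suc k"] by (intro exI[of _ k]) simp
    have up: "k < L (Suc (J k))"
      unfolding J_def by (rule LeastI_ex[OF ex])
    have "L (J k) \<le> k"
    proof (cases "J k")
      case (Suc i)
      then have "\<not> k < L (Suc i)"
        using not_less_Least[of i "\<lambda>j. k < L (Suc j)"] unfolding J_def by auto
      then show ?thesis using Suc by simp
    qed (simp add: L0)
    with up show ?thesis by auto
  qed
  define c where "c k = u k / V (J k)" for k
  have c0: "0 \<le> c k" for k
    unfolding c_def using pos[of k] V0[of "J k"] by simp
  have c1: "(\<Sum>k\<in>{L j..<L (Suc j)}. c k) = 1" for j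
  proof -
    have "(\<Sum>k\<in>{L j..<L (Suc j)}. c k) = (\<Sum>k\<in>{L j..<L (Suc j)}. u k / V j)"
      by (intro sum.cong) (auto simp: c_def J)
    also have "\<dots> = V j / V j"
      unfolding V_def by (rule sum_divide_distrib[symmetric])
    finally show ?thesis using V0[of j] by simp
  qed
  have cle: "c k \<le> 1" for k
  proof -
    obtain j where "k \<in> {L j..<L (Suc j)}" using Jex by blast
    then have "c k \<le> (\<Sum>k\<in>{L j..<L (Suc j)}. c k)"
      using c0 by (intro member_le_sum) auto
    then show ?thesis by (simp only: c1)
  qed
  have c2: "(\<Sum>k\<in>{L j..<L (Suc j)}. (c k)\<^sup>2 / u k) \<le> (1 / 2) ^ j" for j
  proof -
    have "(\<Sum>k\<in>{L j..<L (Suc j)}. (c k)\<^sup>2 / u k) = (\<Sum>k\<in>{L j..<L (Suc j)}. c k * (1 / V j))"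
    proof (intro sum.cong)
      fix k assume "k \<in> {L j..<L (Suc j)}"
      then show "(c k)\<^sup>2 / u k = c k * (1 / V j)"
        using pos[of k] V0[of j] by (simp add: c_def J power2_eq_square)
    qed simp
    also have "\<dots> = 1 / V j"
      unfolding sum_distrib_right[symmetric] c1 by simp
    also have "\<dots> \<le> (1 / 2) ^ j"
      using V[of j] V0[of j] by (simp add: power_divide field_simps)
    finally show ?thesis .
  qed
  \<comment> \<open>The subtracted term is the remainder of the geometric series and makes the bound
    inductive.\<close>
  have tot: "(\<Sum>k<L N. (c k)\<^sup>2 / u k) \<le> 2 - 2 * (1 / 2) ^ N" for N
  proof (induction N)
    case (Suc N)
    have "(\<Sum>k<L (Suc N). (c k)\<^sup>2 / u k) = (\<Sum>k<L N. (c k)\<^sup>2 / u k) + (\<Sum>k\<in>{L N..<L (Suc N)}. (c k)\<^sup>2 / u k)"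
      using sum.atLeastLessThan_concat[of 0 "L N" "L (Suc N)" "\<lambda>k. (c k)\<^sup>2 / u k"] mono
      by (simp add: lessThan_atLeast0 strict_mono_less_eq)
    with Suc c2[of N] show ?case by simp
  qed (simp add: L0)
  have "(\<Sum>k<N. (c k)\<^sup>2 / u k) \<le> 2" for N
  proof -
    have "(\<Sum>k<N. (c k)\<^sup>2 / u k) \<le> (\<Sum>k<L N. (c k)\<^sup>2 / u k)"
      using strict_mono_imp_increasing[OF mono, of N] pos[THEN less_imp_le]
          by (intro sum_mono2) (auto intro!: divide_nonneg_nonneg)
    also have "\<dots> \<le> 2 - 2 * (1 / 2) ^ N" by (rule tot)
    also have "\<dots> \<le> 2" by simp
    finally show ?thesis .
  qed
  with mono c0 cle c1 show thesis
    by (rule that)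
qed

section \<open>Condensation along powers of 2\<close>

lemma sum_dyadic_le:
  fixes g v :: "nat \<Rightarrow> real"
  assumes "\<And>i n. n \<in> {2 ^ i..<2 ^ Suc i} \<Longrightarrow> g n \<le> v i / 2 ^ i"
  shows "(\<Sum>n\<in>{1..<2 ^ I}. g n) \<le> (\<Sum>i<I. v i)"
proof (induction I)
  case (Suc I)
  have "(\<Sum>n\<in>{2 ^ I..<2 ^ Suc I}. g n) \<le> (\<Sum>n\<in>{(2::nat) ^ I..<2 ^ Suc I}. v I / 2 ^ I)"
    by (intro sum_mono assms)
  also have "\<dots> = v I"
    by simp
  finally have "(\<Sum>n\<in>{2 ^ I..<2 ^ Suc I}. g n) \<le> v I" .
  moreover have "(\<Sum>n\<in>{1..<2 ^ Suc I}. g n) = (\<Sum>n\<in>{1..<2 ^ I}. g n) + (\<Sum>n\<in>{2 ^ I..<2 ^ Suc I}. g n)"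
    by (rule sum.atLeastLessThan_concat[symmetric]) auto
  ultimately show ?case
    using Suc by simp
qed simp

text \<open>Each group of G consecutive terms is bounded by its first one. The initial group is kept
  apart because the sampling starts at index G, not at 0.\<close>

lemma sum_antimono_sparse_le:
  fixes v :: "nat \<Rightarrow> real"
  assumes "antimono v"
  shows "(\<Sum>i<G * Suc K. v i) \<le> real G * v 0 + real G * (\<Sum>k<K. v (G * Suc k))"
proof (induction K)
  case 0
  have "(\<Sum>i<G * Suc 0. v i) \<le> (\<Sum>i<G * Suc 0. v 0)"
    using assms by (intro sum_mono) (auto simp: antimono_def)
  then show ?case by simp
next
  case (Suc K)
  have "(\<Sum>i<G * Suc (Suc K). v i) = (\<Sum>i<G * Suc K. v i) + (\<Sum>i\<in>{G * Suc K..<G * Suc (Suc K)}. v i)"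
    using sum.atLeastLessThan_concat[of 0 "G * Suc K" "G * Suc (Suc K)" v] by (simp add: lessThan_atLeast0)
  moreover have "(\<Sum>i\<in>{G * Suc K..<G * Suc (Suc K)}. v i) \<le> (\<Sum>i\<in>{G * Suc K..<G * Suc (Suc K)}. v (G * Suc K))"
    using assms by (intro sum_mono) (auto simp: antimono_def)
  ultimately show ?case
    using Suc by (simp add: algebra_simps)
qed

text \<open>Cauchy condensation: the n from 2^i to 2^(i+1) - 1 contribute at most 1 / w(2^i), and by
  monotonicity every G-th exponent already has an unbounded sum.\<close>

lemma sparse_reciprocal_unbounded:
  fixes w :: "nat \<Rightarrow> real"
  assumes pos: "\<And>n. n \<ge> 1 \<Longrightarrow> w n > 0" and mono: "mono_on {1..} w" and G: "G \<ge> 1"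
    and div: "filterlim (\<lambda>N. \<Sum>n=1..N. 1 / (real n * w n)) at_top sequentially"
  shows "\<exists>N. B \<le> (\<Sum>k<N. 1 / w (2 ^ (G * Suc k)))"
proof -
  define v where "v i = 1 / w (2 ^ i)" for i
  have anti: "antimono v"
  proof (rule antimonoI)
    fix i j :: nat assume "i \<le> j"
    then have "w (2 ^ i) \<le> w (2 ^ j)"
      by (intro mono_onD[OF mono]) (auto intro: power_increasing)
    then show "v j \<le> v i"
      unfolding v_def using pos[of "2 ^ i"] pos[of "2 ^ j"] by (intro divide_left_mono) auto
  qed
  obtain N where N: "real G * v 0 + real G * B \<le> (\<Sum>n=1..N. 1 / (real n * w n))"
    using div unfolding filterlim_at_top eventually_sequentially by blast
  have "(\<Sum>n=1..N. 1 / (real n * w n)) \<le> (\<Sum>n\<in>{1..<2 ^ (G * Suc N)}. 1 / (real n * w n))"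
  proof (rule sum_mono2)
    have "N \<le> G * Suc N"
      using G by (cases G) auto
    then have "(2::nat) ^ N \<le> 2 ^ (G * Suc N)"
      by (intro power_increasing) auto
    with less_exp[of N] have "N < 2 ^ (G * Suc N)"
      by (rule less_le_trans)
    then show "{1..N} \<subseteq> {1..<2 ^ (G * Suc N)}" by auto
    show "0 \<le> 1 / (real n * w n)" if "n \<in> {1..<2 ^ (G * Suc N)} - {1..N}" for n
      using pos[of n] that by auto
  qed simp
  also have "\<dots> \<le> (\<Sum>i<G * Suc N. v i)"
  proof (rule sum_dyadic_le)
    fix i n :: nat assume n: "n \<in> {2 ^ i..<2 ^ Suc i}"
    have "(1::nat) \<le> 2 ^ i" by simp
    with n have 1: "w (2 ^ i) \<le> w n"
      by (intro mono_onD[OF mono]) (auto simp del: one_le_power)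
    have 2: "2 ^ i \<le> real n"
      using n of_nat_mono[of "2 ^ i" n, where 'a = real] by simp
    have 3: "w (2 ^ i) > 0"
      using pos by simp
    have "2 ^ i * w (2 ^ i) \<le> real n * w n"
      using 1 2 3 by (intro mult_mono) auto
    then have "1 / (real n * w n) \<le> 1 / (2 ^ i * w (2 ^ i))"
      using 3 by (intro frac_le) auto
    then show "1 / (real n * w n) \<le> v i / 2 ^ i"
      by (simp add: v_def mult.commute)
  qed
  also have "\<dots> \<le> real G * v 0 + real G * (\<Sum>k<N. v (G * Suc k))"
    by (rule sum_antimono_sparse_le[OF anti])
  finally have "real G * B \<le> real G * (\<Sum>k<N. v (G * Suc k))"
    using N by linarith
  then have "B \<le> (\<Sum>k<N. v (G * Suc k))"
    using G by (subst (asm) mult_le_cancel_left_pos) auto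
  then show ?thesis
    unfolding v_def ..
qed

section \<open>Divergence\<close>

text \<open>\<open>p div 2 ^ (b - k)\<close> is the ancestor of p on level k.\<close>

lemma div_power2_level:
  fixes p :: nat
  assumes "p \<in> {2 ^ b..<2 ^ Suc b}" "k \<le> b"
  shows "p div 2 ^ (b - k) \<in> {2 ^ k..<2 ^ Suc k}"
proof -
  have e: "(2::nat) ^ b = 2 ^ k * 2 ^ (b - k)"
    using assms(2) by (simp flip: power_add)
  have "2 ^ k \<le> p div 2 ^ (b - k)"
    using assms(1) e by (simp add: less_eq_div_iff_mult_less_eq)
  moreover have "p div 2 ^ (b - k) < 2 ^ Suc k"
    using assms(1) e by (simp add: div_less_iff_less_mult)
  ultimately show ?thesis by simp
qed

lemma level_ge1: "q \<in> {2 ^ k..<2 ^ Suc k} \<Longrightarrow> q \<ge> 1" for q :: nat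
  by (rule order.trans[of 1 "2 ^ k"]) auto

section \<open>The path of a point: \<open>F\<close> lists the cell indicators at one fixed
  point\<close>

context
  fixes F :: "nat \<Rightarrow> real"
  assumes root: "F 1 = 1" and F01: "\<And>q. q \<ge> 1 \<Longrightarrow> F q \<in> {0, 1}"
    and children: "\<And>q. q \<ge> 1 \<Longrightarrow> F (2 * q) + F (Suc (2 * q)) = F q"
begin

lemma path_exists: "\<exists>p\<in>{2 ^ b..<2 ^ Suc b}. F p = 1"
proof (rule ccontr)
  assume "\<not> ?thesis"
  then have "F p = 0" if "p \<in> {2 ^ b..<2 ^ Suc b}" for p
    using F01[OF level_ge1[OF that]] that by auto
  then have "sum F {2 ^ b..<2 ^ Suc b} = 0"
    by (rule sum.neutral[OF ballI])
  then show False
    using sum_tree_level[of F b] root children by simp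
qed

lemma path_unique:
  assumes "p \<in> {2 ^ k..<2 ^ Suc k}" "q \<in> {2 ^ k..<2 ^ Suc k}" "F p = 1" "F q = 1"
  shows "p = q"
proof (rule ccontr)
  assume "p \<noteq> q"
  then have "2 = sum F {p, q}"
    using assms by simp
  also have "\<dots> \<le> sum F {2 ^ k..<2 ^ Suc k}"
  proof (rule sum_mono2)
    fix r assume "r \<in> {2 ^ k..<2 ^ Suc k} - {p, q}"
    then show "0 \<le> F r"
      using F01[OF level_ge1[of r k]] by auto
  qed (use assms in auto)
  also have "\<dots> = 1"
    by (rule sum_tree_level[OF root children])
  finally show False by simp
qed

text \<open>A child of value 1 forces value 1 on its parent, whose value in {0, 1} is the sum of two
  nonnegative ones.\<close>

lemma path_ancestor:
  assumes "F p = 1" "p div 2 ^ d \<ge> 1"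
  shows "F (p div 2 ^ d) = 1"
  using assms(2)
proof (induction d)
  case (Suc d)
  define q where "q = p div 2 ^ Suc d"
  have eq: "p div 2 ^ d div 2 = q"
    unfolding q_def power_Suc2 div_mult2_eq ..
  have q: "q \<ge> 1"
    using Suc.prems unfolding q_def .
  then have "p div 2 ^ d \<ge> 1"
    using eq by (cases "p div 2 ^ d") auto
  then have 1: "F (p div 2 ^ d) = 1"
    by (rule Suc.IH)
  have "p div 2 ^ d = 2 * q \<or> p div 2 ^ d = Suc (2 * q)"
    unfolding eq[symmetric] by (simp add: mult.commute[of 2], arith)
  then have "F (2 * q) = 1 \<or> F (Suc (2 * q)) = 1"
    using 1 by metis
  moreover have "F (2 * q) \<in> {0, 1}" "F (Suc (2 * q)) \<in> {0, 1}" "F q \<in> {0, 1}"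
    using q F01[of "2 * q"] F01[of "Suc (2 * q)"] F01[of q] by auto
  ultimately have "F q = 1"
    using children[OF q] by auto
  then show ?case
    unfolding q_def .
qed (use assms in simp)

lemma path_eq_div:
  assumes "p \<in> {2 ^ b..<2 ^ Suc b}" "F p = 1" "q \<in> {2 ^ k..<2 ^ Suc k}" "F q = 1" "k \<le> b"
  shows "q = p div 2 ^ (b - k)"
proof (rule path_unique[OF assms(3) div_power2_level[OF assms(1,5)] assms(4)])
  show "F (p div 2 ^ (b - k)) = 1"
    by (rule path_ancestor[OF assms(2) level_ge1[OF div_power2_level[OF assms(1,5)]]])
qed

text \<open>\<open>(2 * q + 1) * 2 ^ (b - Suc (tree_level q))\<close> is the position of \<open>q\<close> in the symmetric (in-order)
  traversal of the binary tree with leaves on level \<open>b\<close>.\<close>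

lemma inorder_left:
  assumes p: "p \<in> {2 ^ b..<2 ^ Suc b}" "F p = 1" and q: "q \<ge> 1" "tree_level q < b"
    and le: "(2 * q + 1) * 2 ^ (b - Suc (tree_level q)) \<le> p"
  shows "F (2 * q) = 0"
proof (rule ccontr)
  assume "F (2 * q) \<noteq> 0"
  then have "F (2 * q) = 1"
    using F01[of "2 * q"] q by auto
  moreover have "2 * q \<in> {2 ^ Suc (tree_level q)..<2 ^ Suc (Suc (tree_level q))}"
    using tree_level_bounds[OF q(1)] by auto
  \<comment> \<open>A path through the left child would make \<open>2 * q\<close> the ancestor of p
    on that level, whereas p lies at or beyond the first leaf below
    \<open>2 * q + 1\<close>.\<close>
  ultimately have "2 * q = p div 2 ^ (b - Suc (tree_level q))"
    using path_eq_div[OF p, of "2 * q" "Suc (tree_level q)"] q by simp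
  moreover have "2 * q + 1 \<le> p div 2 ^ (b - Suc (tree_level q))"
    using le by (simp add: less_eq_div_iff_mult_less_eq)
  ultimately show False by simp
qed

text \<open>Mirror image: a path through the right child ends in a leaf at or after the position of
  q.\<close>

lemma inorder_right:
  assumes p: "p \<in> {2 ^ b..<2 ^ Suc b}" "F p = 1" and q: "q \<ge> 1" "tree_level q < b"
    and le: "\<not> (2 * q + 1) * 2 ^ (b - Suc (tree_level q)) \<le> p"
  shows "F (Suc (2 * q)) = 0"
proof (rule ccontr)
  assume "F (Suc (2 * q)) \<noteq> 0"
  then have "F (Suc (2 * q)) = 1"
    using F01[of "Suc (2 * q)"] q by auto
  moreover have "Suc (2 * q) \<in> {2 ^ Suc (tree_level q)..<2 ^ Suc (Suc (tree_level q))}"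
    using tree_level_bounds[OF q(1)] by auto
  ultimately have "Suc (2 * q) = p div 2 ^ (b - Suc (tree_level q))"
    using path_eq_div[OF p, of "Suc (2 * q)" "Suc (tree_level q)"] q by simp
  moreover have "\<not> 2 * q + 1 \<le> p div 2 ^ (b - Suc (tree_level q))"
    using le by (simp add: less_eq_div_iff_mult_less_eq)
  ultimately show False by simp
qed

end

section \<open>Assembly of the divergent rearrangement\<close>

lemma AE_lebesgue_on_of_AE_unit:
  assumes "AE x in unit_measure. Q x"
  shows "AE x in lebesgue_on {0<..<1}. Q x"
proof -
  have 1: "{0..<1} \<inter> space lborel \<in> sets (lborel :: real measure)"
    "{0<..<1} \<inter> space lebesgue \<in> sets (lebesgue :: real measure)"
    by simp_all
  have "AE x in lborel. x \<in> {0..<1} \<longrightarrow> Q x"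
    using assms unfolding unit_measure_def AE_restrict_space_iff[OF 1(1)] .
  then have "AE x in lebesgue. x \<in> {0..<1} \<longrightarrow> Q x"
    by (rule AE_completion)
  then have "AE x in lebesgue. x \<in> {0<..<1} \<longrightarrow> Q x"
    by (rule eventually_mono) simp
  then show ?thesis
    unfolding AE_restrict_space_iff[OF 1(2)] .
qed

text \<open>In-order listing makes the two parts of a block, cut at the leaf of x, differences of
  partial sums. Convergence at x would put the left part and the negative of the right part below
  1/4 for late blocks; with approximation errors below 1/4 their sum could not account for the exact
  value 1.\<close>

lemma ae_divergent_rearrangement_exists:
  fixes w :: "nat \<Rightarrow> real"
  assumes pos: "\<And>n. n \<ge> 1 \<Longrightarrow> w n > 0"
    and mono: "mono_on {1..} w"
    and div: "filterlim (\<lambda>N. \<Sum>n=1..N. 1 / (real n * w n)) at_top sequentially"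
  shows "\<exists>a :: nat \<Rightarrow> complex. (\<lambda>n. (cmod (a n))\<^sup>2 * w n) summable_on {1..} \<and>
       (\<exists>\<sigma>. bij_betw \<sigma> {1..} {1..} \<and>
          (AE x in lebesgue_on {0<..<1}. \<not> convergent (rearranged_partial_sum trig_system a \<sigma> x)))"
proof -
  define u where "u k = 1 / w (2 ^ (121 * Suc k))" for k
  have u: "u k > 0" for k
    unfolding u_def using pos by simp
  have unb: "\<exists>N. B \<le> (\<Sum>k<N. u k)" for B
    unfolding u_def by (rule sparse_reciprocal_unbounded[OF pos mono _ div]) auto
  obtain L :: "nat \<Rightarrow> nat" and c where
    L: "strict_mono L" and c01: "\<And>k. 0 \<le> c k" "\<And>k. c k \<le> 1"
    and csum: "\<And>j. (\<Sum>k\<in>{L j..<L (Suc j)}. c k) = 1" and csq: "\<And>N. (\<Sum>k<N. (c k)\<^sup>2 / u k) \<le> 2"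
    by (rule block_weights[OF u unb], rule that, assumption+)
  obtain U :: "nat \<Rightarrow> nat set" and A :: "nat \<Rightarrow> nat \<Rightarrow> complex" and F :: "nat \<Rightarrow> real \<Rightarrow> real" where
    Ufin: "\<And>q. q \<ge> 1 \<Longrightarrow> finite (U q)" and Usub: "\<And>q. q \<ge> 1 \<Longrightarrow> U q \<subseteq> {1..2 ^ (121 * (tree_level q + 1))}"
    and Udis: "\<And>p q. p \<ge> 1 \<Longrightarrow> q \<ge> 1 \<Longrightarrow> p \<noteq> q \<Longrightarrow> U p \<inter> U q = {}"
    and F1: "\<And>x. F 1 x = 1" and F01: "\<And>q x. q \<ge> 1 \<Longrightarrow> F q x \<in> {0, 1}"
    and Fch: "\<And>q x. q \<ge> 1 \<Longrightarrow> F (2 * q) x + F (Suc (2 * q)) x = F q x"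
    and Aen: "\<And>k. (\<Sum>q\<in>{2 ^ k..<2 ^ Suc k}. \<Sum>n\<in>U q. (cmod (A q n))\<^sup>2) \<le> 8"
    and ae: "AE x in unit_measure. summable (\<lambda>i. \<bar>(\<Sum>n\<in>U (Suc i). Re (A (Suc i) n * trig_system n x))
        - (F (Suc (2 * Suc i)) x - F (2 * Suc i) x)\<bar>)"
    by (rule node_system_exists, rule that, assumption+)
  \<comment> \<open>Indices outside all frequency sets get coefficient 0; for any other index
    disjointness lets \<open>nd\<close> recover its node.\<close>
  define used where "used n \<longleftrightarrow> (\<exists>q\<ge>1. n \<in> U q)" for n
  define nd where "nd n = (SOME q. q \<ge> 1 \<and> n \<in> U q)" for n
  define a where "a n = (if used n then of_real (c (tree_level (nd n))) * A (nd n) n else 0)" for n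
  have nd: "nd n = q" if "q \<ge> 1" "n \<in> U q" for q n
  proof -
    have "nd n \<ge> 1 \<and> n \<in> U (nd n)"
      unfolding nd_def by (rule someI[of _ q]) (use that in simp)
    then show ?thesis
      using Udis[of "nd n" q] that by blast
  qed
  have a_eq: "a n = of_real (c (tree_level q)) * A q n" if "q \<ge> 1" "n \<in> U q" for q n
    using nd[OF that] that unfolding a_def used_def by auto
  have sum_U: "(\<Sum>n\<in>(\<Union>q\<in>Q. U q). f n) = (\<Sum>q\<in>Q. \<Sum>n\<in>U q. f n)"
    if "finite Q" "Q \<subseteq> {1..}" for Q and f :: "nat \<Rightarrow> real"
    using that by (intro sum.UNION_disjoint ballI impI Ufin Udis) auto

  have "(\<lambda>n. (cmod (a n))\<^sup>2 * w n) summable_on {1..}"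
  proof (rule nonneg_bdd_above_summable_on)
    show "0 \<le> (cmod (a n))\<^sup>2 * w n" if "n \<in> {1..}" for n
      using pos[of n] that by auto
    \<comment> \<open>16 = 2 * 8: at most 2 for the weighted squares of \<open>c\<close>, and 8 for
      the energy of a level.\<close>
    have "(\<Sum>n\<in>X. (cmod (a n))\<^sup>2 * w n) \<le> 16" if X: "X \<subseteq> {1..}" "finite X" for X
    proof -
      obtain K where K: "nd ` X \<subseteq> {..<K}"
        using finite_nat_bounded[of "nd ` X"] X(2) by blast
      have inU: "n \<in> (\<Union>q\<in>{1..<2 ^ K}. U q)" if n: "n \<in> X" "used n" for n
      proof -
        obtain q where q: "q \<ge> 1" "n \<in> U q"
          using n(2) unfolding used_def by blast
        have "q < K"
          using K n(1) nd[OF q] by auto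
        then have "q < 2 ^ K"
          using less_exp[of K] by (rule less_trans)
        then show ?thesis
          using q by auto
      qed
      have fU: "finite (\<Union>q\<in>{1..<2 ^ K}. U q)"
        by (auto intro: Ufin)
      have "(\<Sum>n\<in>X. (cmod (a n))\<^sup>2 * w n) = (\<Sum>n\<in>{n\<in>X. used n}. (cmod (a n))\<^sup>2 * w n)"
        using X(2) by (intro sum.mono_neutral_right) (auto simp: a_def)
      also have "\<dots> \<le> (\<Sum>n\<in>(\<Union>q\<in>{1..<2 ^ K}. U q). (cmod (a n))\<^sup>2 * w n)"
      proof (rule sum_mono2[OF fU])
        show "{n \<in> X. used n} \<subseteq> (\<Union>q\<in>{1..<2 ^ K}. U q)"
          using inU by blast
        fix n assume "n \<in> (\<Union>q\<in>{1..<2 ^ K}. U q) - {n \<in> X. used n}"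
        then obtain q where "q \<ge> 1" "n \<in> U q" by auto
        then have "n \<ge> 1" using Usub[of q] by auto
        then show "0 \<le> (cmod (a n))\<^sup>2 * w n"
          using pos[of n] by simp
      qed
      also have "\<dots> = (\<Sum>q\<in>{1..<2 ^ K}. \<Sum>n\<in>U q. (cmod (a n))\<^sup>2 * w n)"
        by (rule sum_U) auto
      also have "\<dots> \<le> (\<Sum>q\<in>{1..<2 ^ K}. (c (tree_level q))\<^sup>2 / u (tree_level q) * (\<Sum>n\<in>U q. (cmod (A q n))\<^sup>2))"
      proof (rule sum_mono)
        fix q :: nat assume "q \<in> {1..<2 ^ K}"
        then have q: "q \<ge> 1" by simp
        have "(\<Sum>n\<in>U q. (cmod (a n))\<^sup>2 * w n) \<le> (\<Sum>n\<in>U q. (c (tree_level q))\<^sup>2 / u (tree_level q) * (cmod (A q n))\<^sup>2)"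
        proof (rule sum_mono)
          fix n assume n: "n \<in> U q"
          have n1: "1 \<le> n" "n \<le> 2 ^ (121 * Suc (tree_level q))"
            using Usub[OF q] n by auto
          then have "w n \<le> w (2 ^ (121 * Suc (tree_level q)))"
            by (intro mono_onD[OF mono]) auto
          also have "\<dots> = 1 / u (tree_level q)"
            by (simp add: u_def)
          finally have "(c (tree_level q) * cmod (A q n))\<^sup>2 * w n
              \<le> (c (tree_level q) * cmod (A q n))\<^sup>2 * (1 / u (tree_level q))"
            by (rule mult_left_mono) simp
          then show "(cmod (a n))\<^sup>2 * w n \<le> (c (tree_level q))\<^sup>2 / u (tree_level q) * (cmod (A q n))\<^sup>2"
            using c01(1)[of "tree_level q"] by (simp add: a_eq[OF q n] norm_mult power_mult_distrib mult_ac)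
        qed
        then show "(\<Sum>n\<in>U q. (cmod (a n))\<^sup>2 * w n)
            \<le> (c (tree_level q))\<^sup>2 / u (tree_level q) * (\<Sum>n\<in>U q. (cmod (A q n))\<^sup>2)"
          by (simp add: sum_distrib_left)
      qed
      also have "\<dots> = (\<Sum>k<K. \<Sum>q\<in>{2 ^ k..<2 ^ Suc k}. (c (tree_level q))\<^sup>2 / u (tree_level q) * (\<Sum>n\<in>U q. (cmod (A
          q n))\<^sup>2))"
        using sum_levels[of 0 K "\<lambda>q. (c (tree_level q))\<^sup>2 / u (tree_level q) * (\<Sum>n\<in>U q. (cmod (A q n))\<^sup>2)"]
        by (simp add: lessThan_atLeast0)
      also have "\<dots> = (\<Sum>k<K. (c k)\<^sup>2 / u k * (\<Sum>q\<in>{2 ^ k..<2 ^ Suc k}. \<Sum>n\<in>U q. (cmod (A q n))\<^sup>2))"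
        unfolding sum_distrib_left[of "(c _)\<^sup>2 / u _" _ "{2 ^ _..<2 ^ Suc _}"]
      proof (intro sum.cong refl)
        fix k q :: nat assume q: "q \<in> {2 ^ k..<2 ^ Suc k}"
        then have "q \<ge> 1" by (rule level_ge1)
        then have "tree_level q = k" using q tree_level_eq_iff by blast
        then show "(c (tree_level q))\<^sup>2 / u (tree_level q) * (\<Sum>n\<in>U q. (cmod (A q n))\<^sup>2)
            = (c k)\<^sup>2 / u k * (\<Sum>n\<in>U q. (cmod (A q n))\<^sup>2)"
          by simp
      qed
      also have "\<dots> \<le> (\<Sum>k<K. (c k)\<^sup>2 / u k * 8)"
        using u[THEN less_imp_le] by (intro sum_mono mult_left_mono Aen) auto
      also have "\<dots> = (\<Sum>k<K. (c k)\<^sup>2 / u k) * 8"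
        by (rule sum_distrib_right[symmetric])
      also have "\<dots> \<le> 2 * 8"
        by (intro mult_right_mono csq) auto
      finally show ?thesis by simp
    qed
    then show "bdd_above (sum (\<lambda>n. (cmod (a n))\<^sup>2 * w n) ` {X. X \<subseteq> {1..} \<and> finite X})"
      by (intro bdd_aboveI[of _ 16]) auto
  qed

  moreover
  define B where "B j = {2 ^ L j..<(2::nat) ^ L (Suc j)}" for j
  \<comment> \<open>Compares t with the in-order position of q when the leaves are on level
    \<open>L (Suc j)\<close>; increasing t thus lists block j in in-order.\<close>
  define before where "before j t q \<longleftrightarrow> (2 * q + 1) * 2 ^ (L (Suc j) - Suc (tree_level q)) \<le> t" for j t q :: nat
  define X where "X j t = {1..<2 ^ L j} \<union> {q \<in> B j. before j t q}" for j t
  define D where "D j t = {n \<in> {1..j}. \<not> used n} \<union> (\<Union>q\<in>X j t. U q)" for j t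
  have Lmono: "(2::nat) ^ L i \<le> 2 ^ L j" if "i \<le> j" for i j
    using that L by (intro power_increasing) (auto simp: strict_mono_less_eq)
  have Bge: "q \<ge> 1" "L j \<le> tree_level q" "tree_level q < L (Suc j)" if "q \<in> B j" for q j
  proof -
    have "1 \<le> (2::nat) ^ L j"
      by simp
    also have "\<dots> \<le> q"
      using that unfolding B_def by simp
    finally show q: "q \<ge> 1" .
    have "(2::nat) ^ L j < 2 ^ Suc (tree_level q)" "(2::nat) ^ tree_level q < 2 ^ L (Suc j)"
      using that tree_level_bounds[OF q] unfolding B_def atLeastLessThan_iff by linarith+
    then have "L j < Suc (tree_level q)" "tree_level q < L (Suc j)"
      by (simp_all only: power_strict_increasing_iff one_less_numeral_iff semiring_norm)
    then show "L j \<le> tree_level q" "tree_level q < L (Suc j)" by auto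
  qed
  have Xsub: "X j t \<subseteq> {1..<2 ^ L (Suc j)}" for j t
    using Lmono[of j "Suc j"] Bge(1)[of _ j] unfolding X_def B_def by auto
  have finX: "finite (X j t)" "X j t \<subseteq> {1..}" for j t
    using Xsub[of j t] finite_subset by auto
  \<comment> \<open>Positions are positive, so t = 0 stands for the state before block j.\<close>
  have X0: "X j 0 = {1..<2 ^ L j}" for j
    unfolding X_def before_def by auto
  have Xmono: "X i s \<subseteq> X j t" if "i < j" for i j s t
  proof -
    have "{1..<(2::nat) ^ L (Suc i)} \<subseteq> {1..<2 ^ L j}"
      using Lmono[of "Suc i" j] that by auto
    then show ?thesis
      using Xsub[of i s] unfolding X_def[of j t] by blast
  qed
  have Dmono: "D i s \<subseteq> D j t" if "i < j" for i j s t
    using Xmono[OF that, of s t] that unfolding D_def by fastforce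
  have Dmono2: "D j s \<subseteq> D j t" if "s \<le> t" for j s t
  proof -
    have "X j s \<subseteq> X j t"
      using that unfolding X_def before_def by auto
    then show ?thesis
      unfolding D_def by blast
  qed
  have Dfin: "finite (D j t)" "D j t \<subseteq> {1..}" for j t
  proof -
    show "finite (D j t)"
      unfolding D_def using finX[of j t] by (auto intro!: Ufin)
    show "D j t \<subseteq> {1..}"
      unfolding D_def using finX(2)[of j t] Usub by fastforce
  qed
  have Dcover: "\<exists>i. \<forall>j\<ge>i. n \<in> D j 0" if n: "n \<ge> 1" for n
  proof (cases "used n")
    case False
    then show ?thesis
      using n unfolding D_def by auto
  next
    case True
    then obtain q where q: "q \<ge> 1" "n \<in> U q"
      unfolding used_def by blast
    have "q < 2 ^ L j" if "j \<ge> q" for j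
    proof -
      have "q < 2 ^ q" by (rule less_exp)
      also have "(2::nat) ^ q \<le> 2 ^ L j"
        using strict_mono_imp_increasing[OF L, of j] that by (intro power_increasing) auto
      finally show ?thesis .
    qed
    then show ?thesis
      using q unfolding D_def X0 by (intro exI[of _ q]) auto
  qed
  have "\<exists>\<sigma>. bij_betw \<sigma> {1..} {1..} \<and> (\<forall>E\<in>range (\<lambda>(j, t). D j t). \<sigma> ` {1..card E} = E)"
  proof (rule chain_enumeration)
    fix E assume "E \<in> range (\<lambda>(j, t). D j t)"
    then obtain j t where "E = D j t"
      by auto
    then show "finite E \<and> E \<subseteq> {1..}"
      using Dfin[of j t] by simp
  next
    fix E E' assume "E \<in> range (\<lambda>(j, t). D j t)" "E' \<in> range (\<lambda>(j, t). D j t)"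
    then obtain i s j t where "E = D i s" "E' = D j t" by auto
    then show "E \<subseteq> E' \<or> E' \<subseteq> E"
      using Dmono[of i j s t] Dmono[of j i t s] Dmono2[of s t j] Dmono2[of t s j] nat_le_linear[of s t]
      by (cases i j rule: linorder_cases) metis+
  next
    fix n :: nat assume "n \<ge> 1"
    then obtain i where "n \<in> D i 0" using Dcover by blast
    then show "\<exists>E\<in>range (\<lambda>(j, t). D j t). n \<in> E"
      by (intro bexI[of _ "D i 0"]) auto
  qed
  then obtain \<sigma> where \<sigma>: "bij_betw \<sigma> {1..} {1..}" and \<sigma>D: "\<And>j t. \<sigma> ` {1..card (D j t)} = D j t"
    by auto

  have "AE x in unit_measure. \<not> convergent (rearranged_partial_sum trig_system a \<sigma> x)"
    using ae
  proof (rule AE_mp, intro AE_I2 impI notI)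
    fix x
    define H where "H q = (\<Sum>n\<in>U q. Re (A q n * trig_system n x))" for q
    define S where "S q = F (Suc (2 * q)) x - F (2 * q) x" for q
    assume "summable (\<lambda>i. \<bar>(\<Sum>n\<in>U (Suc i). Re (A (Suc i) n * trig_system n x))
        - (F (Suc (2 * Suc i)) x - F (2 * Suc i) x)\<bar>)"
    then have "summable (\<lambda>i. \<bar>H (Suc i) - S (Suc i)\<bar>)"
      unfolding H_def S_def .
    then have "\<forall>e>0. \<exists>N. \<forall>m\<ge>N. \<forall>n. norm (\<Sum>i\<in>{m..<n}. \<bar>H (Suc i) - S (Suc i)\<bar>) < e"
      unfolding summable_Cauchy .
    then obtain N1 where N1: "\<And>m n. m \<ge> N1 \<Longrightarrow> norm (\<Sum>i\<in>{m..<n}. \<bar>H (Suc i) - S (Suc i)\<bar>) < 1 / 4"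
      by (metis zero_less_divide_1_iff zero_less_numeral)
    assume "convergent (rearranged_partial_sum trig_system a \<sigma> x)"
    then obtain l where l: "rearranged_partial_sum trig_system a \<sigma> x \<longlonglongrightarrow> l"
      unfolding convergent_def by blast
    \<comment> \<open>Two late partial sums then have real parts less than 2 * 1/8 = 1/4
      apart.\<close>
    then obtain N2 where N2: "\<And>N. N \<ge> N2 \<Longrightarrow> norm (rearranged_partial_sum trig_system a \<sigma> x N - l) < 1 / 8"
      using LIMSEQ_D[OF l, of "1 / 8"] by auto
    have "\<exists>J. \<forall>j\<ge>J. {1..N} \<subseteq> D j 0" for N
    proof (induction N)
      case (Suc N)
      then obtain J where J: "\<And>j. j \<ge> J \<Longrightarrow> {1..N} \<subseteq> D j 0" by blast
      obtain i where "\<And>j. j \<ge> i \<Longrightarrow> Suc N \<in> D j 0"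
        using Dcover[of "Suc N"] by auto
      with J show ?case
        by (intro exI[of _ "max i J"]) (auto simp: atLeastAtMostSuc_conv)
    qed simp
    then obtain J where J: "\<And>j. j \<ge> J \<Longrightarrow> {1..N2} \<subseteq> D j 0" by blast
    define val where "val E = (\<Sum>n\<in>E. Re (a n * trig_system n x))" for E
    have val_near: "\<bar>val (D j t) - Re l\<bar> < 1 / 8" if "j \<ge> J" for j t
    proof -
      have "{1..N2} \<subseteq> D j t"
        using J[OF that] Dmono2[of 0 t j] by auto
      then have "N2 \<le> card (D j t)"
        using card_mono[OF Dfin(1), of "{1..N2}" j t] by simp
      then have 1: "norm (rearranged_partial_sum trig_system a \<sigma> x (card (D j t)) - l) < 1 / 8"
        by (rule N2)
      have inj: "inj_on \<sigma> {1..card (D j t)}"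
        using \<sigma> by (auto simp: bij_betw_def intro: inj_on_subset)
      have "rearranged_partial_sum trig_system a \<sigma> x (card (D j t))
          = (\<Sum>n\<in>\<sigma> ` {1..card (D j t)}. a n * trig_system n x)"
        unfolding rearranged_partial_sum_def sum.reindex[OF inj] by (simp add: o_def)
      then have "val (D j t) = Re (rearranged_partial_sum trig_system a \<sigma> x (card (D j t)))"
        unfolding val_def \<sigma>D by simp
      then show ?thesis
        using abs_Re_le_cmod[of "rearranged_partial_sum trig_system a \<sigma> x (card (D j t)) - l"] 1 by simp
    qed
    have val_D: "val (D j t) = (\<Sum>q\<in>X j t. c (tree_level q) * H q)" for j t
    proof -
      have "val (D j t) = (\<Sum>n\<in>(\<Union>q\<in>X j t. U q). Re (a n * trig_system n x))"
        unfolding val_def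
      proof (rule sum.mono_neutral_right[OF Dfin(1)])
        show "(\<Union>q\<in>X j t. U q) \<subseteq> D j t"
          unfolding D_def by blast
        show "\<forall>n\<in>D j t - (\<Union>q\<in>X j t. U q). Re (a n * trig_system n x) = 0"
          unfolding D_def by (auto simp: a_def)
      qed
      also have "\<dots> = (\<Sum>q\<in>X j t. \<Sum>n\<in>U q. Re (a n * trig_system n x))"
        by (rule sum_U[OF finX])
      also have "\<dots> = (\<Sum>q\<in>X j t. c (tree_level q) * H q)"
      proof (rule sum.cong)
        fix q assume "q \<in> X j t"
        then have q: "q \<ge> 1" using finX(2) by auto
        show "(\<Sum>n\<in>U q. Re (a n * trig_system n x)) = c (tree_level q) * H q"
          unfolding H_def sum_distrib_left by (intro sum.cong) (auto simp: a_eq[OF q] algebra_simps)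
      qed simp
      finally show ?thesis .
    qed
    define j where "j = max J N1"
    have jJ: "j \<ge> J" "Suc j \<ge> J"
      unfolding j_def by auto
    \<comment> \<open>b is the leaf level for block j; the block will be cut at the leaf p on the
      path of x.\<close>
    define b where "b = L (Suc j)"
    obtain p where p: "p \<in> {2 ^ b..<2 ^ Suc b}" "F p x = 1"
      using path_exists[of "\<lambda>q. F q x" b] F1 F01 Fch by auto
    define Bl where "Bl = {q \<in> B j. before j p q}"
    define Br where "Br = {q \<in> B j. \<not> before j p q}"
    have finB: "finite (B j)"
      by (simp add: B_def)
    have splitB: "sum f (B j) = sum f Bl + sum f Br" for f :: "nat \<Rightarrow> real"
    proof -
      have "B j = Bl \<union> Br" "Bl \<inter> Br = {}" "finite Bl" "finite Br"
        using finB unfolding Bl_def Br_def by auto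
      then show ?thesis
        by (simp add: sum.union_disjoint)
    qed
    have XB: "sum f (X j p) = sum f (X j 0) + sum f Bl" for f :: "nat \<Rightarrow> real"
    proof -
      have "X j p = X j 0 \<union> Bl" "X j 0 \<inter> Bl = {}"
        unfolding X0 unfolding X_def Bl_def B_def by auto
      then show ?thesis
        using finX(1)[of j 0] finB by (simp add: sum.union_disjoint Bl_def)
    qed
    have XS: "sum f (X (Suc j) 0) = sum f (X j 0) + sum f (B j)" for f :: "nat \<Rightarrow> real"
      unfolding X0 B_def using Lmono[of j "Suc j"] by (intro sum.atLeastLessThan_concat[symmetric]) auto
    have left: "(\<Sum>q\<in>Bl. c (tree_level q) * H q) < 1 / 4"
    proof -
      have "(\<Sum>q\<in>Bl. c (tree_level q) * H q) = val (D j p) - val (D j 0)"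
        unfolding val_D XB by simp
      then show ?thesis
        using val_near[OF jJ(1), of p] val_near[OF jJ(1), of 0] unfolding abs_less_iff by linarith
    qed
    have right: "- (\<Sum>q\<in>Br. c (tree_level q) * H q) < 1 / 4"
    proof -
      have "(\<Sum>q\<in>Br. c (tree_level q) * H q) = val (D (Suc j) 0) - val (D j p)"
        unfolding val_D XB XS splitB by simp
      then show ?thesis
        using val_near[OF jJ(1), of p] val_near[OF jJ(2), of 0] unfolding abs_less_iff by linarith
    qed
    \<comment> \<open>Up to the cut the path never takes the left child, so wave and indicator
      agree; after the cut it never takes the right child, and they are opposite.\<close>
    have SBl: "F q x = S q" if "q \<in> Bl" for q
    proof -
      have q: "q \<ge> 1" "tree_level q < b"
        using Bge[of q j] that unfolding Bl_def b_def by auto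
      have "F (2 * q) x = 0"
        by (rule inorder_left[of "\<lambda>q. F q x", OF F1 F01 Fch p q]) (use that in \<open>auto simp: Bl_def before_def b_def\<close>)
      then show ?thesis
        using Fch[OF q(1), of x] unfolding S_def by simp
    qed
    have SBr: "F q x = - S q" if "q \<in> Br" for q
    proof -
      have q: "q \<ge> 1" "tree_level q < b"
        using Bge[of q j] that unfolding Br_def b_def by auto
      have "F (Suc (2 * q)) x = 0"
        by (rule inorder_right[of "\<lambda>q. F q x", OF F1 F01 Fch p q]) (use that in \<open>auto simp: Br_def before_def b_def\<close>)
      then show ?thesis
        using Fch[OF q(1), of x] unfolding S_def by simp
    qed
    have "1 = (\<Sum>k\<in>{L j..<L (Suc j)}. c k * (\<Sum>q\<in>{2 ^ k..<2 ^ Suc k}. F q x))"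
      using sum_tree_level[of "\<lambda>q. F q x", OF F1 Fch] csum[of j] by simp
    also have "\<dots> = (\<Sum>k\<in>{L j..<L (Suc j)}. \<Sum>q\<in>{2 ^ k..<2 ^ Suc k}. c (tree_level q) * F q x)"
      unfolding sum_distrib_left
    proof (intro sum.cong refl)
      fix k q :: nat assume q: "q \<in> {2 ^ k..<2 ^ Suc k}"
      then have "q \<ge> 1" by (rule level_ge1)
      then have "tree_level q = k" using q tree_level_eq_iff by blast
      then show "c k * F q x = c (tree_level q) * F q x" by simp
    qed
    also have "\<dots> = (\<Sum>q\<in>B j. c (tree_level q) * F q x)"
      unfolding B_def using L by (intro sum_levels[symmetric]) (auto simp: strict_mono_less_eq)
    also have "\<dots> = (\<Sum>q\<in>Bl. c (tree_level q) * S q) + (\<Sum>q\<in>Br. - (c (tree_level q) * S q))"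
      unfolding splitB by (intro arg_cong2[of _ _ _ _ "(+)"] sum.cong) (auto simp: SBl SBr)
    also have "\<dots> \<le> (\<Sum>q\<in>Bl. c (tree_level q) * H q + \<bar>H q - S q\<bar>) + (\<Sum>q\<in>Br. - (c (tree_level q) * H q) + \<bar>H q - S q\<bar>)"
    proof -
      \<comment> \<open>The bound c <= 1 lets the unweighted errors dominate the weighted
        ones.\<close>
      have *: "\<bar>c (tree_level q) * (H q - S q)\<bar> \<le> \<bar>H q - S q\<bar>" for q
        using c01[of "tree_level q"] by (simp add: abs_mult mult_left_le_one_le)
      have "c (tree_level q) * S q \<le> c (tree_level q) * H q + \<bar>H q - S q\<bar>" "- (c (tree_level q) * S q)
          \<le> - (c (tree_level q) * H q) + \<bar>H q - S q\<bar>" for q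
        using *[of q] by (auto simp: right_diff_distrib abs_le_iff)
      then show ?thesis
        by (intro add_mono sum_mono)
    qed
    also have "\<dots> = (\<Sum>q\<in>Bl. c (tree_level q) * H q) - (\<Sum>q\<in>Br. c (tree_level q) * H q) + (\<Sum>q\<in>B j. \<bar>H q - S q\<bar>)"
      unfolding splitB by (simp add: sum.distrib sum_negf sum_subtractf)
    also have "(\<Sum>q\<in>B j. \<bar>H q - S q\<bar>) < 1 / 4"
    proof -
      \<comment> \<open>The errors are summed with index \<open>Suc i\<close>, hence the shift of
        both ends of the block by one.\<close>
      define m where "m = (2::nat) ^ L j - 1"
      define n where "n = (2::nat) ^ L (Suc j) - 1"
      have B: "B j = {Suc m..<Suc n}"
        by (simp add: B_def m_def n_def)
      have "N1 \<le> L j"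
        using strict_mono_imp_increasing[OF L, of j] unfolding j_def by simp
      also have "L j < 2 ^ L j" by (rule less_exp)
      finally have "N1 \<le> m"
        unfolding m_def by simp
      then show ?thesis
        using N1[of m n] unfolding B sum.shift_bounds_Suc_ivl by simp
    qed
    finally show False
      using left right by linarith
  qed
  then have "AE x in lebesgue_on {0<..<1}. \<not> convergent (rearranged_partial_sum trig_system a \<sigma> x)"
    by (rule AE_lebesgue_on_of_AE_unit)
  ultimately show ?thesis
    using \<sigma> by blast
qed

theorem corollary1p3:
  fixes w :: "nat \<Rightarrow> real"
  assumes "\<And>n. n \<ge> 1 \<Longrightarrow> w n > 0"
    and "mono_on {1..} w"
    and "filterlim (\<lambda>N. \<Sum>n=1..N. 1 / (real n * w n)) at_top sequentially"
  shows "\<not> UC_multiplier trig_system w \<and>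
    (\<exists>a :: nat \<Rightarrow> complex.
       (\<lambda>n. (cmod (a n))\<^sup>2 * w n) summable_on {1..} \<and>
       (\<exists>\<sigma>. bij_betw \<sigma> {1..} {1..} \<and>
          (AE x in lebesgue_on {0<..<1}.
             \<not> convergent (rearranged_partial_sum trig_system a \<sigma> x))))"
proof (intro conjI notI)
  from ae_divergent_rearrangement_exists[OF assms] obtain a :: "nat \<Rightarrow> complex" and \<sigma> where
    *: "(\<lambda>n. (cmod (a n))\<^sup>2 * w n) summable_on {1..}" "bij_betw \<sigma> {1..} {1..}"
    "AE x in lebesgue_on {0<..<1}. \<not> convergent (rearranged_partial_sum trig_system a \<sigma> x)"
    by blast
  assume "UC_multiplier trig_system w"
  then have "AE x in lebesgue_on {0<..<1}. convergent (rearranged_partial_sum trig_system a \<sigma> x)"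
    using * unfolding UC_multiplier_def by blast
  \<comment> \<open>The interval has positive measure, so convergence cannot both hold and fail
    almost everywhere on it.\<close>
  with *(3) have "AE x in lebesgue_on {0<..<1::real}. False"
    by eventually_elim simp
  then show False
    by (simp add: eventually_False ae_filter_eq_bot_iff space_restrict_space emeasure_restrict_space)
qed (rule ae_divergent_rearrangement_exists[OF assms])

end
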